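(* Let $X,X_1,X_2,\ldots$ be i.i.d. random points in $\mathbb{R}^d$ whose common distribution $\mu$ has a density $f$ with respect to Lebesgue measure. Suppose that the support of $\mu$ is $[0,1]^d$ and that there are constants $f_-,f_+\in(0,\infty)$ such that $f_-\le f(x)\le f_+$ for all $x\in[0,1]^d$. Fix an integer $k\ge 1$ and let $P_{n,k}=\max_{1\le i\le n}\mu(B(X_i,R_{i,n,k}))$. Then for every $t\in\mathbb{R}$, $$\lim_{n\to\infty}\mathbb{P}\big(nP_{n,k}-\log n-(k-1)\log\log n+\log (k-1)!\le t\big)=\exp(-\exp(-t)).$$
   Context: $\|\cdot\|$ is the Euclidean norm on $\mathbb{R}^d$ and $B(x,r)=\{y\in\mathbb{R}^d:\|x-y\|\le r\}$. For $k\le n-1$ and $i\in\{1,\ldots,n\}$, $R_{i,n,k}$ denotes the Euclidean distance of $X_i$ to its $k$th-nearest neighbor among $\{X_1,\ldots,X_n\}\setminus\{X_i\}$. *)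

theory Defs
  imports "HOL-Probability.Probability"
begin

definition measure_support :: "'a::topological_space measure \<Rightarrow> 'a set" where
  "measure_support \<mu> = {x. \<forall>U. open U \<and> x \<in> U \<longrightarrow> emeasure \<mu> U > 0}"

text \<open>The sample is the family \<open>x 1, \<dots>, x n\<close>; the \<open>k\<close>-th nearest-neighbour distance is the
  \<open>k\<close>-th smallest of the distances from \<open>x i\<close> to the other members, counted by index. It is
  meaningful for \<open>1 \<le> i \<le> n\<close> and \<open>1 \<le> k \<le> n - 1\<close> only.\<close>

definition knn_dist :: "(nat \<Rightarrow> 'a::metric_space) \<Rightarrow> nat \<Rightarrow> nat \<Rightarrow> nat \<Rightarrow> real" where
  "knn_dist x i n k =
     sort (map (\<lambda>j. dist (x i) (x j)) (filter (\<lambda>j. j \<noteq> i) [1..<Suc n])) ! (k - 1)"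

definition max_knn_ball_measure ::
  "'a::metric_space measure \<Rightarrow> (nat \<Rightarrow> 'a) \<Rightarrow> nat \<Rightarrow> nat \<Rightarrow> real" where
  "max_knn_ball_measure \<mu> x n k =
     Max ((\<lambda>i. measure \<mu> (cball (x i) (knn_dist x i n k))) ` {1..n})"

end

theory Submission
  imports Defs "HOL-Real_Asymp.Real_Asymp"
begin

text \<open>Let \<open>v = y / n\<close> with \<open>y = t + log n + (k - 1) log log n - log (k - 1)!\<close>, let \<open>r x\<close> be the radius with
  \<open>\<mu> (cball x (r x)) = v\<close>, and call \<open>X\<^sub>i\<close> sparse if \<open>cball X\<^sub>i (r X\<^sub>i)\<close> contains fewer than \<open>k\<close> other
  sample points. The event of the theorem is that no point is sparse. For points whose balls are disjoint the
  probability that all of them are sparse does not depend on their positions, so the expected number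
  of \<open>m\<close>-sets of sparse points at mutual distance \<open>> s\<close>, where \<open>s \<ge> 2 r\<close>, is asymptotically
  \<open>exp (- t) ^ m / m!\<close>. Pairs of sparse points at distance \<open>\<le> s\<close> are asymptotically absent: near
  the boundary there are too few pairs; if the points are very close, each must have one fewer
  further neighbour, which costs a factor \<open>log n\<close>; otherwise the union of the two balls has mass
  noticeably larger than \<open>v\<close>. A ball of diameter \<open>\<le> r\<close> holds at most \<open>k\<close> sparse points,
  so the number of sparse points is at most a constant multiple of the size of a separated subset,
  which gives the uniform integrability needed to conclude with Bonferroni's inequalities.\<close>

section \<open>Sparse cells in a product measure\<close>

text \<open>The radius depends on the centre so that every ball has mass exactly v; position then
  disappears from the occupancy law of separated points. The equivalence with the theorem is
  monotonicity: \<open>r x\<close> is the largest radius of mass at most v, so a k-th neighbour ball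
  has mass at most v exactly when its radius is at most \<open>r x\<close>, that is, when at least k
  other points lie within \<open>r x\<close>. Ordinary factorial moments would require estimates for
  clusters of every size. Counting only separated m-sets avoids this, at the price that the counts
  are binomial moments only off the near-pair event. The threshold \<rho> between very close and
  moderately close pairs has \<rho>^d of order v / sqrt y. Very close pairs then gain a factor 1 /
  sqrt y over pairs at the scale of the radii, while for the others n times the surplus mass of the
  union is of order sqrt y, and exp (- c * sqrt y) beats every power of y. Centres in a boundary
  layer are treated apart because there the surplus may lie outside the cube.\<close>

lemma (in prob_space) measure_PiM_fold_le:
  assumes "finite I" "S \<subseteq> I" and E: "E \<in> sets (PiM I (\<lambda>_. M))" and G: "G \<in> sets (PiM S (\<lambda>_. M))"
    and "0 \<le> c"
    and out: "\<And>x y. x \<in> space (PiM S (\<lambda>_. M)) \<Longrightarrow> x \<notin> G \<Longrightarrow> y \<in> space (PiM (I - S) (\<lambda>_. M))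
        \<Longrightarrow> merge S (I - S) (x, y) \<notin> E"
    and le: "\<And>x. x \<in> G \<Longrightarrow> measure (PiM (I - S) (\<lambda>_. M))
        {y \<in> space (PiM (I - S) (\<lambda>_. M)). merge S (I - S) (x, y) \<in> E} \<le> c"
  shows "measure (PiM I (\<lambda>_. M)) E \<le> c * measure (PiM S (\<lambda>_. M)) G"
proof -
  note ps = prob_space_axioms
  interpret product_prob_space "\<lambda>_. M" I ..
  interpret S: prob_space "PiM S (\<lambda>_. M)" by (intro prob_space_PiM ps)
  interpret R: prob_space "PiM (I - S) (\<lambda>_. M)" by (intro prob_space_PiM ps)
  have IS: "S \<union> (I - S) = I" using \<open>S \<subseteq> I\<close> by auto
  have "emeasure (PiM I (\<lambda>_. M)) E = (\<integral>\<^sup>+x. emeasure (PiM (I - S) (\<lambda>_. M))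
      ((\<lambda>y. merge S (I - S) (x, y)) -` E \<inter> space (PiM (I - S) (\<lambda>_. M))) \<partial>PiM S (\<lambda>_. M))"
    using emeasure_fold_integral[of S "I - S" E, unfolded IS] assms(1) E finite_subset[OF \<open>S \<subseteq> I\<close>]
    by simp
  also have "\<dots> \<le> (\<integral>\<^sup>+x. ennreal c * indicator G x \<partial>PiM S (\<lambda>_. M))"
  proof (rule nn_integral_mono)
    fix x assume x: "x \<in> space (PiM S (\<lambda>_. M))"
    have eq: "(\<lambda>y. merge S (I - S) (x, y)) -` E \<inter> space (PiM (I - S) (\<lambda>_. M))
        = {y \<in> space (PiM (I - S) (\<lambda>_. M)). merge S (I - S) (x, y) \<in> E}" by auto
    show "emeasure (PiM (I - S) (\<lambda>_. M))
      ((\<lambda>y. merge S (I - S) (x, y)) -` E \<inter> space (PiM (I - S) (\<lambda>_. M))) \<le> ennreal c * indicator G x"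
    proof (cases "x \<in> G")
      case True
      then show ?thesis using le[OF True] unfolding eq
        by (simp add: R.emeasure_eq_measure ennreal_leI)
    next
      case False
      then have "{y \<in> space (PiM (I - S) (\<lambda>_. M)). merge S (I - S) (x, y) \<in> E} = {}"
        using out[OF x False] by auto
      then show ?thesis unfolding eq by (simp only:) simp
    qed
  qed
  also have "\<dots> = ennreal c * emeasure (PiM S (\<lambda>_. M)) G"
    using G by (simp add: nn_integral_cmult_indicator)
  finally have "ennreal (measure (PiM I (\<lambda>_. M)) E) \<le> ennreal (c * measure (PiM S (\<lambda>_. M)) G)"
    using \<open>0 \<le> c\<close> by (simp add: P.emeasure_eq_measure S.emeasure_eq_measure ennreal_mult)
  then show ?thesis using \<open>0 \<le> c\<close> by (simp add: ennreal_le_iff)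
qed

text \<open>Fubini with the coordinates in \<open>S\<close> frozen, as for the inequality: off
  \<open>G\<close> the fibre is empty, over \<open>G\<close> it has the constant mass
  \<open>c\<close>. The sign of \<open>c\<close> follows as soon as \<open>G\<close> has a point,
  which explains the case split at the end.\<close>

lemma (in prob_space) measure_PiM_fold_eq:
  assumes "finite I" "S \<subseteq> I" and E: "E \<in> sets (PiM I (\<lambda>_. M))" and G: "G \<in> sets (PiM S (\<lambda>_. M))"
    and out: "\<And>x y. x \<in> space (PiM S (\<lambda>_. M)) \<Longrightarrow> x \<notin> G \<Longrightarrow> y \<in> space (PiM (I - S) (\<lambda>_. M))
        \<Longrightarrow> merge S (I - S) (x, y) \<notin> E"
    and eq_c: "\<And>x. x \<in> G \<Longrightarrow> measure (PiM (I - S) (\<lambda>_. M))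
        {y \<in> space (PiM (I - S) (\<lambda>_. M)). merge S (I - S) (x, y) \<in> E} = c"
  shows "measure (PiM I (\<lambda>_. M)) E = c * measure (PiM S (\<lambda>_. M)) G"
proof -
  note ps = prob_space_axioms
  interpret product_prob_space "\<lambda>_. M" I ..
  interpret S: prob_space "PiM S (\<lambda>_. M)" by (intro prob_space_PiM ps)
  interpret R: prob_space "PiM (I - S) (\<lambda>_. M)" by (intro prob_space_PiM ps)
  have IS: "S \<union> (I - S) = I" using \<open>S \<subseteq> I\<close> by auto
  have "emeasure (PiM I (\<lambda>_. M)) E = (\<integral>\<^sup>+x. emeasure (PiM (I - S) (\<lambda>_. M))
      ((\<lambda>y. merge S (I - S) (x, y)) -` E \<inter> space (PiM (I - S) (\<lambda>_. M))) \<partial>PiM S (\<lambda>_. M))"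
    using emeasure_fold_integral[of S "I - S" E, unfolded IS] assms(1) E finite_subset[OF \<open>S \<subseteq> I\<close>]
    by simp
  also have "\<dots> = (\<integral>\<^sup>+x. ennreal c * indicator G x \<partial>PiM S (\<lambda>_. M))"
  proof (rule nn_integral_cong)
    fix x assume x: "x \<in> space (PiM S (\<lambda>_. M))"
    have eq: "(\<lambda>y. merge S (I - S) (x, y)) -` E \<inter> space (PiM (I - S) (\<lambda>_. M))
        = {y \<in> space (PiM (I - S) (\<lambda>_. M)). merge S (I - S) (x, y) \<in> E}" by auto
    show "emeasure (PiM (I - S) (\<lambda>_. M))
      ((\<lambda>y. merge S (I - S) (x, y)) -` E \<inter> space (PiM (I - S) (\<lambda>_. M))) = ennreal c * indicator G x"
    proof (cases "x \<in> G")
      case True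
      then show ?thesis using eq_c[OF True] unfolding eq
        by (simp add: R.emeasure_eq_measure)
    next
      case False
      then have "{y \<in> space (PiM (I - S) (\<lambda>_. M)). merge S (I - S) (x, y) \<in> E} = {}"
        using out[OF x False] by auto
      then show ?thesis unfolding eq using False by (simp only:) simp
    qed
  qed
  also have "\<dots> = ennreal c * emeasure (PiM S (\<lambda>_. M)) G"
    using G by (simp add: nn_integral_cmult_indicator)
  finally have *: "ennreal (measure (PiM I (\<lambda>_. M)) E) = ennreal c * ennreal (measure (PiM S (\<lambda>_. M)) G)"
    by (simp add: P.emeasure_eq_measure S.emeasure_eq_measure)
  show ?thesis
  proof (cases "G = {}")
    case True
    then have "ennreal (measure (PiM I (\<lambda>_. M)) E) = 0" using * by simp
    then show ?thesis using True by (simp add: ennreal_eq_0_iff measure_le_0_iff)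
  next
    case False
    then obtain x where "x \<in> G" by auto
    have "0 \<le> c" unfolding eq_c[OF \<open>x \<in> G\<close>, symmetric] by simp
    then have "ennreal (measure (PiM I (\<lambda>_. M)) E) = ennreal (c * measure (PiM S (\<lambda>_. M)) G)"
      using * by (simp add: ennreal_mult)
    then show ?thesis using \<open>0 \<le> c\<close> by (subst (asm) ennreal_inj) auto
  qed
qed

lemma (in prob_space) measure_PiM_merge_Times:
  assumes "finite I" "J \<subseteq> I" and A: "A \<in> sets (PiM J (\<lambda>_. M))" and B: "B \<in> sets (PiM (I - J) (\<lambda>_. M))"
    and E: "E \<in> sets (PiM I (\<lambda>_. M))"
    and iff: "\<And>x y. x \<in> space (PiM J (\<lambda>_. M)) \<Longrightarrow> y \<in> space (PiM (I - J) (\<lambda>_. M))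
        \<Longrightarrow> merge J (I - J) (x, y) \<in> E \<longleftrightarrow> x \<in> A \<and> y \<in> B"
  shows "measure (PiM I (\<lambda>_. M)) E = measure (PiM (I - J) (\<lambda>_. M)) B * measure (PiM J (\<lambda>_. M)) A"
proof (rule measure_PiM_fold_eq[OF assms(1,2) E A])
  fix x assume "x \<in> A"
  then have "x \<in> space (PiM J (\<lambda>_. M))" using A sets.sets_into_space by auto
  then have "{y \<in> space (PiM (I - J) (\<lambda>_. M)). merge J (I - J) (x, y) \<in> E} = B"
    using iff \<open>x \<in> A\<close> sets.sets_into_space[OF B] by auto
  then show "measure (PiM (I - J) (\<lambda>_. M))
      {y \<in> space (PiM (I - J) (\<lambda>_. M)). merge J (I - J) (x, y) \<in> E} = measure (PiM (I - J) (\<lambda>_. M)) B" by simp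
qed (use iff in auto)

section \<open>Measurability of occupancy counts\<close>

lemma measurable_card_pred [measurable (raw)]:
  assumes "finite T" "\<And>j. j \<in> T \<Longrightarrow> Measurable.pred N (P j)"
  shows "(\<lambda>x. card {j \<in> T. P j x}) \<in> measurable N (count_space UNIV)"
proof -
  have "(\<lambda>x. card {j \<in> T. P j x}) = (\<lambda>x. \<Sum>j\<in>T. if P j x then 1 else 0)"
    using assms(1) by (auto simp: fun_eq_iff sum.If_cases Int_def)
  moreover have "(\<lambda>x. \<Sum>j\<in>T. if P j x then 1 else 0 :: nat) \<in> measurable N (count_space UNIV)"
    using assms by (induction T rule: finite_induct) auto
  ultimately show ?thesis by simp
qed

lemma pred_less_const:
  fixes g :: "'a \<Rightarrow> nat"
  assumes "g \<in> measurable N (count_space UNIV)"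
  shows "Measurable.pred N (\<lambda>x. g x < k)"
  using assms by measurable

lemma pred_le_real:
  fixes f g :: "'b \<Rightarrow> real"
  assumes "f \<in> borel_measurable N" "g \<in> borel_measurable N"
  shows "Measurable.pred N (\<lambda>x. f x \<le> g x)"
  using assms by measurable

lemma pred_component:
  assumes "j \<in> T" "B \<in> sets N"
  shows "Measurable.pred (PiM T (\<lambda>_. N)) (\<lambda>y. y j \<in> B)"
proof -
  note [measurable] = assms(2)
  have [measurable]: "(\<lambda>y. y j) \<in> measurable (PiM T (\<lambda>_. N)) N"
    using assms(1) by (rule measurable_component_singleton)
  show ?thesis by measurable
qed

section \<open>Joint occupancy probabilities of disjoint cells\<close>

text \<open>The probability that each of \<open>m\<close> disjoint cells of mass \<open>v\<close> receives fewer than \<open>k\<close> of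
  \<open>N\<close> independent points and that a further disjoint cell of mass \<open>c\<close> receives none, computed by
  exposing the cells one at a time.\<close>

fun sparse_prob :: "nat \<Rightarrow> real \<Rightarrow> nat \<Rightarrow> nat \<Rightarrow> real \<Rightarrow> real" where
  "sparse_prob k v 0 N c = (1 - c) ^ N"
| "sparse_prob k v (Suc m) N c =
     (\<Sum>j<k. real (N choose j) * v ^ j * sparse_prob k v m (N - j) (c + v))"

lemma sparse_prob_nonneg:
  assumes "0 \<le> v" "c + real m * v \<le> 1"
  shows "0 \<le> sparse_prob k v m N c"
  using assms(2)
proof (induction m arbitrary: N c)
  case (Suc m)
  then have "0 \<le> sparse_prob k v m (N - j) (c + v)" for j
    by (intro Suc.IH) (simp add: algebra_simps)
  then show ?case using assms(1) by (auto intro!: sum_nonneg mult_nonneg_nonneg)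
qed simp

lemma sum_subsets_card:
  fixes g :: "nat \<Rightarrow> real"
  assumes "finite T"
  shows "(\<Sum>J\<in>{J. J \<subseteq> T \<and> card J < k}. g (card J)) = (\<Sum>j<k. real (card T choose j) * g j)"
proof -
  have fin: "finite {J. J \<subseteq> T \<and> card J = j}" for j using assms by simp
  have "{J. J \<subseteq> T \<and> card J < k} = (\<Union>j\<in>{..<k}. {J. J \<subseteq> T \<and> card J = j})" by auto
  then have "(\<Sum>J\<in>{J. J \<subseteq> T \<and> card J < k}. g (card J))
      = (\<Sum>j<k. \<Sum>J\<in>{J. J \<subseteq> T \<and> card J = j}. g (card J))"
    using fin by (simp only:) (subst sum.UNION_disjoint, auto)
  also have "\<dots> = (\<Sum>j<k. real (card T choose j) * g j)"
    by (intro sum.cong refl) (simp add: n_subsets[OF assms])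
  finally show ?thesis .
qed

text \<open>Induction over the cells with \<open>T\<close> and \<open>C\<close> arbitrary: once the
  exact set of indices falling into the new cell is known, the remaining indices must avoid it, so
  the cell is absorbed into the forbidden set \<open>C\<close> and \<open>T\<close> shrinks. Working
  with joint rather than conditional probabilities avoids renormalising the mass after each
  exposure.\<close>

lemma (in prob_space) sparse_cells:
  assumes "finite S" "finite T" "\<And>i. i \<in> S \<Longrightarrow> B i \<in> sets M" "disjoint_family_on B S"
    "\<And>i. i \<in> S \<Longrightarrow> measure M (B i) = v" "C \<in> sets M" "\<And>i. i \<in> S \<Longrightarrow> B i \<inter> C = {}"
  shows "measure (PiM T (\<lambda>_. M)) {y \<in> space (PiM T (\<lambda>_. M)).
      (\<forall>i\<in>S. card {j \<in> T. y j \<in> B i} < k) \<and> (\<forall>j\<in>T. y j \<notin> C)}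
    = sparse_prob k v (card S) (card T) (measure M C)"
  using assms
proof (induction S arbitrary: T C rule: finite_induct)
  case empty
  note ps = prob_space_axioms
  interpret P: finite_product_prob_space "\<lambda>_. M" T by standard (rule empty.prems)
  have "{y \<in> space (PiM T (\<lambda>_. M)). \<forall>j\<in>T. y j \<notin> C} = (PiE T (\<lambda>_. space M - C))"
    by (auto simp: space_PiM PiE_iff extensional_def)
  moreover have "measure (PiM T (\<lambda>_. M)) (PiE T (\<lambda>_. space M - C)) = (\<Prod>j\<in>T. measure M (space M - C))"
    using empty by (intro P.prob_times) auto
  ultimately show ?case using empty by (simp add: prob_compl)
next
  case (insert i S)
  note ps = prob_space_axioms
  interpret P: product_prob_space "\<lambda>_. M" T ..
  note [measurable] = insert.prems(2)[of i] insert.prems(5)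
  have Bm[measurable]: "i' \<in> S \<Longrightarrow> B i' \<in> sets M" for i' using insert.prems(2) by auto
  \<comment> \<open>\<open>F J\<close> fixes the exact index set \<open>J\<close> that hits
    \<open>B i\<close>. These events are disjoint, and those with \<open>card J < k\<close> exhaust
    the event in question.\<close>
  define F where "F J = {y \<in> space (PiM T (\<lambda>_. M)).
      {j\<in>T. y j \<in> B i} = J \<and> (\<forall>i'\<in>S. card {j \<in> T. y j \<in> B i'} < k) \<and> (\<forall>j\<in>T. y j \<notin> C)}" for J
  have disj: "i' \<in> S \<Longrightarrow> B i' \<inter> B i = {}" for i'
    using insert.prems(3) insert.hyps(2) by (auto simp: disjoint_family_on_def)
  \<comment> \<open>Disjointness of the cells frees every other cell and \<open>C\<close> from the
    indices in \<open>J\<close>, so \<open>F J\<close> splits into a condition on the coordinates in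
    \<open>J\<close> and one on those in \<open>T - J\<close>.\<close>
  have Feq: "F J = {y \<in> space (PiM T (\<lambda>_. M)). (\<forall>j\<in>J. y j \<in> B i) \<and>
      (\<forall>i'\<in>S. card {j \<in> T-J. y j \<in> B i'} < k) \<and> (\<forall>j\<in>T-J. y j \<notin> C \<union> B i)}" if "J \<subseteq> T" for J
  proof -
    have a: "{j \<in> T. y j \<in> B i'} = {j \<in> T-J. y j \<in> B i'}" if "\<forall>j\<in>J. y j \<in> B i" "i' \<in> S" for y i'
      using disj that \<open>J \<subseteq> T\<close> by blast
    have b: "y j \<notin> C" if "\<forall>j\<in>J. y j \<in> B i" "j \<in> J" for y j
      using insert.prems(6)[of i] that by blast
    have c: "{j\<in>T. y j \<in> B i} = J \<longleftrightarrow> (\<forall>j\<in>J. y j \<in> B i) \<and> (\<forall>j\<in>T-J. y j \<notin> B i)" for y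
      using that by blast
    show ?thesis
    proof (rule set_eqI)
      fix y
      show "y \<in> F J \<longleftrightarrow> y \<in> {y \<in> space (PiM T (\<lambda>_. M)). (\<forall>j\<in>J. y j \<in> B i) \<and>
        (\<forall>i'\<in>S. card {j \<in> T-J. y j \<in> B i'} < k) \<and> (\<forall>j\<in>T-J. y j \<notin> C \<union> B i)}"
      proof (cases "\<forall>j\<in>J. y j \<in> B i")
        case True
        have 1: "(\<forall>i'\<in>S. card {j \<in> T. y j \<in> B i'} < k) = (\<forall>i'\<in>S. card {j \<in> T-J. y j \<in> B i'} < k)"
          using a[OF True] by (intro ball_cong) simp_all
        have 2: "(\<forall>j\<in>T. y j \<notin> C) = (\<forall>j\<in>T-J. y j \<notin> C)"
          using b[OF True] by blast
        show ?thesis unfolding F_def mem_Collect_eq c 1 2 by blast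
      qed (unfold F_def mem_Collect_eq c, blast)
    qed
  qed
  have Fm: "F J \<in> sets (PiM T (\<lambda>_. M))" if "J \<subseteq> T" for J
  proof -
    show ?thesis unfolding Feq[OF that]
      using that insert.prems(1) insert.hyps finite_subset[OF that]
      by (intro predE pred_intros_logic(2,3) pred_intros_finite(3) pred_less_const measurable_card_pred
          pred_component) auto
  qed
  have Fmeas: "measure (PiM T (\<lambda>_. M)) (F J)
      = v ^ card J * sparse_prob k v (card S) (card T - card J) (measure M C + v)" if J: "J \<subseteq> T" for J
  proof -
    have finJ: "finite J" "finite (T - J)" using J insert.prems(1) finite_subset by auto
    interpret J: finite_product_prob_space "\<lambda>_. M" J by standard (rule finJ)
    define A where "A = PiE J (\<lambda>_. B i)"
    define B' where "B' = {y \<in> space (PiM (T-J) (\<lambda>_. M)).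
      (\<forall>i'\<in>S. card {j \<in> T-J. y j \<in> B i'} < k) \<and> (\<forall>j\<in>T-J. y j \<notin> C \<union> B i)}"
    have Am: "A \<in> sets (PiM J (\<lambda>_. M))" unfolding A_def using finJ by (intro sets_PiM_I_finite) auto
    have B'm: "B' \<in> sets (PiM (T-J) (\<lambda>_. M))"
    proof -
      show ?thesis unfolding B'_def using finJ insert.hyps
        by (intro predE pred_intros_logic(2,3) pred_intros_finite(3) pred_less_const measurable_card_pred
            pred_component) auto
    qed
    have "measure (PiM T (\<lambda>_. M)) (F J) = measure (PiM (T - J) (\<lambda>_. M)) B' * measure (PiM J (\<lambda>_. M)) A"
    proof (rule measure_PiM_merge_Times[OF insert.prems(1) J Am B'm Fm[OF J]])
      fix x y assume xy: "x \<in> space (PiM J (\<lambda>_. M))" "y \<in> space (PiM (T - J) (\<lambda>_. M))"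
      then have sp: "merge J (T - J) (x, y) \<in> space (PiM T (\<lambda>_. M))"
        using J by (auto simp: space_PiM PiE_iff merge_def extensional_def)
      have 1: "{j \<in> T - J. merge J (T - J) (x, y) j \<in> B i'} = {j \<in> T - J. y j \<in> B i'}" for i'
        by (auto simp: merge_def)
      have 2: "(\<forall>j\<in>T - J. merge J (T - J) (x, y) j \<notin> C \<union> B i) = (\<forall>j\<in>T-J. y j \<notin> C \<union> B i)"
        by (auto simp: merge_def)
      have 3: "(\<forall>j\<in>J. merge J (T - J) (x, y) j \<in> B i) = (x \<in> A)"
        using xy by (auto simp: merge_def A_def space_PiM PiE_iff)
      show "(merge J (T - J) (x, y) \<in> F J) = (x \<in> A \<and> y \<in> B')"
        unfolding Feq[OF J] B'_def mem_Collect_eq 1 2 3 using sp xy by simp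
    qed
    also have "measure (PiM J (\<lambda>_. M)) A = v ^ card J"
      unfolding A_def using insert.prems(4)[of i] by (subst J.prob_times) auto
    also have "measure (PiM (T - J) (\<lambda>_. M)) B'
        = sparse_prob k v (card S) (card (T - J)) (measure M (C \<union> B i))"
      unfolding B'_def
    proof (rule insert.IH)
      show "disjoint_family_on B S" using insert.prems(3) by (auto simp: disjoint_family_on_def)
      show "B i' \<inter> (C \<union> B i) = {}" if "i' \<in> S" for i'
        using disj[OF that] insert.prems(6)[of i'] that by auto
    qed (use finJ insert.prems(4) in auto)
    also have "measure M (C \<union> B i) = measure M C + v"
      using insert.prems(4)[of i] insert.prems(6)[of i] by (subst finite_measure_Union) auto
    finally show ?thesis using card_Diff_subset[OF finJ(1) J] by simp
  qed
  have "{y \<in> space (PiM T (\<lambda>_. M)). (\<forall>i\<in>insert i S. card {j \<in> T. y j \<in> B i} < k) \<and> (\<forall>j\<in>T. y j \<notin> C)}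
      = (\<Union>J\<in>{J. J \<subseteq> T \<and> card J < k}. F J)"
    by (auto simp: F_def)
  also have "measure (PiM T (\<lambda>_. M)) \<dots> = (\<Sum>J\<in>{J. J \<subseteq> T \<and> card J < k}. measure (PiM T (\<lambda>_. M)) (F J))"
    using insert.prems(1) Fm
    by (intro P.finite_measure_finite_Union) (auto simp: disjoint_family_on_def F_def)
  also have "\<dots> = (\<Sum>J\<in>{J. J \<subseteq> T \<and> card J < k}.
      v ^ card J * sparse_prob k v (card S) (card T - card J) (measure M C + v))"
    by (intro sum.cong) (auto simp: Fmeas)
  also have "\<dots> = sparse_prob k v (Suc (card S)) (card T) (measure M C)"
    by (subst sum_subsets_card[OF insert.prems(1)]) (simp add: mult.assoc)
  finally show ?case using insert.hyps by simp
qed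

lemma (in prob_space) sparse_cell_single:
  assumes "finite T" "B \<in> sets M"
  shows "measure (PiM T (\<lambda>_. M)) {y \<in> space (PiM T (\<lambda>_. M)). card {j \<in> T. y j \<in> B} < k}
    = sparse_prob k (measure M B) 1 (card T) 0"
  using sparse_cells[of "{()}" T "\<lambda>_. B" "measure M B" "{}" k] assms
  by (simp add: disjoint_family_on_def)

section \<open>Sparse points in a sample of fixed size\<close>

text \<open>Indices rather than points are collected, so coinciding sample values count separately.
  Centres outside \<open>Q\<close> are dropped because the mass and radius properties of
  \<open>r\<close> will be available only on \<open>Q\<close>, a set of full mass.\<close>

definition sparse_points :: "'a::metric_space set \<Rightarrow> ('a \<Rightarrow> real) \<Rightarrow> nat \<Rightarrow> nat \<Rightarrow> (nat \<Rightarrow> 'a) \<Rightarrow> nat set" where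
  "sparse_points Q r k n x =
     {i \<in> {1..n}. x i \<in> Q \<and> card {j \<in> {1..n} - {i}. x j \<in> cball (x i) (r (x i))} < k}"

definition separated :: "real \<Rightarrow> nat set \<Rightarrow> (nat \<Rightarrow> 'a::metric_space) \<Rightarrow> bool" where
  "separated s S x \<longleftrightarrow> (\<forall>i\<in>S. \<forall>j\<in>S. i \<noteq> j \<longrightarrow> s < dist (x i) (x j))"

text \<open>The data at one fixed sample size. \<open>v\<close> is the common ball mass;
  \<open>s\<close> is so large that centres further than \<open>s\<close> apart have disjoint balls
  and avoid each other's balls; \<open>p\<close> bounds the chance that another point comes within
  \<open>s\<close> of a given one.\<close>

locale knn_scale = prob_space \<mu> for \<mu> :: "'a::euclidean_space measure" +
  fixes Q :: "'a set" and r :: "'a \<Rightarrow> real" and v s p :: real and k n :: nat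
  assumes sets_mu [measurable_cong]: "sets \<mu> = sets borel"
    and Q [measurable]: "Q \<in> sets borel" and prob_Q: "prob Q = 1"
    and r [measurable]: "r \<in> borel_measurable borel"
    and ball_mass: "\<And>x. x \<in> Q \<Longrightarrow> prob (cball x (r x)) = v"
    and radius: "\<And>x. x \<in> Q \<Longrightarrow> 2 * r x \<le> s"
    and near_mass: "\<And>x. x \<in> Q \<Longrightarrow> prob (cball x s) \<le> p"
begin

abbreviation "sample I \<equiv> PiM I (\<lambda>_. \<mu>)"

lemma space_mu [simp]: "space \<mu> = UNIV"
  using sets_eq_imp_space_eq[OF sets_mu] by simp

lemma prob_space_sample: "prob_space (sample I)"
  by (intro prob_space_PiM prob_space_axioms)

lemma v_nonneg: "0 \<le> v"
proof -
  obtain x where "x \<in> Q" using prob_Q by (cases "Q = {}") auto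
  from ball_mass[OF this] show ?thesis using measure_nonneg[of \<mu> "cball x (r x)"] by linarith
qed

lemma p_nonneg: "0 \<le> p"
proof -
  obtain x where "x \<in> Q" using prob_Q by (cases "Q = {}") auto
  from near_mass[OF this] show ?thesis using measure_nonneg[of \<mu> "cball x s"] by linarith
qed

lemma measurable_coord [measurable]: "i \<in> I \<Longrightarrow> (\<lambda>x. x i) \<in> borel_measurable (sample I)"
  using measurable_component_singleton[of i I "\<lambda>_. \<mu>"] by (simp cong: measurable_cong_sets[OF refl sets_mu])

lemma measurable_radius_coord [measurable]: "i \<in> I \<Longrightarrow> (\<lambda>x. r (x i)) \<in> borel_measurable (sample I)"
  by (rule measurable_compose[OF measurable_coord r])

lemma pred_Q_coord [measurable]: "i \<in> I \<Longrightarrow> Measurable.pred (sample I) (\<lambda>x. x i \<in> Q)"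
  using Q measurable_coord by (rule pred_sets2)

lemma measurable_dist_coord [measurable]:
  "i \<in> I \<Longrightarrow> j \<in> I \<Longrightarrow> (\<lambda>x. dist (x i) (x j)) \<in> borel_measurable (sample I)"
  by (intro borel_measurable_dist measurable_coord)

lemma pred_card_ball:
  assumes "i \<in> {1..n}"
  shows "Measurable.pred (sample {1..n}) (\<lambda>x. card {j \<in> {1..n} - {i}. x j \<in> cball (x i) (r (x i))} < k)"
proof -
  have *: "Measurable.pred (sample {1..n}) (\<lambda>x. x j \<in> cball (x i) (r (x i)))" if "j \<in> {1..n} - {i}" for j
    unfolding mem_cball using that assms
    by (intro pred_le_real measurable_dist_coord measurable_radius_coord) auto
  show ?thesis by (intro pred_less_const measurable_card_pred *) simp_all
qed

lemma pred_sparse_point: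
  assumes "i \<in> {1..n}"
  shows "Measurable.pred (sample {1..n}) (\<lambda>x. i \<in> sparse_points Q r k n x)"
proof -
  have eq: "(\<lambda>x. i \<in> sparse_points Q r k n x)
      = (\<lambda>x. x i \<in> Q \<and> card {j \<in> {1..n} - {i}. x j \<in> cball (x i) (r (x i))} < k)"
    unfolding sparse_points_def mem_Collect_eq using assms by blast
  show ?thesis unfolding eq
    by (intro pred_intros_logic(3) pred_card_ball pred_Q_coord assms)
qed

lemma pred_separated:
  assumes "finite S" "S \<subseteq> I"
  shows "Measurable.pred (sample I) (separated c S)"
proof -
  have eq: "separated c S = (\<lambda>x. \<forall>i\<in>S. \<forall>j\<in>S - {i}. c < dist (x i) (x j))"
    by (auto simp: separated_def fun_eq_iff)
  have "Measurable.pred (sample I) (\<lambda>x. c < dist (x i) (x j))" if "i \<in> S" "j \<in> S - {i}" for i j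
  proof (rule borel_measurable_pred_less)
    show "(\<lambda>x. dist (x i) (x j)) \<in> borel_measurable (sample I)"
      using that assms(2) by (intro measurable_dist_coord) auto
  qed (rule borel_measurable_const)
  moreover have "finite (S - {i})" for i using assms(1) by simp
  ultimately show ?thesis unfolding eq by (intro pred_intros_finite(3) assms(1))
qed

lemma prob_coord:
  assumes "j \<in> I" "B \<in> sets borel"
  shows "measure (sample I) {y \<in> space (sample I). y j \<in> B} = prob B"
proof -
  interpret P: product_prob_space "\<lambda>_. \<mu>" I ..
  have "prob B = measure (distr (sample I) \<mu> (\<lambda>y. y j)) B"
    using P.PiM_component[OF assms(1)] by simp
  also have "\<dots> = measure (sample I) ((\<lambda>y. y j) -` B \<inter> space (sample I))"
    using assms by (intro measure_distr) auto
  also have "(\<lambda>y. y j) -` B \<inter> space (sample I) = {y \<in> space (sample I). y j \<in> B}" by auto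
  finally show ?thesis by simp
qed

text \<open>Freeze the \<open>i\<close>-th point: the \<open>j\<close>-th must then fall into a ball
  of mass at most \<open>q\<close>.\<close>

lemma prob_close_pair:
  assumes "finite I" "i \<in> I" "j \<in> I" "i \<noteq> j" and A: "A \<in> sets borel"
    and q: "\<And>x. x \<in> A \<Longrightarrow> prob (cball x \<rho>) \<le> q" "0 \<le> q"
  shows "measure (sample I) {x \<in> space (sample I). x i \<in> A \<and> dist (x i) (x j) \<le> \<rho>} \<le> q * prob A"
proof -
  note [measurable] = A
  note [measurable] = measurable_coord[OF assms(2)] measurable_dist_coord[OF assms(2,3)]
    measurable_coord[of i "{i}"]
  have "measure (sample I) {x \<in> space (sample I). x i \<in> A \<and> dist (x i) (x j) \<le> \<rho>}
    \<le> q * measure (sample {i}) {x \<in> space (sample {i}). x i \<in> A}"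
  proof (rule measure_PiM_fold_le[OF assms(1)])
    fix x assume x: "x \<in> {x \<in> space (sample {i}). x i \<in> A}"
    interpret R: prob_space "sample (I - {i})" by (rule prob_space_sample)
    have j: "j \<in> I - {i}" using assms by auto
    have "measure (sample (I - {i})) {y \<in> space (sample (I - {i})). merge {i} (I - {i}) (x, y)
        \<in> {x \<in> space (sample I). x i \<in> A \<and> dist (x i) (x j) \<le> \<rho>}}
      \<le> measure (sample (I - {i})) {y \<in> space (sample (I - {i})). y j \<in> cball (x i) \<rho>}"
      using j by (intro R.finite_measure_mono) (auto simp: merge_def)
    also have "\<dots> = prob (cball (x i) \<rho>)" using j by (intro prob_coord) auto
    also have "\<dots> \<le> q" using x q(1) by auto
    finally show "measure (sample (I - {i})) {y \<in> space (sample (I - {i})). merge {i} (I - {i}) (x, y)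
        \<in> {x \<in> space (sample I). x i \<in> A \<and> dist (x i) (x j) \<le> \<rho>}} \<le> q" .
  qed (use assms in \<open>auto simp: merge_def\<close>)
  also have "measure (sample {i}) {x \<in> space (sample {i}). x i \<in> A} = prob A"
    by (rule prob_coord) (auto simp: A)
  finally show ?thesis .
qed

lemma balls_disjoint:
  assumes "x \<in> Q" "y \<in> Q" "s < dist x y"
  shows "cball x (r x) \<inter> cball y (r y) = {}" "y \<notin> cball x (r x)"
proof -
  have "r x + r y < dist x y" using radius[OF assms(1)] radius[OF assms(2)] assms(3) by linarith
  then show "cball x (r x) \<inter> cball y (r y) = {}"
    by (intro disjoint_cballI)
  show "y \<notin> cball x (r x)"
    using radius[OF assms(1)] assms(3) zero_le_dist[of x y] unfolding mem_cball by linarith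
qed

text \<open>A union bound over the null events of leaving \<open>Q\<close> and over the ordered
  pairs of close points, each of probability at most \<open>p\<close>.\<close>

lemma prob_separated:
  assumes "finite S"
  shows "1 - real (card S)^2 * p \<le> measure (sample S) {x \<in> space (sample S). (\<forall>i\<in>S. x i \<in> Q) \<and> separated s S x}"
proof -
  interpret S: prob_space "sample S" by (rule prob_space_sample)
  define G where "G = {x \<in> space (sample S). (\<forall>i\<in>S. x i \<in> Q) \<and> separated s S x}"
  define D where "D = (\<lambda>(i, j). {x \<in> space (sample S). x i \<in> Q \<and> dist (x i) (x j) \<le> s})"
  define N where "N i = {x \<in> space (sample S). x i \<in> - Q}" for i
  define O' where "O' = {(i, j). i \<in> S \<and> j \<in> S \<and> i \<noteq> j}"
  have O': "finite O'" "card O' \<le> card S ^ 2"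
  proof -
    have "O' \<subseteq> S \<times> S" by (auto simp: O'_def)
    then show "finite O'" "card O' \<le> card S ^ 2"
      using assms finite_subset[of O' "S \<times> S"] card_mono[of "S \<times> S" O']
      by (auto simp: card_cartesian_product power2_eq_square)
  qed
  have Gm: "G \<in> sets (sample S)" unfolding G_def using assms
    by (intro predE pred_intros_logic(2,3) pred_intros_finite(3) pred_Q_coord pred_separated) auto
  have Dm: "D z \<in> sets (sample S)" if z_in: "z \<in> O'" for z
  proof -
    obtain i j where z: "z = (i, j)" "i \<in> S" "j \<in> S" using z_in unfolding O'_def by blast
    show ?thesis unfolding D_def z(1) prod.case
      by (intro predE pred_intros_logic(3) pred_Q_coord[OF z(2)] pred_le_real
          measurable_dist_coord[OF z(2,3)] borel_measurable_const)
  qed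
  have Nm: "N i \<in> sets (sample S)" if "i \<in> S" for i
  proof -
    have "- Q \<in> sets \<mu>" using Q by (simp add: sets_mu)
    then show ?thesis unfolding N_def by (intro predE pred_component[OF that])
  qed
  have "1 - measure (sample S) G = measure (sample S) (space (sample S) - G)"
    using S.prob_compl[OF Gm] by simp
  also have "\<dots> \<le> measure (sample S) ((\<Union>i\<in>S. N i) \<union> (\<Union>z\<in>O'. D z))"
    using assms O' Dm Nm
    by (intro S.finite_measure_mono sets.Un sets.finite_UN)
       (auto simp: G_def N_def D_def O'_def separated_def not_less)
  also have "\<dots> \<le> measure (sample S) (\<Union>i\<in>S. N i) + measure (sample S) (\<Union>z\<in>O'. D z)"
    using assms O' Dm Nm by (intro measure_Un_le sets.finite_UN) auto
  also have "\<dots> \<le> (\<Sum>i\<in>S. measure (sample S) (N i)) + (\<Sum>z\<in>O'. measure (sample S) (D z))"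
    using assms O' Dm Nm by (intro add_mono S.finite_measure_subadditive_finite) auto
  also have "(\<Sum>i\<in>S. measure (sample S) (N i)) = 0"
  proof (rule sum.neutral, rule ballI)
    fix i assume "i \<in> S"
    have "measure (sample S) (N i) = prob (- Q)" unfolding N_def using \<open>i \<in> S\<close> by (intro prob_coord) auto
    also have "\<dots> = 0" using prob_compl[of Q] prob_Q by (simp add: Compl_eq_Diff_UNIV sets_mu)
    finally show "measure (sample S) (N i) = 0" .
  qed
  also have "(\<Sum>z\<in>O'. measure (sample S) (D z)) \<le> (\<Sum>z\<in>O'. p)"
  proof (rule sum_mono)
    fix z assume "z \<in> O'"
    then obtain i j where z: "z = (i, j)" "i \<in> S" "j \<in> S" "i \<noteq> j" unfolding O'_def by blast
    have "measure (sample S) (D z) \<le> p * prob Q"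
      unfolding D_def z(1) prod.case using z assms near_mass p_nonneg by (intro prob_close_pair) auto
    then show "measure (sample S) (D z) \<le> p" using prob_Q by simp
  qed
  also have "\<dots> \<le> real (card S)^2 * p"
    using O'(2) p_nonneg by (auto intro!: mult_right_mono simp flip: of_nat_power)
  finally show ?thesis unfolding G_def by simp
qed

lemma card_merge:
  assumes "S \<subseteq> I" "i \<in> S" "\<And>j. j \<in> S \<Longrightarrow> j \<noteq> i \<Longrightarrow> x j \<notin> B"
  shows "{j \<in> I - {i}. merge S (I - S) (x, y) j \<in> B} = {j \<in> I - S. y j \<in> B}"
  using assms by (auto simp: merge_def)

text \<open>Given the points indexed by \<open>S\<close>, their balls are disjoint and contain no
  other point of \<open>S\<close>. Sparseness therefore concerns only the remaining
  \<open>n - card S\<close> points and has the same conditional probability at all separated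
  positions in \<open>Q\<close>. The identity is exact; the approximation is confined to the second
  factor.\<close>

lemma prob_sparse_separated_eq:
  assumes S: "S \<subseteq> {1..n}"
  shows "measure (sample {1..n}) {x \<in> space (sample {1..n}). S \<subseteq> sparse_points Q r k n x \<and> separated s S x}
    = sparse_prob k v (card S) (n - card S) 0 *
      measure (sample S) {x \<in> space (sample S). (\<forall>i\<in>S. x i \<in> Q) \<and> separated s S x}"
    (is "measure _ ?E = _ * measure _ ?G")
proof (rule measure_PiM_fold_eq)
  let ?I = "{1..n}"
  have finS: "finite S" using S finite_subset by blast
  show "?E \<in> sets (sample ?I)"
    unfolding subset_eq using finS S
    by (intro predE pred_intros_logic(2,3) pred_intros_finite(3) pred_sparse_point pred_separated) auto
  show "?G \<in> sets (sample S)" using finS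
    by (intro predE pred_intros_logic(2,3) pred_intros_finite(3) pred_Q_coord pred_separated) auto
  have sep: "separated s S (merge S (?I - S) (x, y)) = separated s S x" for x y
    by (simp add: separated_def merge_def)
  have coord: "merge S (?I - S) (x, y) i = x i" if "i \<in> S" for x y i using that by (simp add: merge_def)
  show "merge S (?I - S) (x, y) \<notin> ?E" if "x \<in> space (sample S)" "x \<notin> ?G" for x y
    using that S sep coord by (auto simp: sparse_points_def subset_eq)
  fix x assume x: "x \<in> ?G"
  define B where "B i = cball (x i) (r (x i))" for i
  have xB: "x j \<notin> B i" "B i \<inter> B j = {}" if "i \<in> S" "j \<in> S" "j \<noteq> i" for i j
    using balls_disjoint[of "x i" "x j"] x that by (auto simp: B_def separated_def)
  have "{y \<in> space (sample (?I - S)). merge S (?I - S) (x, y) \<in> ?E}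
    = {y \<in> space (sample (?I - S)). (\<forall>i\<in>S. card {j \<in> ?I - S. y j \<in> B i} < k) \<and> (\<forall>j\<in>?I - S. y j \<notin> {})}"
  proof (intro Collect_cong conj_cong refl)
    fix y assume y: "y \<in> space (sample (?I - S))"
    have sp: "merge S (?I - S) (x, y) \<in> space (sample ?I)"
      using x y S by (auto simp: space_PiM PiE_iff merge_def extensional_def)
    have "i \<in> sparse_points Q r k n (merge S (?I - S) (x, y)) \<longleftrightarrow> card {j \<in> ?I - S. y j \<in> B i} < k" if "i \<in> S" for i
    proof -
      have "{j \<in> ?I - {i}. merge S (?I - S) (x, y) j \<in> B i} = {j \<in> ?I - S. y j \<in> B i}"
        using S that xB(1) by (intro card_merge) auto
      moreover have "i \<in> ?I" "x i \<in> Q" using that S x by auto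
      ultimately show ?thesis
        unfolding sparse_points_def mem_Collect_eq coord[OF that] B_def by (simp only: simp_thms)
    qed
    then show "merge S (?I - S) (x, y) \<in> ?E \<longleftrightarrow>
        (\<forall>i\<in>S. card {j \<in> ?I - S. y j \<in> B i} < k) \<and> (\<forall>j\<in>?I - S. y j \<notin> {})"
      using sp sep x by auto
  qed
  also have "measure (sample (?I - S)) \<dots> = sparse_prob k v (card S) (card (?I - S)) (prob {})"
    using finS xB(2) x ball_mass
    by (intro sparse_cells) (auto simp: disjoint_family_on_def B_def)
  finally show "measure (sample (?I - S)) {y \<in> space (sample (?I - S)). merge S (?I - S) (x, y) \<in> ?E}
      = sparse_prob k v (card S) (n - card S) 0"
    using card_Diff_subset[OF finS S] by simp
qed (use S in auto)

lemma prob_sparse_separated: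
  assumes S: "S \<subseteq> {1..n}" "card S = m" "real m * v \<le> 1"
  defines "E \<equiv> {x \<in> space (sample {1..n}). S \<subseteq> sparse_points Q r k n x \<and> separated s S x}"
  shows "E \<in> sets (sample {1..n})"
    and "measure (sample {1..n}) E \<le> sparse_prob k v m (n - m) 0"
    and "sparse_prob k v m (n - m) 0 * (1 - real m ^ 2 * p) \<le> measure (sample {1..n}) E"
proof -
  have finS: "finite S" using S finite_subset by blast
  interpret S: prob_space "sample S" by (rule prob_space_sample)
  define G where "G = {x \<in> space (sample S). (\<forall>i\<in>S. x i \<in> Q) \<and> separated s S x}"
  show Em: "E \<in> sets (sample {1..n})"
    unfolding E_def subset_eq using finS S
    by (intro predE pred_intros_logic(2,3) pred_intros_finite(3) pred_sparse_point pred_separated) auto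
  have eq: "measure (sample {1..n}) E = sparse_prob k v m (n - m) 0 * measure (sample S) G"
    using prob_sparse_separated_eq[OF S(1)] S(2) by (simp add: E_def G_def)
  have G: "1 - real m ^ 2 * p \<le> measure (sample S) G" "measure (sample S) G \<le> 1"
    using prob_separated[OF finS] S(2) by (auto simp: G_def)
  have nonneg: "0 \<le> sparse_prob k v m (n - m) 0"
    using S(3) v_nonneg by (intro sparse_prob_nonneg) auto
  show "measure (sample {1..n}) E \<le> sparse_prob k v m (n - m) 0"
    unfolding eq using G(2) nonneg by (rule mult_left_le)
  show "sparse_prob k v m (n - m) 0 * (1 - real m ^ 2 * p) \<le> measure (sample {1..n}) E"
    unfolding eq using G(1) nonneg by (rule mult_left_mono)
qed

text \<open>Conditioning on the two points leaves \<open>n - 2\<close> independent ones.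
  \<open>A\<close> collects the centres for which the lower bound \<open>u\<close> on the union is
  available; for a centre outside \<open>A\<close> only the sparseness of \<open>i\<close> is kept.
  \<open>Z\<close> must be uniform over a range of masses, since the mass of the union varies with
  the two positions.\<close>

lemma prob_near_pair:
  assumes ij: "i \<in> {1..n}" "j \<in> {1..n}" "i \<noteq> j"
    and A: "A \<in> sets borel" "A \<subseteq> Q"
    and small: "\<And>x. x \<in> Q \<Longrightarrow> \<rho> \<le> r x" "\<And>x. x \<in> Q \<Longrightarrow> prob (cball x \<rho>) \<le> q" "0 \<le> q"
    and union: "\<And>x y. x \<in> A \<Longrightarrow> y \<in> Q \<Longrightarrow> \<rho> < dist x y \<Longrightarrow> dist x y \<le> s
        \<Longrightarrow> u \<le> prob (cball x (r x) \<union> cball y (r y))"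
    and Z: "\<And>w. u \<le> w \<Longrightarrow> w \<le> 2 * v \<Longrightarrow> sparse_prob (2 * k) w 1 (n - 2) 0 \<le> Z" "0 \<le> Z"
    and "v \<le> 1"
  defines "E \<equiv> {x \<in> space (sample {1..n}). i \<in> sparse_points Q r k n x \<and> j \<in> sparse_points Q r k n x
      \<and> dist (x i) (x j) \<le> s}"
  shows "E \<in> sets (sample {1..n})"
    and "measure (sample {1..n}) E \<le> sparse_prob k v 1 (n - 2) 0 * (p * prob (Q - A))
      + sparse_prob (k - 1) v 1 (n - 2) 0 * q + Z * p"
proof -
  let ?I = "{1..n}" and ?S = "{i, j}"
  interpret I: prob_space "sample ?I" by (rule prob_space_sample)
  define E1 where "E1 = {x \<in> E. x i \<in> Q - A}"
  define E2 where "E2 = {x \<in> E. dist (x i) (x j) \<le> \<rho>}"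
  define E3 where "E3 = {x \<in> E. x i \<in> A \<and> \<rho> < dist (x i) (x j)}"
  define G1 where "G1 = {x \<in> space (sample ?S). x i \<in> Q - A \<and> dist (x i) (x j) \<le> s}"
  define G2 where "G2 = {x \<in> space (sample ?S). x i \<in> Q \<and> dist (x i) (x j) \<le> \<rho>}"
  define G3 where "G3 = {x \<in> space (sample ?S). x i \<in> A \<and> x j \<in> Q \<and> \<rho> < dist (x i) (x j) \<and> dist (x i) (x j) \<le> s}"
  have S: "?S \<subseteq> ?I" "finite ?S" "card ?S = 2" using ij by auto
  have cT: "card (?I - ?S) = n - 2" using card_Diff_subset[OF S(2,1)] S(3) by simp
  have pQA: "Measurable.pred (sample J) (\<lambda>x. x i \<in> B)" if "i \<in> J" "B \<in> sets borel" for J B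
    using that by (intro pred_component) (simp_all add: sets_mu)
  have le_pred: "Measurable.pred (sample J) (\<lambda>x. dist (x i) (x j) \<le> c)" if "i \<in> J" "j \<in> J" for J c
    using that by (intro pred_le_real measurable_dist_coord borel_measurable_const)
  have less_pred: "Measurable.pred (sample J) (\<lambda>x. c < dist (x i) (x j))" if "i \<in> J" "j \<in> J" for J c
    using that by (intro borel_measurable_pred_less measurable_dist_coord borel_measurable_const)
  have QA: "Q - A \<in> sets borel" using A(1) Q by (rule sets.Diff[rotated])
  show Em: "E \<in> sets (sample ?I)" unfolding E_def
    by (intro predE pred_intros_logic(3) pred_sparse_point le_pred ij)
  have mI: "i \<in> ?I" "j \<in> ?I" using ij by simp_all
  have mS: "i \<in> ?S" "j \<in> ?S" by simp_all
  have Es: "{x \<in> E. R x} \<in> sets (sample ?I)" if "Measurable.pred (sample ?I) R" for R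
  proof -
    have "{x \<in> E. R x} = E \<inter> {x \<in> space (sample ?I). R x}" by (auto simp: E_def)
    then show ?thesis using sets.Int[OF Em predE[OF that]] by (simp only:)
  qed
  have Em1: "E1 \<in> sets (sample ?I)" unfolding E1_def by (intro Es pQA mI QA)
  have Em2: "E2 \<in> sets (sample ?I)" unfolding E2_def by (intro Es le_pred mI)
  have Em3: "E3 \<in> sets (sample ?I)" unfolding E3_def
    by (intro Es pred_intros_logic(3) pQA less_pred mI A)
  have Gm1: "G1 \<in> sets (sample ?S)" unfolding G1_def
    by (intro predE pred_intros_logic(3) pQA le_pred mS QA)
  have Gm2: "G2 \<in> sets (sample ?S)" unfolding G2_def
    by (intro predE pred_intros_logic(3) pQA le_pred mS Q)
  have Gm3: "G3 \<in> sets (sample ?S)" unfolding G3_def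
    by (intro predE pred_intros_logic(3) pQA pred_Q_coord le_pred less_pred mS A Q)
  have "E \<subseteq> E1 \<union> E2 \<union> E3"
    unfolding E1_def E2_def E3_def using A(2) by (auto simp: E_def sparse_points_def)
  then have "measure (sample ?I) E \<le> measure (sample ?I) (E1 \<union> E2 \<union> E3)"
    using Em1 Em2 Em3 by (intro I.finite_measure_mono sets.Un)
  also have "\<dots> \<le> measure (sample ?I) E1 + measure (sample ?I) E2 + measure (sample ?I) E3"
    using measure_Un_le[OF sets.Un[OF Em1 Em2] Em3] measure_Un_le[OF Em1 Em2] by linarith
  finally have sum: "measure (sample ?I) E
    \<le> measure (sample ?I) E1 + measure (sample ?I) E2 + measure (sample ?I) E3" .
  have coord: "merge ?S (?I - ?S) (x, y) i = x i" "merge ?S (?I - ?S) (x, y) j = x j" for x y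
    by (simp_all add: merge_def)
  have rest: "{l \<in> ?I - ?S. y l \<in> B} \<subseteq> {l \<in> ?I - {a}. merge ?S (?I - ?S) (x, y) l \<in> B}" if "a \<in> ?S" for a x y B
    using that by (auto simp: merge_def)
  have card_le: "card {l \<in> ?I - ?S. y l \<in> cball (x a) (r (x a))} < k"
    if "a \<in> ?S" "merge ?S (?I - ?S) (x, y) \<in> E" for a x y
  proof -
    have "card {l \<in> ?I - ?S. y l \<in> cball (x a) (r (x a))}
      \<le> card {l \<in> ?I - {a}. merge ?S (?I - ?S) (x, y) l \<in> cball (x a) (r (x a))}"
      using rest[OF that(1)] by (intro card_mono) auto
    also have "\<dots> < k" using that coord by (auto simp: E_def sparse_points_def)
    finally show ?thesis .
  qed
  have single: "measure (sample (?I - ?S)) {y \<in> space (sample (?I - ?S)). card {l \<in> ?I - ?S. y l \<in> B} < k'}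
      = sparse_prob k' (prob B) 1 (n - 2) 0" if "B \<in> sets borel" for B k'
    using sparse_cell_single[of "?I - ?S" B k'] that cT by (simp add: sets_mu)
  have card_pred: "{y \<in> space (sample (?I - ?S)). card {l \<in> ?I - ?S. y l \<in> B} < k'} \<in> sets (sample (?I - ?S))"
    if "B \<in> sets borel" for B k'
    using that by (intro predE pred_less_const measurable_card_pred pred_component) (auto simp: sets_mu)
  interpret R: prob_space "sample (?I - ?S)" by (rule prob_space_sample)
  have sp0: "0 \<le> sparse_prob k' v 1 (n - 2) 0" for k'
    using v_nonneg \<open>v \<le> 1\<close> by (intro sparse_prob_nonneg) auto
  have "measure (sample ?I) E1 \<le> sparse_prob k v 1 (n - 2) 0 * measure (sample ?S) G1"
  proof (rule measure_PiM_fold_le[OF _ S(1) Em1 Gm1 sp0])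
    fix x y assume "x \<in> space (sample ?S)" "x \<notin> G1"
    then show "merge ?S (?I - ?S) (x, y) \<notin> E1" using coord by (auto simp: E1_def G1_def E_def)
  next
    fix x assume x: "x \<in> G1"
    have "measure (sample (?I - ?S)) {y \<in> space (sample (?I - ?S)). merge ?S (?I - ?S) (x, y) \<in> E1}
      \<le> measure (sample (?I - ?S)) {y \<in> space (sample (?I - ?S)). card {l \<in> ?I - ?S. y l \<in> cball (x i) (r (x i))} < k}"
      using card_le[of i x] by (intro R.finite_measure_mono card_pred) (auto simp: E1_def)
    also have "\<dots> = sparse_prob k v 1 (n - 2) 0"
      using x by (subst single) (auto simp: G1_def ball_mass)
    finally show "measure (sample (?I - ?S)) {y \<in> space (sample (?I - ?S)). merge ?S (?I - ?S) (x, y) \<in> E1}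
      \<le> sparse_prob k v 1 (n - 2) 0" .
  qed simp
  also have "measure (sample ?S) G1 \<le> p * prob (Q - A)"
    unfolding G1_def using ij(3) QA near_mass p_nonneg by (intro prob_close_pair) auto
  finally have b1: "measure (sample ?I) E1 \<le> sparse_prob k v 1 (n - 2) 0 * (p * prob (Q - A))"
    using sp0 by (simp add: mult_left_mono)
  have "measure (sample ?I) E2 \<le> sparse_prob (k - 1) v 1 (n - 2) 0 * measure (sample ?S) G2"
  proof (rule measure_PiM_fold_le[OF _ S(1) Em2 Gm2 sp0])
    fix x y assume "x \<in> space (sample ?S)" "x \<notin> G2"
    then show "merge ?S (?I - ?S) (x, y) \<notin> E2" using coord by (auto simp: E2_def G2_def E_def sparse_points_def)
  next
    fix x assume x: "x \<in> G2"
    let ?B = "cball (x i) (r (x i))"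
    have xj: "x j \<in> ?B" using x small(1)[of "x i"] by (auto simp: G2_def)
    \<comment> \<open>The point \<open>x j\<close> already occupies one place in the ball of
      \<open>x i\<close>, which lowers the threshold by one. For \<open>k = 1\<close> this makes the
      event empty.\<close>
    have "card {l \<in> ?I - ?S. y l \<in> ?B} < k - 1" if "merge ?S (?I - ?S) (x, y) \<in> E2" for y
    proof -
      have "Suc (card {l \<in> ?I - ?S. y l \<in> ?B}) = card (insert j {l \<in> ?I - ?S. y l \<in> ?B})" by simp
      also have "\<dots> \<le> card {l \<in> ?I - {i}. merge ?S (?I - ?S) (x, y) l \<in> ?B}"
        using rest[of i y ?B x] xj coord(2)[of x y] ij by (intro card_mono) auto
      also have "\<dots> < k" using that coord by (auto simp: E2_def E_def sparse_points_def)
      finally show ?thesis by simp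
    qed
    then have "measure (sample (?I - ?S)) {y \<in> space (sample (?I - ?S)). merge ?S (?I - ?S) (x, y) \<in> E2}
      \<le> measure (sample (?I - ?S)) {y \<in> space (sample (?I - ?S)). card {l \<in> ?I - ?S. y l \<in> ?B} < k - 1}"
      by (intro R.finite_measure_mono card_pred) auto
    also have "\<dots> = sparse_prob (k - 1) v 1 (n - 2) 0"
      using x by (subst single) (auto simp: G2_def ball_mass)
    finally show "measure (sample (?I - ?S)) {y \<in> space (sample (?I - ?S)). merge ?S (?I - ?S) (x, y) \<in> E2}
      \<le> sparse_prob (k - 1) v 1 (n - 2) 0" .
  qed simp
  also have "measure (sample ?S) G2 \<le> q * prob Q"
    unfolding G2_def using ij(3) small Q by (intro prob_close_pair) auto
  finally have b2: "measure (sample ?I) E2 \<le> sparse_prob (k - 1) v 1 (n - 2) 0 * q"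
    using sp0 prob_Q by (simp add: mult_left_mono)
  have "measure (sample ?I) E3 \<le> Z * measure (sample ?S) G3"
  proof (rule measure_PiM_fold_le[OF _ S(1) Em3 Gm3 Z(2)])
    fix x y assume "x \<in> space (sample ?S)" "x \<notin> G3"
    then show "merge ?S (?I - ?S) (x, y) \<notin> E3" using coord by (auto simp: E3_def G3_def E_def sparse_points_def)
  next
    fix x assume x: "x \<in> G3"
    let ?Bi = "cball (x i) (r (x i))" and ?Bj = "cball (x j) (r (x j))"
    \<comment> \<open>Two counts below \<open>k\<close> leave fewer than \<open>2 * k\<close> points
      in the union. The doubled threshold costs only a power of the expected count, which the
      exponential decay will absorb.\<close>
    have "card {l \<in> ?I - ?S. y l \<in> ?Bi \<union> ?Bj} < 2 * k" if "merge ?S (?I - ?S) (x, y) \<in> E" for y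
    proof -
      have "{l \<in> ?I - ?S. y l \<in> ?Bi \<union> ?Bj} = {l \<in> ?I - ?S. y l \<in> ?Bi} \<union> {l \<in> ?I - ?S. y l \<in> ?Bj}" by auto
      then have "card {l \<in> ?I - ?S. y l \<in> ?Bi \<union> ?Bj}
          \<le> card {l \<in> ?I - ?S. y l \<in> ?Bi} + card {l \<in> ?I - ?S. y l \<in> ?Bj}"
        by (simp only: card_Un_le)
      then show ?thesis using card_le[OF mS(1) that] card_le[OF mS(2) that] by linarith
    qed
    then have "measure (sample (?I - ?S)) {y \<in> space (sample (?I - ?S)). merge ?S (?I - ?S) (x, y) \<in> E3}
      \<le> measure (sample (?I - ?S)) {y \<in> space (sample (?I - ?S)). card {l \<in> ?I - ?S. y l \<in> ?Bi \<union> ?Bj} < 2 * k}"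
      by (intro R.finite_measure_mono card_pred) (auto simp: E3_def)
    also have "\<dots> = sparse_prob (2 * k) (prob (?Bi \<union> ?Bj)) 1 (n - 2) 0" by (subst single) auto
    also have "\<dots> \<le> Z"
    proof (rule Z(1))
      show "u \<le> prob (?Bi \<union> ?Bj)" using x by (intro union) (auto simp: G3_def)
      have "prob (?Bi \<union> ?Bj) \<le> prob ?Bi + prob ?Bj" by (intro measure_Un_le) (auto simp: sets_mu)
      then show "prob (?Bi \<union> ?Bj) \<le> 2 * v" using x A(2) ball_mass by (auto simp: G3_def)
    qed
    finally show "measure (sample (?I - ?S)) {y \<in> space (sample (?I - ?S)). merge ?S (?I - ?S) (x, y) \<in> E3} \<le> Z" .
  qed simp
  also have "measure (sample ?S) G3 \<le> measure (sample ?S) {x \<in> space (sample ?S). x i \<in> Q \<and> dist (x i) (x j) \<le> s}"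
  proof -
    interpret S: prob_space "sample ?S" by (rule prob_space_sample)
    have "{x \<in> space (sample ?S). x i \<in> Q \<and> dist (x i) (x j) \<le> s} \<in> sets (sample ?S)"
      by (intro predE pred_intros_logic(3) pred_Q_coord le_pred mS)
    then show ?thesis using A(2) by (intro S.finite_measure_mono) (auto simp: G3_def)
  qed
  also have "\<dots> \<le> p * prob Q" using ij(3) near_mass p_nonneg Q by (intro prob_close_pair) auto
  finally have b3: "measure (sample ?I) E3 \<le> Z * p"
    using Z(2) prob_Q by (simp add: mult_left_mono)
  show "measure (sample ?I) E \<le> sparse_prob k v 1 (n - 2) 0 * (p * prob (Q - A))
      + sparse_prob (k - 1) v 1 (n - 2) 0 * q + Z * p"
    using sum b1 b2 b3 by linarith
qed

end

section \<open>Convergence of void probabilities\<close>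

text \<open>Take an inclusion-maximal separated subset: by maximality the closed
  \<open>s\<close>-balls around its members cover all of \<open>V\<close>, and each of them holds at
  most \<open>D\<close> indices.\<close>

lemma separated_subset_exists:
  assumes "finite V" "0 \<le> s" and deg: "\<And>i. i \<in> V \<Longrightarrow> card {j \<in> V. dist (x i) (x j) \<le> s} \<le> D"
  shows "\<exists>S\<subseteq>V. separated s S x \<and> card V \<le> D * card S"
proof -
  let ?F = "{S. S \<subseteq> V \<and> separated s S x}"
  have "finite ?F" using assms(1) by simp
  moreover have "{} \<in> ?F" by (simp add: separated_def)
  then have "?F \<noteq> {}" by (simp only: empty_iff ex_in_conv[symmetric]) (rule exI)
  ultimately have "\<exists>S\<in>?F. \<forall>S'\<in>?F. S \<subseteq> S' \<longrightarrow> S = S'" by (rule finite_has_maximal)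
  then obtain S where S: "S \<in> ?F" and max: "\<forall>S'\<in>?F. S \<subseteq> S' \<longrightarrow> S = S'"
    by (rule bexE)
  have finS: "finite S" using S assms(1) finite_subset by auto
  have "V \<subseteq> (\<Union>i\<in>S. {j \<in> V. dist (x i) (x j) \<le> s})"
  proof
    fix j assume j: "j \<in> V"
    show "j \<in> (\<Union>i\<in>S. {j \<in> V. dist (x i) (x j) \<le> s})"
    proof (rule ccontr)
      assume not: "j \<notin> (\<Union>i\<in>S. {j \<in> V. dist (x i) (x j) \<le> s})"
      then have "insert j S \<in> ?F" using S j by (auto simp: separated_def dist_commute not_le)
      from bspec[OF max this] have "S = insert j S" by (simp only: subset_insertI simp_thms)
      then have "j \<in> S" by (metis insertI1)
      then show False using not j \<open>0 \<le> s\<close> by auto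
    qed
  qed
  then have "card V \<le> card (\<Union>i\<in>S. {j \<in> V. dist (x i) (x j) \<le> s})"
    using finS assms(1) by (intro card_mono) auto
  also have "\<dots> \<le> (\<Sum>i\<in>S. card {j \<in> V. dist (x i) (x j) \<le> s})" using finS by (rule card_UN_le)
  also have "\<dots> \<le> (\<Sum>i\<in>S. D)" using S deg by (intro sum_mono) auto
  finally show ?thesis using S by (auto simp: mult.commute)
qed

text \<open>A binomial moment truncated to separated sets, the version whose expectation can be
  estimated sharply.\<close>

definition separated_count :: "real \<Rightarrow> nat set \<Rightarrow> nat \<Rightarrow> (nat \<Rightarrow> 'a::metric_space) \<Rightarrow> nat" where
  "separated_count s V m x = card {S. S \<subseteq> V \<and> card S = m \<and> separated s S x}"

lemma separated_count_le:
  assumes "finite V" shows "separated_count s V m x \<le> card V choose m"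
proof -
  have "separated_count s V m x \<le> card {S. S \<subseteq> V \<and> card S = m}"
    unfolding separated_count_def using assms by (intro card_mono) auto
  then show ?thesis using n_subsets[OF assms] by simp
qed

lemma separated_count_eq:
  assumes "finite V" "separated s V x" shows "separated_count s V m x = card V choose m"
proof -
  have "{S. S \<subseteq> V \<and> card S = m \<and> separated s S x} = {S. S \<subseteq> V \<and> card S = m}"
    using assms(2) by (auto simp: separated_def subset_eq)
  then show ?thesis using n_subsets[OF assms(1)] by (simp add: separated_count_def)
qed

text \<open>The summand 1 covers \<open>a < p\<close>, where the binomial coefficient
  vanishes.\<close>

lemma power_le_choose: "(a::nat) ^ p \<le> p ^ p * (1 + (a choose p))"
proof (cases "p \<le> a")
  case True
  show ?thesis
  proof (cases "p = 0")
    case False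
    have "(real a / real p) ^ p \<le> real (a choose p)" using True by (rule binomial_ge_n_over_k_pow_k)
    then have "real a ^ p \<le> real p ^ p * real (a choose p)"
      using False by (simp add: power_divide field_simps)
    then have "real (a ^ p) \<le> real (p ^ p * (a choose p))" by simp
    then have "a ^ p \<le> p ^ p * (a choose p)" by (simp only: of_nat_le_iff)
    then show ?thesis by simp
  qed simp
next
  case False
  then have "a ^ p \<le> p ^ p" by (intro power_mono) auto
  then show ?thesis by (simp add: trans_le_add1)
qed

text \<open>Subsets of a separated set are separated, so a large \<open>V\<close> produces many
  separated \<open>p\<close>-sets. The bound is deterministic and lets the expected separated counts
  dominate every moment of \<open>card V\<close>.\<close>

lemma power_card_le_separated_count:
  assumes "finite V" "0 \<le> s" "\<And>i. i \<in> V \<Longrightarrow> card {j \<in> V. dist (x i) (x j) \<le> s} \<le> D"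
  shows "card V ^ p \<le> (D * p) ^ p * (1 + separated_count s V p x)"
proof -
  obtain S where S: "S \<subseteq> V" "separated s S x" "card V \<le> D * card S"
    using separated_subset_exists[of V s x D] assms by auto
  have finS: "finite S" using S(1) assms(1) finite_subset by auto
  have "card S choose p = card {S'. S' \<subseteq> S \<and> card S' = p}" using n_subsets[OF finS] by simp
  also have "\<dots> \<le> separated_count s V p x" unfolding separated_count_def
  proof (rule card_mono)
    show "finite {S'. S' \<subseteq> V \<and> card S' = p \<and> separated s S' x}" using assms(1) by simp
    show "{S'. S' \<subseteq> S \<and> card S' = p} \<subseteq> {S'. S' \<subseteq> V \<and> card S' = p \<and> separated s S' x}"
      using S(1,2) unfolding separated_def by auto
  qed
  finally have *: "card S choose p \<le> separated_count s V p x" .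
  have "card V ^ p \<le> (D * card S) ^ p" using S(3) by (rule power_mono) simp
  also have "\<dots> = D ^ p * card S ^ p" by (rule power_mult_distrib)
  also have "\<dots> \<le> D ^ p * (p ^ p * (1 + (card S choose p)))" by (intro mult_left_mono power_le_choose) simp
  also have "\<dots> \<le> D ^ p * (p ^ p * (1 + separated_count s V p x))" using * by (intro mult_left_mono) auto
  finally show ?thesis by (simp only: power_mult_distrib mult.assoc)
qed

section \<open>Bonferroni truncation and passage to the limit\<close>

lemma alternating_choose_sum_Suc:
  "(\<Sum>m\<le>q. (-1) ^ m * real (Suc M choose m)) = (-1) ^ q * real (M choose q)"
  by (induction q) (simp_all add: algebra_simps)

text \<open>For \<open>N = Suc M\<close> the partial alternating sum collapses to the single
  coefficient \<open>M choose q\<close> up to sign. Hence the last included term bounds the error at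
  both parities of \<open>q\<close>.\<close>

lemma bonferroni_error:
  "\<bar>of_bool (N = 0) - (\<Sum>m\<le>q. (-1) ^ m * real (N choose m))\<bar> \<le> real (N choose q)"
proof (cases N)
  case 0
  have "(\<Sum>m\<le>q. (-1) ^ m * real (0 choose m)) = (\<Sum>m\<in>{0}. (-1) ^ m * real (0 choose m))"
    by (intro sum.mono_neutral_right) auto
  then show ?thesis using 0 by simp
next
  case (Suc M)
  have "M choose q \<le> Suc M choose q" by (cases q) simp_all
  then show ?thesis unfolding Suc alternating_choose_sum_Suc by (simp add: abs_mult power_abs)
qed

lemma integrable_bounded_prob:
  fixes g :: "'b \<Rightarrow> real"
  assumes "prob_space P" "g \<in> borel_measurable P" "\<And>x. \<bar>g x\<bar> \<le> B"
  shows "integrable P g"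
proof -
  interpret prob_space P by fact
  show ?thesis using assms(2,3) by (intro integrable_const_bound[of _ B]) auto
qed

text \<open>The control of the powers of \<open>N n\<close> by the counts \<open>T n m\<close> gives the uniform integrability
  that makes the event \<open>W n\<close>, off which \<open>T n m\<close> is a binomial moment, negligible.\<close>

lemma void_probability_limit:
  fixes P :: "nat \<Rightarrow> 'b measure" and N :: "nat \<Rightarrow> 'b \<Rightarrow> nat" and T :: "nat \<Rightarrow> nat \<Rightarrow> 'b \<Rightarrow> nat"
    and C :: "nat \<Rightarrow> real"
  assumes prob: "\<And>n. prob_space (P n)"
    and N_m: "\<forall>\<^sub>F n in sequentially. N n \<in> measurable (P n) (count_space UNIV)"
    and T_m: "\<And>m. \<forall>\<^sub>F n in sequentially. T n m \<in> measurable (P n) (count_space UNIV)"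
    and N_le: "\<And>n x. N n x \<le> n"
    and T_le: "\<And>n m x. T n m x \<le> N n x choose m"
    and W_m: "\<forall>\<^sub>F n in sequentially. W n \<in> sets (P n)"
    and T_eq: "\<And>n m x. x \<in> space (P n) \<Longrightarrow> x \<notin> W n \<Longrightarrow> T n m x = N n x choose m"
    and N_pow: "\<And>m. \<forall>\<^sub>F n in sequentially. AE x in P n. real (N n x) ^ m \<le> C m * (1 + real (T n m x))"
    and T_lim: "\<And>m. (\<lambda>n. \<integral>x. real (T n m x) \<partial>P n) \<longlonglongrightarrow> \<eta> ^ m / fact m"
    and W_lim: "(\<lambda>n. measure (P n) (W n)) \<longlonglongrightarrow> 0"
  shows "(\<lambda>n. measure (P n) {x \<in> space (P n). N n x = 0}) \<longlonglongrightarrow> exp (- \<eta>)"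
proof -
  have pow_le: "real (N n x) ^ m \<le> real n ^ m" for n m x
    using N_le[of n x] by (intro power_mono) auto
  have choose_le: "real (N n x choose m) \<le> real (N n x) ^ m" for n m x
  proof (cases "m \<le> N n x")
    case True
    show ?thesis using binomial_le_pow[OF True] by (simp flip: of_nat_power)
  qed (simp add: binomial_eq_0)
  have int_N: "\<forall>\<^sub>F n in sequentially. integrable (P n) (\<lambda>x. real (N n x) ^ m)
      \<and> integrable (P n) (\<lambda>x. real (N n x choose m))" for m
    using N_m
  proof eventually_elim
    case (elim n)
    note [measurable] = elim
    have "integrable (P n) (\<lambda>x. real (N n x) ^ m)"
      using pow_le[of n _ m] by (intro integrable_bounded_prob[OF prob, of _ _ "real n ^ m"]) auto
    moreover have "integrable (P n) (\<lambda>x. real (N n x choose m))"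
      using order_trans[OF choose_le pow_le, of n _ m]
      by (intro integrable_bounded_prob[OF prob, of _ _ "real n ^ m"]) auto
    ultimately show ?case ..
  qed
  have int_T: "\<forall>\<^sub>F n in sequentially. integrable (P n) (\<lambda>x. real (T n m x))" for m
    using T_m[of m]
  proof eventually_elim
    case (elim n)
    note [measurable] = elim
    have "real (T n m x) \<le> real n ^ m" for x
      using T_le[of n m x] choose_le[of n x m] pow_le[of n x m] by linarith
    then show ?case by (intro integrable_bounded_prob[OF prob, of _ _ "real n ^ m"]) auto
  qed
  define b where "b n m = (\<integral>x. real (N n x choose m) \<partial>P n)" for n m
  \<comment> \<open>The inequality a \<le> \<theta> a^2 + 1 / \<theta> splits the contribution of
    \<open>W n\<close> into a moment part and a probability part. With \<theta> near the square root
    of the probability of \<open>W n\<close> both parts vanish; the added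
    \<open>inverse (real (Suc n))\<close> keeps \<theta> positive when that probability is
    zero.\<close>
  define \<theta> where "\<theta> n = sqrt (measure (P n) (W n)) + inverse (real (Suc n))" for n
  have \<theta>: "\<theta> n > 0" "measure (P n) (W n) / \<theta> n \<le> sqrt (measure (P n) (W n))" for n
  proof -
    show pos: "\<theta> n > 0" unfolding \<theta>_def by (intro add_nonneg_pos) auto
    have "measure (P n) (W n) = sqrt (measure (P n) (W n)) * sqrt (measure (P n) (W n))" by simp
    also have "\<dots> \<le> sqrt (measure (P n) (W n)) * \<theta> n" unfolding \<theta>_def by (intro mult_left_mono) auto
    finally show "measure (P n) (W n) / \<theta> n \<le> sqrt (measure (P n) (W n))"
      using pos by (simp add: pos_divide_le_eq)
  qed
  have sqrt_lim: "(\<lambda>n. sqrt (measure (P n) (W n))) \<longlonglongrightarrow> 0" using tendsto_real_sqrt[OF W_lim] by simp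
  have \<theta>_lim: "\<theta> \<longlonglongrightarrow> 0"
    unfolding \<theta>_def using tendsto_add[OF sqrt_lim LIMSEQ_inverse_real_of_nat] by simp
  have b_lim: "(\<lambda>n. b n m) \<longlonglongrightarrow> \<eta> ^ m / fact m" for m
  proof -
    \<comment> \<open>The order \<open>2 * m\<close> comes from squaring the \<open>m\<close>-th
      power of \<open>N n\<close>; through \<open>N_pow\<close> this moment is bounded by an
      integral that converges.\<close>
    define err where "err n = \<theta> n * (C (2 * m) * (1 + (\<integral>x. real (T n (2 * m) x) \<partial>P n)))
        + sqrt (measure (P n) (W n))" for n
    have "err \<longlonglongrightarrow> 0 * (C (2 * m) * (1 + \<eta> ^ (2 * m) / fact (2 * m))) + 0"
      unfolding err_def by (intro tendsto_intros \<theta>_lim T_lim sqrt_lim)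
    then have err: "err \<longlonglongrightarrow> 0" by simp
    have diff: "\<forall>\<^sub>F n in sequentially. norm (b n m - (\<integral>x. real (T n m x) \<partial>P n)) \<le> err n"
      using int_N[of m] int_N[of "2 * m"] int_T[of m] int_T[of "2 * m"] N_pow[of "2 * m"] W_m
    proof eventually_elim
      case (elim n)
      interpret prob_space "P n" by (rule prob)
      have pt: "real (N n x choose m) - real (T n m x)
          \<le> \<theta> n * real (N n x) ^ (2 * m) + indicator (W n) x / \<theta> n" if "x \<in> space (P n)" for x
      proof (cases "x \<in> W n")
        case True
        define a where "a = real (N n x) ^ m"
        have "a \<le> \<theta> n * a\<^sup>2 + 1 / \<theta> n"
        proof -
          have "0 \<le> (\<theta> n * a - 1)\<^sup>2 + \<theta> n * a" using \<theta>(1)[of n] by (simp add: a_def)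
          then have "\<theta> n * a \<le> \<theta> n * (\<theta> n * a\<^sup>2 + 1 / \<theta> n)"
            using \<theta>(1)[of n] by (simp add: power2_eq_square algebra_simps)
          then show ?thesis using \<theta>(1)[of n] by (simp only: mult_le_cancel_left_pos)
        qed
        moreover have "a\<^sup>2 = real (N n x) ^ (2 * m)" by (simp add: a_def power_mult[symmetric] mult.commute)
        moreover have "real (N n x choose m) \<le> a" unfolding a_def by (rule choose_le)
        moreover have "indicator (W n) x = (1::real)" using True by simp
        ultimately show ?thesis using of_nat_0_le_iff[of "T n m x", where ?'a = real] by simp
      next
        case False
        then show ?thesis using T_eq[OF that False, of m] \<theta>(1)[of n] by simp
      qed
      have intW: "integrable (P n) (\<lambda>x. indicator (W n) x / \<theta> n)"
        using elim by (intro Bochner_Integration.integrable_divide integrable_real_indicator)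
          (auto simp: emeasure_eq_measure)
      have "b n m - (\<integral>x. real (T n m x) \<partial>P n) = (\<integral>x. real (N n x choose m) - real (T n m x) \<partial>P n)"
        unfolding b_def using elim by simp
      also have "\<dots> \<le> (\<integral>x. \<theta> n * real (N n x) ^ (2 * m) + indicator (W n) x / \<theta> n \<partial>P n)"
        using elim intW pt by (intro integral_mono) auto
      also have "\<dots> = \<theta> n * (\<integral>x. real (N n x) ^ (2 * m) \<partial>P n) + measure (P n) (W n) / \<theta> n"
        using elim intW by simp
      also have "(\<integral>x. real (N n x) ^ (2 * m) \<partial>P n) \<le> (\<integral>x. C (2 * m) * (1 + real (T n (2 * m) x)) \<partial>P n)"
        using elim by (intro integral_mono_AE) auto
      also have "\<dots> = C (2 * m) * (1 + (\<integral>x. real (T n (2 * m) x) \<partial>P n))"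
        using elim by (simp add: prob_space)
      finally have "b n m - (\<integral>x. real (T n m x) \<partial>P n) \<le> err n"
        using \<theta>[of n] by (simp add: err_def)
      moreover have "(\<integral>x. real (T n m x) \<partial>P n) \<le> b n m"
        unfolding b_def using elim T_le by (intro integral_mono) auto
      ultimately show ?case by simp
    qed
    have "(\<lambda>n. b n m - (\<integral>x. real (T n m x) \<partial>P n)) \<longlonglongrightarrow> 0"
      by (rule Lim_null_comparison[OF diff err])
    from tendsto_add[OF this T_lim[of m]] show ?thesis by simp
  qed
  have bonf: "\<forall>\<^sub>F n in sequentially. \<bar>measure (P n) {x \<in> space (P n). N n x = 0}
      - (\<Sum>m\<le>q. (-1) ^ m * b n m)\<bar> \<le> b n q" for q
  proof -
    have "\<forall>\<^sub>F n in sequentially. \<forall>m\<in>{..q}. integrable (P n) (\<lambda>x. real (N n x choose m))"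
      by (subst eventually_ball_finite_distrib) (auto intro: eventually_mono[OF int_N])
    then show ?thesis using N_m
    proof eventually_elim
      case (elim n)
      interpret prob_space "P n" by (rule prob)
      note [measurable] = elim(2)
      have i: "integrable (P n) (\<lambda>x. real (N n x choose m))" if "m \<le> q" for m using elim(1) that by simp
      have i0: "integrable (P n) (\<lambda>x. of_bool (N n x = 0) :: real)"
        by (intro integrable_bounded_prob[OF prob, of _ _ 1]) auto
      have iS: "integrable (P n) (\<lambda>x. \<Sum>m\<le>q. (-1) ^ m * real (N n x choose m))"
        using i by (intro Bochner_Integration.integrable_sum integrable_mult_right) auto
      have "measure (P n) {x \<in> space (P n). N n x = 0}
          = (\<integral>x. indicator {x \<in> space (P n). N n x = 0} x \<partial>P n)" by simp
      also have "\<dots> = (\<integral>x. of_bool (N n x = 0) \<partial>P n)" by (intro Bochner_Integration.integral_cong) auto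
      finally have "measure (P n) {x \<in> space (P n). N n x = 0} - (\<Sum>m\<le>q. (-1) ^ m * b n m)
        = (\<integral>x. of_bool (N n x = 0) - (\<Sum>m\<le>q. (-1) ^ m * real (N n x choose m)) \<partial>P n)"
        unfolding b_def Bochner_Integration.integral_diff[OF i0 iS]
        by (subst Bochner_Integration.integral_sum) (use i in auto)
      then have "\<bar>measure (P n) {x \<in> space (P n). N n x = 0} - (\<Sum>m\<le>q. (-1) ^ m * b n m)\<bar>
        \<le> (\<integral>x. \<bar>of_bool (N n x = 0) - (\<Sum>m\<le>q. (-1) ^ m * real (N n x choose m))\<bar> \<partial>P n)"
        by (simp only: integral_abs_bound)
      also have "\<dots> \<le> b n q" unfolding b_def
        using i[of q] i0 iS bonferroni_error
        by (intro integral_mono integrable_abs Bochner_Integration.integrable_diff) auto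
      finally show ?case .
    qed
  qed
  show ?thesis
  proof (rule tendstoI)
    fix e :: real assume "e > 0"
    \<comment> \<open>The truncation order \<open>q\<close> is fixed before \<open>n\<close>, so
      convergence of finitely many moments suffices.\<close>
    have "(\<lambda>q. \<Sum>m\<le>q. (- \<eta>) ^ m / fact m) \<longlonglongrightarrow> exp (- \<eta>)"
      using exp_converges[of "- \<eta>"] by (simp add: sums_def_le divide_inverse mult.commute)
    then have "\<forall>\<^sub>F q in sequentially. dist (\<Sum>m\<le>q. (- \<eta>) ^ m / fact m) (exp (- \<eta>)) < e / 4"
      using \<open>e > 0\<close> by (intro tendstoD) auto
    moreover have "(\<lambda>q. \<eta> ^ q / fact q) \<longlonglongrightarrow> 0"
      using summable_LIMSEQ_zero[OF summable_exp[of \<eta>]] by (simp add: divide_inverse mult.commute)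
    then have "\<forall>\<^sub>F q in sequentially. dist (\<eta> ^ q / fact q) 0 < e / 4"
      using \<open>e > 0\<close> by (intro tendstoD) auto
    ultimately have "\<forall>\<^sub>F q in sequentially. dist (\<Sum>m\<le>q. (- \<eta>) ^ m / fact m) (exp (- \<eta>)) < e / 4
        \<and> dist (\<eta> ^ q / fact q) 0 < e / 4"
      by (rule eventually_conj)
    then obtain q where q: "dist (\<Sum>m\<le>q. (- \<eta>) ^ m / fact m) (exp (- \<eta>)) < e / 4"
        "\<bar>\<eta> ^ q / fact q\<bar> < e / 4"
      by (auto dest!: eventually_happens simp: dist_norm)
    have "(\<lambda>n. \<Sum>m\<le>q. (-1) ^ m * b n m) \<longlonglongrightarrow> (\<Sum>m\<le>q. (-1) ^ m * (\<eta> ^ m / fact m))"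
      by (intro tendsto_intros b_lim)
    also have "(\<Sum>m\<le>q. (-1) ^ m * (\<eta> ^ m / fact m)) = (\<Sum>m\<le>q. (- \<eta>) ^ m / fact m)"
      by (intro sum.cong) (auto simp: power_minus[of \<eta>])
    finally have "\<forall>\<^sub>F n in sequentially. dist (\<Sum>m\<le>q. (-1) ^ m * b n m) (\<Sum>m\<le>q. (- \<eta>) ^ m / fact m) < e / 4"
      using \<open>e > 0\<close> by (intro tendstoD) auto
    moreover have "\<forall>\<^sub>F n in sequentially. dist (b n q) (\<eta> ^ q / fact q) < e / 4"
      using \<open>e > 0\<close> b_lim by (intro tendstoD) auto
    ultimately show "\<forall>\<^sub>F n in sequentially. dist (measure (P n) {x \<in> space (P n). N n x = 0}) (exp (- \<eta>)) < e"
      using bonf[of q]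
    proof eventually_elim
      case (elim n)
      then show ?case using q unfolding dist_real_def by linarith
    qed
  qed
qed

section \<open>Asymptotics of the occupancy probabilities\<close>

lemma choose_asymp: "(\<lambda>n. real ((n - a) choose j) * fact j / real n ^ j) \<longlonglongrightarrow> 1"
proof (induction j)
  case 0
  show ?case by simp
next
  case (Suc j)
  have eq: "\<forall>\<^sub>F n in sequentially. real ((n - a) choose j) * fact j / real n ^ j * (1 - real (a + j) / real n)
      = real ((n - a) choose Suc j) * fact (Suc j) / real n ^ Suc j"
    using eventually_gt_at_top[of "a + j"]
  proof eventually_elim
    case (elim n)
    have "Suc j * ((n - a) choose Suc j) = (n - a - j) * ((n - a) choose j)"
      using binomial_absorption[of j "n - a"] binomial_absorb_comp[of "n - a" j] by simp
    then have "real (Suc j) * real ((n - a) choose Suc j) = real (n - a - j) * real ((n - a) choose j)"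
      by (simp only: of_nat_mult[symmetric])
    moreover have "real (n - a - j) = real n - real (a + j)" using elim by simp
    ultimately have *: "real (Suc j) * real ((n - a) choose Suc j) = (real n - real (a + j)) * real ((n - a) choose j)"
      by (simp only:)
    have "real ((n - a) choose Suc j) * fact (Suc j) / real n ^ Suc j
        = (real (Suc j) * real ((n - a) choose Suc j)) * fact j / (real n * real n ^ j)" by simp
    also have "\<dots> = real ((n - a) choose j) * fact j / real n ^ j * ((real n - real (a + j)) / real n)"
      unfolding * by (simp add: mult_ac)
    also have "(real n - real (a + j)) / real n = 1 - real (a + j) / real n"
      using elim by (simp add: diff_divide_distrib)
    finally show ?case by simp
  qed
  have "(\<lambda>n. 1 - real (a + j) / real n) \<longlonglongrightarrow> 1 - 0"
    by (intro tendsto_intros lim_const_over_n)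
  from tendsto_mult[OF Suc.IH this] have
    "(\<lambda>n. real ((n - a) choose j) * fact j / real n ^ j * (1 - real (a + j) / real n)) \<longlonglongrightarrow> 1" by simp
  then show ?case by (rule Lim_transform_eventually[OF _ eq])
qed

text \<open>Throughout, \<open>y n / n\<close> is the mass of a ball, so that \<open>y n\<close> is its expected number of points.\<close>

locale growing_mass =
  fixes y :: "nat \<Rightarrow> real"
  assumes y_top: "filterlim y at_top sequentially"
    and y_pow: "\<And>p. (\<lambda>n. y n ^ p / real n) \<longlonglongrightarrow> 0"
begin

lemma eventually_y_ge: "\<forall>\<^sub>F n in sequentially. c \<le> y n"
  using y_top by (simp add: filterlim_at_top)

lemma v_lim: "(\<lambda>n. y n / real n) \<longlonglongrightarrow> 0"
  using y_pow[of 1] by simp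

text \<open>The logarithm of the quotient is \<open>g\<close>. The bounds -z - 2 z^2 \<le> ln (1 -
  z) \<le> -z reduce the claim to n z^2 tending to 0, which is \<open>y_pow\<close> with exponent 2;
  the shift by \<open>a\<close> costs only a multiple of z.\<close>

lemma power_exp_asymp:
  "(\<lambda>n. (1 - real l * (y n / real n)) ^ (n - a) / exp (- real l * y n)) \<longlonglongrightarrow> 1"
proof -
  define z where "z n = real l * (y n / real n)" for n
  have z_lim: "z \<longlonglongrightarrow> 0"
    unfolding z_def using tendsto_mult_left[OF v_lim, of "real l"] by simp
  have nz2: "(\<lambda>n. real n * (z n)\<^sup>2) \<longlonglongrightarrow> 0"
  proof -
    have "(\<lambda>n. (real l)\<^sup>2 * (y n ^ 2 / real n)) \<longlonglongrightarrow> (real l)\<^sup>2 * 0" by (intro tendsto_intros y_pow)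
    moreover have "\<forall>\<^sub>F n in sequentially. (real l)\<^sup>2 * (y n ^ 2 / real n) = real n * (z n)\<^sup>2"
      using eventually_gt_at_top[of 0] by eventually_elim (simp add: z_def power2_eq_square)
    ultimately show ?thesis by (simp add: Lim_transform_eventually)
  qed
  define g where "g n = real (n - a) * ln (1 - z n) + real n * z n" for n
  have bounds: "\<forall>\<^sub>F n in sequentially. - 2 * (real n * (z n)\<^sup>2) \<le> g n \<and> g n \<le> real a * z n"
    using eventually_y_ge[of 0] eventually_ge_at_top[of "max a 1"]
      order_tendstoD(2)[OF z_lim, of "1/2", simplified]
  proof eventually_elim
    case (elim n)
    have z: "0 \<le> z n" "z n \<le> 1/2" using elim by (auto simp: z_def)
    have up: "ln (1 - z n) \<le> - z n" using ln_le_minus_one[of "1 - z n"] z by simp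
    have lo: "- z n - 2 * (z n)\<^sup>2 \<le> ln (1 - z n)" using z by (intro ln_one_minus_pos_lower_bound)
    have na: "real (n - a) = real n - real a" using elim by simp
    have "g n \<le> real (n - a) * (- z n) + real n * z n"
      unfolding g_def using up by (intro add_right_mono mult_left_mono) auto
    also have "\<dots> = real a * z n" by (simp add: na algebra_simps)
    finally have 1: "g n \<le> real a * z n" .
    have "- 2 * (real n * (z n)\<^sup>2) \<le> - 2 * real (n - a) * (z n)\<^sup>2 + real a * z n"
      using z by (auto simp: na algebra_simps intro!: add_nonneg_nonneg)
    also have "\<dots> = real (n - a) * (- z n - 2 * (z n)\<^sup>2) + real n * z n" by (simp add: na algebra_simps)
    also have "\<dots> \<le> g n" unfolding g_def using lo by (intro add_right_mono mult_left_mono) auto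
    finally show ?case using 1 by simp
  qed
  have "g \<longlonglongrightarrow> 0"
  proof (rule tendsto_sandwich[of "\<lambda>n. - 2 * (real n * (z n)\<^sup>2)" _ _ "\<lambda>n. real a * z n"])
    show "(\<lambda>n. - 2 * (real n * (z n)\<^sup>2)) \<longlonglongrightarrow> 0" using tendsto_mult_left[OF nz2, of "-2"] by simp
    show "(\<lambda>n. real a * z n) \<longlonglongrightarrow> 0" using tendsto_mult_left[OF z_lim, of "real a"] by simp
  qed (use bounds in \<open>auto elim: eventually_mono\<close>)
  then have "(\<lambda>n. exp (g n)) \<longlonglongrightarrow> exp 0" by (rule tendsto_exp)
  moreover have "\<forall>\<^sub>F n in sequentially. exp (g n) = (1 - real l * (y n / real n)) ^ (n - a) / exp (- real l * y n)"
    using eventually_gt_at_top[of 0] order_tendstoD(2)[OF z_lim, of "1/2", simplified]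
  proof eventually_elim
    case (elim n)
    have "exp (real (n - a) * ln (1 - z n)) = (1 - z n) ^ (n - a)"
      using elim by (simp add: exp_of_nat_mult)
    moreover have "real n * z n = real l * y n" using elim by (simp add: z_def)
    ultimately show ?case by (simp add: g_def exp_add z_def exp_minus divide_inverse)
  qed
  ultimately show ?thesis by (simp add: Lim_transform_eventually)
qed

text \<open>The induction has to carry \<open>l\<close> and \<open>a\<close>: exposing a cell adds
  its mass to the forbidden part and removes \<open>j\<close> points from the sample. Only
  \<open>j = k - 1\<close> survives in the limit, since \<open>y\<close> tends to infinity and lower
  powers are negligible.\<close>

lemma sparse_prob_asymp:
  assumes "1 \<le> k"
  shows "(\<lambda>n. sparse_prob k (y n / real n) m (n - a) (real l * (y n / real n))
    / (exp (- real (l + m) * y n) * (y n ^ (k - 1) / fact (k - 1)) ^ m)) \<longlonglongrightarrow> 1"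
proof (induction m arbitrary: a l)
  case 0
  show ?case using power_exp_asymp[of l a] by simp
next
  case (Suc m)
  \<comment> \<open>Each summand factors into \<open>A\<close> (the binomial coefficient against n^j
    / j!), \<open>B\<close> (its power of \<open>y\<close> against the dominant one) and
    \<open>R\<close> (the induction hypothesis at \<open>Suc l\<close> and
    \<open>a + j\<close>).\<close>
  define A where "A j n = real ((n - a) choose j) * fact j / real n ^ j" for j n
  define B where "B j n = (y n ^ j / fact j) / (y n ^ (k - 1) / fact (k - 1))" for j n
  define R where "R j n = sparse_prob k (y n / real n) m (n - (a + j)) (real (Suc l) * (y n / real n))
    / (exp (- real (Suc l + m) * y n) * (y n ^ (k - 1) / fact (k - 1)) ^ m)" for j n
  have B: "B j \<longlonglongrightarrow> of_bool (j = k - 1)" if "j < k" for j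
  proof (cases "j = k - 1")
    case True
    have "\<forall>\<^sub>F n in sequentially. 1 = B j n"
      using eventually_y_ge[of 1] by eventually_elim (simp add: B_def True)
    then show ?thesis using True by (simp add: Lim_transform_eventually[OF tendsto_const])
  next
    case False
    have "filterlim (\<lambda>n. y n ^ (k - 1 - j)) at_top sequentially"
      using False that by (intro filterlim_compose[OF filterlim_pow_at_top y_top] filterlim_ident) auto
    then have "(\<lambda>n. fact (k - 1) / fact j * inverse (y n ^ (k - 1 - j))) \<longlonglongrightarrow> fact (k - 1) / fact j * 0"
      by (intro tendsto_intros tendsto_inverse_0_at_top)
    moreover have "\<forall>\<^sub>F n in sequentially. fact (k - 1) / fact j * inverse (y n ^ (k - 1 - j)) = B j n"
      using eventually_y_ge[of 1]
    proof eventually_elim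
      case (elim n)
      have "y n ^ (k - 1) = y n ^ j * y n ^ (k - 1 - j)" using that by (simp flip: power_add)
      then show ?case using elim by (simp add: B_def field_simps)
    qed
    ultimately have "B j \<longlonglongrightarrow> fact (k - 1) / fact j * 0" by (rule Lim_transform_eventually)
    then show ?thesis using False by simp
  qed
  have "(\<lambda>n. \<Sum>j<k. A j n * B j n * R j n) \<longlonglongrightarrow> (\<Sum>j<k. 1 * of_bool (j = k - 1) * 1)"
    unfolding A_def R_def
    by (intro tendsto_sum tendsto_mult choose_asymp B Suc.IH) auto
  also have "(\<Sum>j<k. 1 * of_bool (j = k - 1) * 1 :: real) = 1"
    using assms by (simp add: of_bool_def)
  finally have lim: "(\<lambda>n. \<Sum>j<k. A j n * B j n * R j n) \<longlonglongrightarrow> 1" .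
  have "\<forall>\<^sub>F n in sequentially. (\<Sum>j<k. A j n * B j n * R j n)
    = sparse_prob k (y n / real n) (Suc m) (n - a) (real l * (y n / real n))
    / (exp (- real (l + Suc m) * y n) * (y n ^ (k - 1) / fact (k - 1)) ^ Suc m)"
    using eventually_gt_at_top[of 0] eventually_y_ge[of 1]
  proof eventually_elim
    case (elim n)
    define w where "w = y n ^ (k - 1) / fact (k - 1)"
    define e where "e = exp (- real (l + Suc m) * y n)"
    have "w \<noteq> 0" "e \<noteq> 0" using elim by (auto simp: w_def e_def)
    have term_eq: "A j n * B j n * R j n = real ((n - a) choose j) * (y n / real n) ^ j *
        sparse_prob k (y n / real n) m (n - a - j) (real l * (y n / real n) + y n / real n) / (e * w ^ Suc m)" for j
    proof -
      define S where "S = sparse_prob k (y n / real n) m (n - a - j) (real l * (y n / real n) + y n / real n)"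
      have R: "R j n = S / (e * w ^ m)"
        by (simp add: R_def S_def w_def e_def algebra_simps add_divide_distrib)
      have B: "B j n = (y n ^ j / fact j) / w" by (simp add: B_def w_def)
      have "A j n * B j n * R j n = real ((n - a) choose j) * (y n ^ j / real n ^ j) * S / (e * w ^ Suc m)"
        unfolding R B A_def by simp
      then show ?thesis by (simp add: S_def power_divide)
    qed
    show ?case unfolding term_eq w_def[symmetric] e_def[symmetric] by (simp add: sum_divide_distrib)
  qed
  from Lim_transform_eventually[OF lim this] show ?case .
qed

end

text \<open>A crude bound, uniform in all masses \<open>w\<close> above \<open>u\<close> with
  \<open>real N * w\<close> at most \<open>b\<close>. Each of the \<open>K\<close> summands has a
  polynomial factor of at most (1 + b)^K, and replacing \<open>N - j\<close> by \<open>N\<close> in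
  the exponent costs \<open>exp (real K)\<close> because \<open>u\<close> is at most 1.\<close>

lemma sparse_prob_single_le:
  assumes "0 \<le> u" "u \<le> w" "w \<le> 1" "real N * w \<le> b"
  shows "sparse_prob K w 1 N 0 \<le> real K * (1 + b) ^ K * exp (real K) * exp (- u * real N)"
proof -
  have b: "0 \<le> b" using assms by (meson mult_nonneg_nonneg of_nat_0_le_iff order_trans)
  have "real (N choose j) * w ^ j * (1 - w) ^ (N - j) \<le> (1 + b) ^ K * (exp (real K) * exp (- u * real N))"
    if "j < K" for j
  proof (rule mult_mono)
    have "real (N choose j) * w ^ j \<le> real N ^ j * w ^ j"
    proof (rule mult_right_mono)
      show "real (N choose j) \<le> real N ^ j"
        using binomial_le_pow[of j N] by (cases "j \<le> N") (auto simp: binomial_eq_0 simp flip: of_nat_power)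
    qed (use assms in auto)
    also have "\<dots> = (real N * w) ^ j" by (simp add: power_mult_distrib)
    also have "\<dots> \<le> (1 + b) ^ j" using assms by (intro power_mono) auto
    also have "\<dots> \<le> (1 + b) ^ K" using that b by (intro power_increasing) auto
    finally show "real (N choose j) * w ^ j \<le> (1 + b) ^ K" .
    have "(1 - w) ^ (N - j) \<le> exp (- w) ^ (N - j)"
      using assms exp_ge_add_one_self[of "- w"] by (intro power_mono) auto
    also have "\<dots> = exp (- w * real (N - j))" by (simp add: exp_of_nat_mult[symmetric] mult.commute)
    also have "\<dots> \<le> exp (real K - u * real N)"
    proof -
      have "real N - real K \<le> real (N - j)" using that by linarith
      then have "u * (real N - real K) \<le> u * real (N - j)" using assms by (intro mult_left_mono) auto
      also have "\<dots> \<le> w * real (N - j)" using assms by (intro mult_right_mono) auto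
      finally have "u * real N - u * real K \<le> w * real (N - j)" by (simp add: algebra_simps)
      moreover have "u * real K \<le> 1 * real K" using assms by (intro mult_right_mono) auto
      ultimately show ?thesis by simp
    qed
    also have "\<dots> = exp (real K) * exp (- u * real N)" by (simp flip: exp_add)
    finally show "(1 - w) ^ (N - j) \<le> exp (real K) * exp (- u * real N)" .
  qed (use assms b in auto)
  then have "(\<Sum>j<K. real (N choose j) * w ^ j * (1 - w) ^ (N - j))
      \<le> (\<Sum>j<K. (1 + b) ^ K * (exp (real K) * exp (- u * real N)))" by (intro sum_mono) auto
  then show ?thesis by (simp add: mult_ac)
qed

lemma poly_exp_sqrt_lim:
  assumes "c > 0"
  shows "((\<lambda>x::real. x ^ K * exp (- c * sqrt x)) \<longlongrightarrow> 0) at_top"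
proof -
  have lim: "filterlim (\<lambda>x. c * sqrt x) at_top at_top"
    using assms by real_asymp
  have "((\<lambda>x. (c * sqrt x) ^ (2 * K) / exp (c * sqrt x)) \<longlongrightarrow> 0) at_top"
    by (rule filterlim_compose[OF tendsto_power_div_exp_0 lim])
  then have "((\<lambda>x. inverse (c ^ (2 * K)) * ((c * sqrt x) ^ (2 * K) / exp (c * sqrt x))) \<longlongrightarrow> 0) at_top"
    by (rule tendsto_mult_right_zero)
  moreover have "\<forall>\<^sub>F x in at_top. inverse (c ^ (2 * K)) * ((c * sqrt x) ^ (2 * K) / exp (c * sqrt x))
      = x ^ K * exp (- c * sqrt x)"
    using eventually_ge_at_top[of 0]
  proof eventually_elim
    case (elim x)
    then show ?case using assms
      by (simp add: power_mult_distrib power_mult real_sqrt_pow2 exp_minus divide_inverse)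
  qed
  ultimately show ?thesis by (rule Lim_transform_eventually)
qed

text \<open>\<open>n e\<^sup>-\<^sup>y y\<^sup>k\<^sup>-\<^sup>1 / (k - 1)!\<close> is the asymptotic mean number of sample points whose ball of
  mass \<open>y / n\<close> contains fewer than \<open>k\<close> others.\<close>

locale critical_mass = growing_mass +
  fixes k :: nat and \<eta> :: real
  assumes k: "1 \<le> k"
    and mean: "(\<lambda>n. real n * exp (- y n) * y n ^ (k - 1) / fact (k - 1)) \<longlonglongrightarrow> \<eta>"
begin

lemma power_sparse_prob_lim:
  "(\<lambda>n. real n ^ m * sparse_prob k (y n / real n) m (n - a) 0) \<longlonglongrightarrow> \<eta> ^ m"
proof -
  have "(\<lambda>n. (real n * exp (- y n) * y n ^ (k - 1) / fact (k - 1)) ^ m *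
    (sparse_prob k (y n / real n) m (n - a) (real 0 * (y n / real n))
    / (exp (- real (0 + m) * y n) * (y n ^ (k - 1) / fact (k - 1)) ^ m))) \<longlonglongrightarrow> \<eta> ^ m * 1"
    by (intro tendsto_intros mean sparse_prob_asymp k)
  moreover have "\<forall>\<^sub>F n in sequentially. (real n * exp (- y n) * y n ^ (k - 1) / fact (k - 1)) ^ m *
    (sparse_prob k (y n / real n) m (n - a) (real 0 * (y n / real n))
    / (exp (- real (0 + m) * y n) * (y n ^ (k - 1) / fact (k - 1)) ^ m))
    = real n ^ m * sparse_prob k (y n / real n) m (n - a) 0"
    using eventually_y_ge[of 1]
  proof eventually_elim
    case (elim n)
    define w where "w = y n ^ (k - 1) / fact (k - 1)"
    have "w \<noteq> 0" using elim by (simp add: w_def)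
    have "exp (- real (0 + m) * y n) = exp (- y n) ^ m" by (simp add: exp_of_nat_mult[symmetric])
    moreover have "real n * exp (- y n) * y n ^ (k - 1) / fact (k - 1) = real n * exp (- y n) * w"
      by (simp add: w_def)
    ultimately show ?case unfolding w_def[symmetric] using \<open>w \<noteq> 0\<close> by (simp add: power_mult_distrib)
  qed
  ultimately show ?thesis by (simp add: Lim_transform_eventually)
qed

lemma choose_sparse_prob_lim:
  "(\<lambda>n. real (n choose m) * sparse_prob k (y n / real n) m (n - m) 0) \<longlonglongrightarrow> \<eta> ^ m / fact m"
proof -
  have "(\<lambda>n. real ((n - 0) choose m) * fact m / real n ^ m *
      (real n ^ m * sparse_prob k (y n / real n) m (n - m) 0) / fact m) \<longlonglongrightarrow> 1 * \<eta> ^ m / fact m"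
    by (intro tendsto_intros choose_asymp power_sparse_prob_lim) simp
  moreover have "\<forall>\<^sub>F n in sequentially. real ((n - 0) choose m) * fact m / real n ^ m *
      (real n ^ m * sparse_prob k (y n / real n) m (n - m) 0) / fact m
      = real (n choose m) * sparse_prob k (y n / real n) m (n - m) 0"
    using eventually_gt_at_top[of 0] by eventually_elim simp
  ultimately show ?thesis by (simp add: Lim_transform_eventually)
qed

text \<open>Lowering the threshold by one divides the leading term y^(k-1) / (k-1)! by y / (k-1), so
  the extra factor \<open>y n\<close> keeps the quantity of order one. For \<open>k = 1\<close> both
  sides are zero, the sum defining the probability being empty.\<close>

lemma sparse_prob_pred_lim:
  "(\<lambda>n. real n * y n * sparse_prob (k - 1) (y n / real n) 1 (n - a) 0) \<longlonglongrightarrow> \<eta> * real (k - 1)"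
proof (cases "k = 1")
  case False
  then have k2: "1 \<le> k - 1" "k - 1 = Suc (k - 1 - 1)" using k by auto
  have "(\<lambda>n. (real n * exp (- y n) * y n ^ (k - 1) / fact (k - 1)) * real (k - 1) *
    (sparse_prob (k - 1) (y n / real n) 1 (n - a) (real 0 * (y n / real n))
    / (exp (- real (0 + 1) * y n) * (y n ^ (k - 1 - 1) / fact (k - 1 - 1)) ^ 1))) \<longlonglongrightarrow> \<eta> * real (k - 1) * 1"
    by (intro tendsto_intros mean sparse_prob_asymp k2(1))
  moreover have "\<forall>\<^sub>F n in sequentially. (real n * exp (- y n) * y n ^ (k - 1) / fact (k - 1)) * real (k - 1) *
    (sparse_prob (k - 1) (y n / real n) 1 (n - a) (real 0 * (y n / real n))
    / (exp (- real (0 + 1) * y n) * (y n ^ (k - 1 - 1) / fact (k - 1 - 1)) ^ 1))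
    = real n * y n * sparse_prob (k - 1) (y n / real n) 1 (n - a) 0"
    using eventually_y_ge[of 1]
  proof eventually_elim
    case (elim n)
    define w where "w = y n ^ (k - 1 - 1) / fact (k - 1 - 1)"
    have "w \<noteq> 0" using elim by (simp add: w_def)
    have "y n ^ (k - 1) / fact (k - 1) * real (k - 1) = y n * w"
      unfolding w_def by (subst k2(2), subst (2) k2(2), subst (3) k2(2)) (simp only: power_Suc fact_Suc, use k2 in \<open>simp add: field_simps\<close>)
    moreover have "(real n * exp (- y n) * y n ^ (k - 1) / fact (k - 1)) * real (k - 1)
        = real n * exp (- y n) * (y n ^ (k - 1) / fact (k - 1) * real (k - 1))" by simp
    ultimately have "(real n * exp (- y n) * y n ^ (k - 1) / fact (k - 1)) * real (k - 1)
        = real n * exp (- y n) * (y n * w)" by (simp only:)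
    then show ?case unfolding w_def[symmetric] using \<open>w \<noteq> 0\<close> by simp
  qed
  ultimately show ?thesis by (simp add: Lim_transform_eventually)
qed simp

text \<open>Once \<open>y n\<close> is at least 1, \<open>real n * exp (- y n)\<close> is at most a
  constant times the convergent mean. What remains is a power of \<open>y n\<close> against
  \<open>exp (- c * sqrt (y n))\<close>.\<close>

lemma doubled_mass_lim:
  assumes "c > 0"
  shows "(\<lambda>n. real n * y n * (b * (1 + 2 * y n) ^ K * exp (- (y n + c * sqrt (y n))))) \<longlonglongrightarrow> 0"
proof -
  define F where "F x = \<bar>b\<bar> * fact (k - 1) * 3 ^ K * (x ^ Suc K * exp (- c * sqrt x))" for x
  have "((\<lambda>x. \<bar>b\<bar> * fact (k - 1) * 3 ^ K * (x ^ Suc K * exp (- c * sqrt x))) \<longlongrightarrow> 0) at_top"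
    by (rule tendsto_mult_right_zero[OF poly_exp_sqrt_lim[OF assms]])
  then have "(F \<longlongrightarrow> 0) at_top" unfolding F_def .
  then have "(\<lambda>n. F (y n)) \<longlonglongrightarrow> 0" by (rule filterlim_compose[OF _ y_top])
  from tendsto_mult[OF mean this]
  have lim: "(\<lambda>n. real n * exp (- y n) * y n ^ (k - 1) / fact (k - 1) * F (y n)) \<longlonglongrightarrow> 0" by simp
  show ?thesis
  proof (rule Lim_null_comparison[OF _ lim])
    show "\<forall>\<^sub>F n in sequentially. norm (real n * y n * (b * (1 + 2 * y n) ^ K * exp (- (y n + c * sqrt (y n)))))
      \<le> real n * exp (- y n) * y n ^ (k - 1) / fact (k - 1) * F (y n)"
      using eventually_y_ge[of 1]
    proof eventually_elim
      case (elim n)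
      have p: "(1 + 2 * y n) ^ K \<le> 3 ^ K * y n ^ K"
        using elim power_mono[of "1 + 2 * y n" "3 * y n" K] by (simp only: power_mult_distrib)
      have q: "1 \<le> y n ^ (k - 1)" using elim by simp
      have "norm (real n * y n * (b * (1 + 2 * y n) ^ K * exp (- (y n + c * sqrt (y n)))))
        = real n * exp (- y n) * \<bar>b\<bar> * exp (- c * sqrt (y n)) * y n * (1 + 2 * y n) ^ K"
        using elim by (simp add: abs_mult mult_exp_exp[symmetric] exp_diff exp_minus divide_inverse mult_ac)
      also have "\<dots> \<le> real n * exp (- y n) * \<bar>b\<bar> * exp (- c * sqrt (y n)) * y n * (3 ^ K * y n ^ K)"
        using elim p by (intro mult_left_mono) auto
      also have "\<dots> = 1 * (real n * exp (- y n) * \<bar>b\<bar> * exp (- c * sqrt (y n)) * y n * (3 ^ K * y n ^ K))" by simp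
      also have "\<dots> \<le> y n ^ (k - 1) * (real n * exp (- y n) * \<bar>b\<bar> * exp (- c * sqrt (y n)) * y n * (3 ^ K * y n ^ K))"
        using elim q by (intro mult_right_mono) auto
      also have "\<dots> = real n * exp (- y n) * y n ^ (k - 1) / fact (k - 1) * F (y n)"
        by (simp add: F_def)
      finally show ?case .
    qed
  qed
qed

end

text \<open>The quotient \<open>q\<close> of \<open>y\<close> by ln n tends to 1. The iterated
  logarithm is there so that exp (- y) = exp (- t) (k - 1)! / (n (ln n)^(k - 1)), which turns the
  mean into exp (- t) q^(k - 1).\<close>

lemma critical_mass_gumbel:
  fixes t :: real and k :: nat
  assumes "1 \<le> k"
  defines "y \<equiv> \<lambda>n. t + ln (real n) + (real k - 1) * ln (ln (real n)) - ln (fact (k - 1))"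
  shows "critical_mass y k (exp (- t))"
proof -
  define q where "q n = y n / ln (real n)" for n
  have y_eq: "\<forall>\<^sub>F n in sequentially. y n = q n * ln (real n)"
    using eventually_gt_at_top[of 1] by eventually_elim (simp add: q_def)
  have q: "q \<longlonglongrightarrow> 1"
  proof -
    have 1: "(\<lambda>n. inverse (ln (real n))) \<longlonglongrightarrow> 0" by real_asymp
    have 2: "(\<lambda>n. ln (ln (real n)) / ln (real n)) \<longlonglongrightarrow> 0" by real_asymp
    have "(\<lambda>n. 1 + (t - ln (fact (k - 1))) * inverse (ln (real n))
        + (real k - 1) * (ln (ln (real n)) / ln (real n))) \<longlonglongrightarrow>
        1 + (t - ln (fact (k - 1))) * 0 + (real k - 1) * 0"
      by (intro tendsto_intros 1 2)
    moreover have "\<forall>\<^sub>F n in sequentially. 1 + (t - ln (fact (k - 1))) * inverse (ln (real n))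
        + (real k - 1) * (ln (ln (real n)) / ln (real n)) = q n"
      using eventually_gt_at_top[of 1] by eventually_elim (simp add: q_def y_def field_simps)
    ultimately show ?thesis by (simp add: Lim_transform_eventually)
  qed
  have top: "filterlim y at_top sequentially"
  proof -
    have "filterlim (\<lambda>n. ln (real n)) at_top sequentially" by real_asymp
    from filterlim_tendsto_pos_mult_at_top[OF q _ this]
    have "filterlim (\<lambda>n. q n * ln (real n)) at_top sequentially" by simp
    then show ?thesis using filterlim_cong[OF refl refl y_eq] by simp
  qed
  show ?thesis
  proof
    show "filterlim y at_top sequentially" by (rule top)
    fix p :: nat
    have "(\<lambda>n. ln (real n) ^ p / real n) \<longlonglongrightarrow> 0"
    proof -
      have "filterlim (\<lambda>n. ln (real n)) at_top sequentially" by real_asymp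
      from filterlim_compose[OF tendsto_power_div_exp_0 this, of p]
      have "(\<lambda>n. ln (real n) ^ p / exp (ln (real n))) \<longlonglongrightarrow> 0" .
      moreover have "\<forall>\<^sub>F n in sequentially. ln (real n) ^ p / exp (ln (real n)) = ln (real n) ^ p / real n"
        using eventually_gt_at_top[of 0] by eventually_elim simp
      ultimately show ?thesis by (rule Lim_transform_eventually)
    qed
    from tendsto_mult[OF tendsto_power[OF q, of p] this]
    have "(\<lambda>n. q n ^ p * (ln (real n) ^ p / real n)) \<longlonglongrightarrow> 0" by simp
    moreover have "\<forall>\<^sub>F n in sequentially. q n ^ p * (ln (real n) ^ p / real n) = y n ^ p / real n"
      using y_eq by eventually_elim (simp add: power_mult_distrib)
    ultimately show "(\<lambda>n. y n ^ p / real n) \<longlonglongrightarrow> 0" by (rule Lim_transform_eventually)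
  next
    show "1 \<le> k" by fact
    have "(\<lambda>n. exp (- t) * q n ^ (k - 1)) \<longlonglongrightarrow> exp (- t) * 1 ^ (k - 1)" by (intro tendsto_intros q)
    moreover have "\<forall>\<^sub>F n in sequentially. exp (- t) * q n ^ (k - 1)
        = real n * exp (- y n) * y n ^ (k - 1) / fact (k - 1)"
      using eventually_gt_at_top[of 3]
    proof eventually_elim
      case (elim n)
      have "3 < real n" using elim by simp
      then have "exp 1 < real n" using exp_le by linarith
      then have "ln (exp 1) < ln (real n)" using elim by (subst ln_less_cancel_iff) auto
      then have L: "ln (real n) > 1" by simp
      have "exp (y n) = exp t * real n * exp (real (k - 1) * ln (ln (real n))) / fact (k - 1)"
        using elim assms(1) by (simp add: y_def exp_add exp_diff of_nat_diff)
      also have "exp (real (k - 1) * ln (ln (real n))) = ln (real n) ^ (k - 1)"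
        using L by (simp add: exp_of_nat_mult)
      finally have "exp (- y n) = exp (- t) * fact (k - 1) / (real n * ln (real n) ^ (k - 1))"
        using elim L by (auto simp: exp_minus field_simps)
      then show ?case using elim L by (simp add: q_def power_divide)
    qed
    ultimately show "(\<lambda>n. real n * exp (- y n) * y n ^ (k - 1) / fact (k - 1)) \<longlonglongrightarrow> exp (- t)"
      by (simp add: Lim_transform_eventually)
  qed
qed

section \<open>Balls of prescribed mass in the unit cube\<close>

text \<open>Total boundedness is used once, at unit scale, and transported by scaling and
  translation; thus one finite set \<open>K\<close> serves all centres and all
  \<open>h\<close>.\<close>

lemma cball_cover_small:
  fixes R :: real
  obtains K :: "'a::euclidean_space set" where "finite K"
    and "\<And>x h. 0 < h \<Longrightarrow> cball x (R * h) \<subseteq> (\<Union>c\<in>K. cball (x + h *\<^sub>R c) (h / 2))"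
proof -
  have "\<forall>e>0. \<exists>K. finite K \<and> cball (0::'a) R \<subseteq> (\<Union>c\<in>K. ball c e)"
    using compact_cball unfolding compact_eq_totally_bounded by (rule conjunct2)
  then obtain K where K: "finite K" "cball (0::'a) R \<subseteq> (\<Union>c\<in>K. ball c (1/2))"
    by (elim allE[of _ "1 / 2 :: real"] impE exE conjE) simp_all
  have "cball x (R * h) \<subseteq> (\<Union>c\<in>K. cball (x + h *\<^sub>R c) (h / 2))" if "0 < h" for x h
  proof
    fix y assume y: "y \<in> cball x (R * h)"
    define z where "z = inverse h *\<^sub>R (y - x)"
    have "norm z = norm (y - x) / h" using that by (simp add: z_def divide_inverse mult.commute)
    then have "norm z \<le> R" using y that by (simp add: dist_norm norm_minus_commute pos_divide_le_eq)
    then have "z \<in> cball 0 R" by simp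
    then obtain c where c: "c \<in> K" "z \<in> ball c (1/2)" using K(2) by auto
    have y_eq: "y = x + h *\<^sub>R z" using that by (simp add: z_def)
    have "dist (x + h *\<^sub>R c) y = h * dist c z"
      using that by (simp add: y_eq dist_norm flip: scaleR_diff_right)
    also have "\<dots> \<le> h * (1/2)" using c(2) that by (intro mult_left_mono) auto
    finally show "y \<in> (\<Union>c\<in>K. cball (x + h *\<^sub>R c) (h / 2))" using c(1) by auto
  qed
  with K(1) show ?thesis by (rule that)
qed

text \<open>All points of \<open>sparse_points\<close> in a set of diameter at most their radii lie in each other's
  balls, so there are at most \<open>k\<close> of them.\<close>

lemma card_sparse_points_near:
  fixes x :: "nat \<Rightarrow> 'a::euclidean_space"
  assumes "finite K" "0 < h" and cover: "\<And>x :: 'a. cball x s \<subseteq> (\<Union>c\<in>K. cball (x + h *\<^sub>R c) (h / 2))"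
    and h: "\<And>x. x \<in> Q \<Longrightarrow> h \<le> r x" and V: "V = sparse_points Q r k n x"
  shows "card {j \<in> V. dist (x i) (x j) \<le> s} \<le> k * card K"
proof -
  define G where "G c = {j \<in> V. x j \<in> cball (x i + h *\<^sub>R c) (h / 2)}" for c
  have finV: "finite V" unfolding V sparse_points_def by simp
  have card_G: "card (G c) \<le> k" for c
  proof (cases "G c = {}")
    case False
    then obtain j where j: "j \<in> G c" by blast
    define H where "H = {l \<in> {1..n} - {j}. x l \<in> cball (x j) (r (x j))}"
    have finH: "finite H" by (simp add: H_def)
    have jV: "j \<in> V" "x j \<in> cball (x i + h *\<^sub>R c) (h / 2)" using j by (auto simp: G_def)
    then have jQ: "x j \<in> Q" "card H < k" by (auto simp: V sparse_points_def H_def)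
    have "G c \<subseteq> insert j H"
    proof
      fix l assume l: "l \<in> G c"
      then have l': "l \<in> {1..n}" "x l \<in> cball (x i + h *\<^sub>R c) (h / 2)" by (auto simp: G_def V sparse_points_def)
      have "dist (x j) (x l) \<le> dist (x j) (x i + h *\<^sub>R c) + dist (x i + h *\<^sub>R c) (x l)" by (rule dist_triangle)
      also have "\<dots> \<le> h / 2 + h / 2" using jV(2) l'(2) by (intro add_mono) (auto simp: dist_commute)
      also have "\<dots> \<le> r (x j)" using h[OF jQ(1)] by simp
      finally show "l \<in> insert j H" using l'(1) by (auto simp: H_def)
    qed
    then have "card (G c) \<le> card (insert j H)" by (intro card_mono) (auto simp: H_def)
    also have "\<dots> \<le> Suc (card H)" using finH by (simp add: card_insert_if)
    finally show ?thesis using jQ(2) by simp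
  qed simp
  have "{j \<in> V. dist (x i) (x j) \<le> s} \<subseteq> (\<Union>c\<in>K. G c)"
    using cover[of "x i"] by (auto simp: G_def subset_eq)
  then have "card {j \<in> V. dist (x i) (x j) \<le> s} \<le> card (\<Union>c\<in>K. G c)"
    using assms(1) finV by (intro card_mono) (auto simp: G_def)
  also have "\<dots> \<le> (\<Sum>c\<in>K. card (G c))" using assms(1) by (rule card_UN_le)
  also have "\<dots> \<le> (\<Sum>c\<in>K. k)" by (intro sum_mono card_G)
  finally show ?thesis by (simp add: mult.commute)
qed

text \<open>The density is visible only through comparisons with Lebesgue measure: the lower one
  inside the cube, the upper one for all sets of finite volume. \<open>\<omega>\<close> is the
  volume of the unit ball.\<close>

locale cube_measure = prob_space \<mu> for \<mu> :: "'a::euclidean_space measure" +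
  fixes fl fu \<omega> :: real and d :: nat
  assumes d_eq: "d = DIM('a)" and omega_eq: "\<omega> = unit_ball_vol (real DIM('a))"
    and sets_mu [measurable_cong]: "sets \<mu> = sets borel"
    and fl: "0 < fl" and fu: "0 < fu"
    and lower: "\<And>A. A \<in> sets borel \<Longrightarrow> A \<subseteq> cbox 0 One \<Longrightarrow> fl * measure lborel A \<le> prob A"
    and upper: "\<And>A. A \<in> sets borel \<Longrightarrow> emeasure lborel A < \<infinity> \<Longrightarrow> prob A \<le> fu * measure lborel A"
    and prob_cube: "prob (cbox 0 One) = 1"
begin

lemma d_pos: "0 < d"
  unfolding d_eq by (rule DIM_positive)

lemma omega_pos: "\<omega> > 0"
  unfolding omega_eq by (rule unit_ball_vol_pos) simp

lemma space_mu: "space \<mu> = UNIV"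
  using sets_eq_imp_space_eq[OF sets_mu] by simp

lemma lborel_cball: "0 \<le> r \<Longrightarrow> measure lborel (cball (x::'a) r) = \<omega> * r ^ d"
  by (simp add: content_cball d_eq omega_eq)

lemma prob_cball_le: "0 \<le> r \<Longrightarrow> prob (cball x r) \<le> fu * \<omega> * r ^ d"
  using upper[of "cball x r"] emeasure_lborel_cball_finite[of x r] by (simp add: lborel_cball mult.assoc)

lemma prob_cball_ge:
  "0 \<le> r \<Longrightarrow> cball x r \<subseteq> cbox 0 One \<Longrightarrow> fl * \<omega> * r ^ d \<le> prob (cball x r)"
  using lower[of "cball x r"] by (simp add: lborel_cball mult.assoc)

lemma prob_mono: "A \<subseteq> B \<Longrightarrow> B \<in> sets borel \<Longrightarrow> prob A \<le> prob B"
  by (intro finite_measure_mono) (auto simp: sets_mu)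

text \<open>The upper density bound applied to the shell between two concentric balls; it makes the
  mass continuous in the radius.\<close>

lemma prob_annulus_le:
  assumes "0 \<le> r" "r \<le> r'"
  shows "prob (cball x r') - prob (cball x r) \<le> fu * \<omega> * (r' ^ d - r ^ d)"
proof -
  have sub: "cball x r \<subseteq> cball x r'" using assms by auto
  have "prob (cball x r') - prob (cball x r) = prob (cball x r' - cball x r)"
    using sub by (intro finite_measure_Diff[symmetric]) (auto simp: sets_mu)
  also have "\<dots> \<le> fu * measure lborel (cball x r' - cball x r)"
  proof (rule upper)
    show "emeasure lborel (cball x r' - cball x r) < \<infinity>"
      using emeasure_lborel_cball_finite[of x r'] emeasure_mono[of "cball x r' - cball x r" "cball x r'" lborel]
      by (auto intro: le_less_trans)
  qed auto
  also have "measure lborel (cball x r' - cball x r) = measure lborel (cball x r') - measure lborel (cball x r)"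
    using sub emeasure_lborel_cball_finite[of x r'] emeasure_lborel_cball_finite[of x r]
    by (intro measure_Diff) (auto simp: top.not_eq_extremum)
  also have "\<dots> = \<omega> * (r' ^ d - r ^ d)" using assms by (simp add: lborel_cball right_diff_distrib del: content_cball)
  finally show ?thesis by (simp add: mult.assoc)
qed

lemma continuous_prob_cball: "continuous_on {0..} (\<lambda>r. prob (cball x r))"
  unfolding continuous_on_def
proof
  fix r :: real assume r: "r \<in> {0..}"
  have le: "norm (prob (cball x r') - prob (cball x r)) \<le> fu * \<omega> * \<bar>r' ^ d - r ^ d\<bar>" if r': "r' \<in> {0..}" for r'
  proof (cases "r \<le> r'")
    case True
    then have "prob (cball x r) \<le> prob (cball x r')" "r ^ d \<le> r' ^ d"
      using r by (auto intro!: prob_mono power_mono)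
    then show ?thesis using prob_annulus_le[of r r' x] True r by simp
  next
    case False
    then have "prob (cball x r') \<le> prob (cball x r)" "r' ^ d \<le> r ^ d"
      using r' by (auto intro!: prob_mono power_mono)
    then show ?thesis using prob_annulus_le[of r' r x] False r' by simp
  qed
  have "((\<lambda>r'. fu * \<omega> * \<bar>r' ^ d - r ^ d\<bar>) \<longlongrightarrow> fu * \<omega> * \<bar>r ^ d - r ^ d\<bar>) (at r within {0..})"
    by (intro tendsto_intros)
  then have lim: "((\<lambda>r'. fu * \<omega> * \<bar>r' ^ d - r ^ d\<bar>) \<longlongrightarrow> 0) (at r within {0..})" by simp
  have "((\<lambda>r'. prob (cball x r') - prob (cball x r)) \<longlongrightarrow> 0) (at r within {0..})"
    by (rule Lim_null_comparison[OF _ lim]) (use le in \<open>auto simp: eventually_at_filter\<close>)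
  then show "((\<lambda>r. prob (cball x r)) \<longlongrightarrow> prob (cball x r)) (at r within {0..})"
    by (simp add: LIM_zero_iff)
qed

section \<open>Radii of balls of prescribed mass\<close>

lemma cube_subset_cball:
  assumes "x \<in> cbox 0 (One::'a)"
  shows "cbox 0 One \<subseteq> cball x (real d)"
proof
  fix y :: 'a assume y: "y \<in> cbox 0 One"
  have "dist x y \<le> (\<Sum>b\<in>Basis. \<bar>(x - y) \<bullet> b\<bar>)" unfolding dist_norm by (rule norm_le_l1)
  also have "\<dots> \<le> (\<Sum>b\<in>(Basis::'a set). 1)"
    using assms y by (intro sum_mono) (fastforce simp: mem_box inner_diff_left abs_le_iff)
  finally show "y \<in> cball x (real d)" by (simp add: d_eq)
qed

text \<open>The radius is the largest one of mass at most \<open>v\<close>, attained by compactness.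
  This choice gives the final equivalence without strict monotonicity of the mass, and for centres
  outside the cube as well.\<close>

lemma ball_radius_exists:
  assumes v: "0 < v" "v < 1"
  shows "\<exists>r\<ge>0. prob (cball x r) = v \<and> (\<forall>r'. prob (cball x r') \<le> v \<longleftrightarrow> r' \<le> r)"
proof -
  define b where "b = norm x + real d"
  have b: "0 \<le> b" by (simp add: b_def)
  have "cbox 0 One \<subseteq> cball x b"
  proof
    fix y :: 'a assume "y \<in> cbox 0 One"
    moreover have "(0::'a) \<in> cbox 0 One" by (simp add: mem_box)
    ultimately have "y \<in> cball 0 (real d)" using cube_subset_cball by blast
    then have "dist 0 y \<le> real d" by simp
    then show "y \<in> cball x b" using dist_triangle[of x y 0] by (simp add: b_def)
  qed
  then have "1 \<le> prob (cball x b)" using prob_mono[of "cbox 0 One" "cball x b"] prob_cube by simp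
  then have pb: "prob (cball x b) = 1" using prob_le_1[of "cball x b"] by linarith
  define A where "A = {r \<in> {0..b}. prob (cball x r) \<le> v}"
  have cont: "continuous_on {0..b} (\<lambda>r. prob (cball x r))"
    by (rule continuous_on_subset[OF continuous_prob_cball]) auto
  have "compact A" unfolding A_def
    using continuous_closed_preimage[OF cont closed_real_atLeastAtMost closed_atMost[of v]]
    by (intro compact_eq_bounded_closed[THEN iffD2] conjI)
       (auto intro: bounded_subset[OF bounded_closed_interval, of _ 0 b] simp: vimage_def Int_def conj_commute)
  moreover have "0 \<in> A" using b v prob_cball_le[of 0 x] d_pos by (auto simp: A_def zero_power)
  ultimately obtain r where r: "r \<in> A" "\<And>r'. r' \<in> A \<Longrightarrow> r' \<le> r"
    using compact_attains_sup[of A] by blast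
  have r0: "0 \<le> r" "r \<le> b" "prob (cball x r) \<le> v" using r(1) by (auto simp: A_def)
  \<comment> \<open>The intermediate value theorem is applied to the right of \<open>r\<close>;
    maximality then forces the point found to be \<open>r\<close> itself.\<close>
  obtain r1 where r1: "r \<le> r1" "r1 \<le> b" "prob (cball x r1) = v"
    using IVT'[of "\<lambda>r. prob (cball x r)" r v b] r0 pb v
      continuous_on_subset[OF cont, of "{r..b}"] by auto
  have "r1 \<in> A" using r1 r0 by (auto simp: A_def)
  then have "r1 = r" using r(2) r1(1) by (meson order_antisym)
  then have eq: "prob (cball x r) = v" using r1(3) by simp
  have "prob (cball x r') \<le> v \<longleftrightarrow> r' \<le> r" for r'
  proof
    assume le: "prob (cball x r') \<le> v"
    show "r' \<le> r"
    proof (rule ccontr)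
      assume not: "\<not> r' \<le> r"
      show False
      proof (cases "r' \<le> b")
        case True
        then have "r' \<in> A" using not r0 le by (auto simp: A_def)
        then show False using r(2) not by blast
      next
        case False
        then have "prob (cball x b) \<le> prob (cball x r')" by (intro prob_mono) auto
        then show False using le pb v by linarith
      qed
    qed
  next
    assume "r' \<le> r"
    then have "prob (cball x r') \<le> prob (cball x r)" by (intro prob_mono) auto
    then show "prob (cball x r') \<le> v" using eq by simp
  qed
  then show ?thesis using eq r0(1) by blast
qed

definition ball_radius :: "real \<Rightarrow> 'a \<Rightarrow> real" where
  "ball_radius v x = (SOME r. 0 \<le> r \<and> prob (cball x r) = v \<and> (\<forall>r'. prob (cball x r') \<le> v \<longleftrightarrow> r' \<le> r))"

context
  fixes v :: real
  assumes v: "0 < v" "v < 1"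
begin

lemma ball_radius:
  shows ball_radius_nonneg: "0 \<le> ball_radius v x"
    and prob_ball_radius: "prob (cball x (ball_radius v x)) = v"
    and le_ball_radius_iff: "r \<le> ball_radius v x \<longleftrightarrow> prob (cball x r) \<le> v"
proof -
  have "0 \<le> ball_radius v x \<and> prob (cball x (ball_radius v x)) = v
    \<and> (\<forall>r'. prob (cball x r') \<le> v \<longleftrightarrow> r' \<le> ball_radius v x)"
    unfolding ball_radius_def by (rule someI_ex) (use ball_radius_exists[OF v, of x] in blast)
  then show "0 \<le> ball_radius v x" "prob (cball x (ball_radius v x)) = v"
    "r \<le> ball_radius v x \<longleftrightarrow> prob (cball x r) \<le> v" by blast+
qed

text \<open>By \<open>le_ball_radius_iff\<close> the superlevel set at \<open>a\<close> consists of
  the centres whose ball of radius \<open>a\<close> has mass at most \<open>v\<close>. That mass is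
  measurable in the centre, being the measure of a section.\<close>

lemma measurable_ball_radius: "ball_radius v \<in> borel_measurable borel"
proof (rule borel_measurable_iff_ge[THEN iffD2], rule allI)
  fix a
  define Z where "Z = {p \<in> space (borel \<Otimes>\<^sub>M \<mu>). dist (fst p) (snd p) \<le> a}"
  have "fst \<in> borel \<Otimes>\<^sub>M \<mu> \<rightarrow>\<^sub>M borel" by (rule measurable_fst)
  moreover have "snd \<in> borel \<Otimes>\<^sub>M \<mu> \<rightarrow>\<^sub>M borel"
    using measurable_snd[of borel \<mu>] by (simp cong: measurable_cong_sets[OF refl sets_mu])
  ultimately have "Z \<in> sets (borel \<Otimes>\<^sub>M \<mu>)" unfolding Z_def
    by (intro predE pred_le_real borel_measurable_dist borel_measurable_const)
  then have "(\<lambda>x. emeasure \<mu> (Pair x -` Z)) \<in> borel_measurable borel" by (rule measurable_emeasure_Pair)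
  moreover have "Pair x -` Z = cball x a" for x
    by (auto simp: Z_def space_pair_measure space_mu)
  ultimately have "(\<lambda>x. emeasure \<mu> (cball x a)) \<in> borel_measurable borel" by simp
  then have "(\<lambda>x. prob (cball x a)) \<in> borel_measurable borel"
    unfolding measure_def by (rule borel_measurable_enn2real)
  then have "{x \<in> space borel. prob (cball x a) \<le> v} \<in> sets borel"
    by (intro predE pred_le_real borel_measurable_const)
  then show "{x \<in> space borel. a \<le> ball_radius v x} \<in> sets borel"
    unfolding le_ball_radius_iff .
qed

lemma ball_radius_lower: "inverse (root d (fu * \<omega>)) * root d v \<le> ball_radius v x"
proof -
  have "v \<le> fu * \<omega> * ball_radius v x ^ d"
    using prob_cball_le[OF ball_radius_nonneg[of x], of x] prob_ball_radius[of x] by simp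
  then have "root d v \<le> root d (fu * \<omega> * ball_radius v x ^ d)" using d_pos by simp
  also have "\<dots> = root d (fu * \<omega>) * ball_radius v x"
    using ball_radius_nonneg d_pos by (simp add: real_root_mult real_root_power_cancel)
  finally show ?thesis using fu omega_pos d_pos by (simp add: field_simps)
qed

text \<open>A ball centred near the boundary leaves the cube, so the lower density bound does not
  apply to it directly. It is applied instead to a smaller ball inside the cube and close to
  \<open>x\<close>.\<close>

lemma ball_radius_upper:
  assumes x: "x \<in> cbox 0 One" and small: "v < fl * \<omega> * (1 / 2) ^ d"
  shows "ball_radius v x \<le> 2 * real d * inverse (root d (fl * \<omega>)) * root d v"
proof -
  define c :: 'a where "c = (1 / 2) *\<^sub>R One"
  have c: "c \<bullet> b = 1 / 2" if "b \<in> Basis" for b using that by (simp add: c_def)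
  have main: "fl * \<omega> * (\<tau> / 2) ^ d \<le> prob (cball x (\<tau> * real d))" if \<tau>: "0 \<le> \<tau>" "\<tau> \<le> 1" for \<tau>
  proof -
    \<comment> \<open>\<open>y\<close> is the image of the cube's centre under the homothety with
      centre \<open>x\<close> and ratio \<open>\<tau>\<close>. The inscribed ball of radius 1/2
      becomes a ball of radius \<open>\<tau> / 2\<close>, still in the cube by convexity.\<close>
    define y where "y = x + \<tau> *\<^sub>R (c - x)"
    have xb: "0 \<le> x \<bullet> b" "x \<bullet> b \<le> 1" if "b \<in> Basis" for b using x that by (auto simp: mem_box)
    have sub1: "cball y (\<tau> / 2) \<subseteq> cbox 0 One"
    proof
      fix z assume z: "z \<in> cball y (\<tau> / 2)"
      have "0 \<le> z \<bullet> b \<and> z \<bullet> b \<le> 1" if b: "b \<in> Basis" for b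
      proof -
        have "\<bar>(z - y) \<bullet> b\<bar> \<le> \<tau> / 2"
          using Basis_le_norm[OF b, of "z - y"] z by (simp add: dist_norm norm_minus_commute)
        then have "y \<bullet> b - \<tau> / 2 \<le> z \<bullet> b" "z \<bullet> b \<le> y \<bullet> b + \<tau> / 2"
          unfolding inner_diff_left abs_le_iff by linarith+
        moreover have "y \<bullet> b = (1 - \<tau>) * (x \<bullet> b) + \<tau> / 2"
          using c[OF b] by (simp add: y_def inner_add_left inner_diff_left algebra_simps)
        moreover have "0 \<le> (1 - \<tau>) * (x \<bullet> b)" using xb[OF b] \<tau> by simp
        moreover have "(1 - \<tau>) * (x \<bullet> b) \<le> 1 - \<tau>"
          using xb[OF b] \<tau> by (intro mult_left_le) auto
        ultimately show ?thesis by argo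
      qed
      then show "z \<in> cbox 0 One" by (simp add: mem_box)
    qed
    have sub2: "cball y (\<tau> / 2) \<subseteq> cball x (\<tau> * real d)"
    proof
      fix z assume z: "z \<in> cball y (\<tau> / 2)"
      have "dist x y = \<tau> * dist x c" using \<tau> by (simp add: y_def dist_norm norm_minus_commute)
      moreover have "dist x c \<le> real d / 2"
      proof -
        have "dist x c \<le> (\<Sum>b\<in>Basis. \<bar>(x - c) \<bullet> b\<bar>)" unfolding dist_norm by (rule norm_le_l1)
        also have "\<dots> \<le> (\<Sum>b\<in>(Basis::'a set). 1 / 2)"
        proof (rule sum_mono)
          fix b :: 'a assume b: "b \<in> Basis"
          show "\<bar>(x - c) \<bullet> b\<bar> \<le> 1 / 2"
            using xb[OF b] c[OF b] unfolding inner_diff_left by linarith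
        qed
        finally show ?thesis by (simp add: d_eq)
      qed
      then have "\<tau> * dist x c \<le> \<tau> * (real d / 2)" using \<tau> by (intro mult_left_mono) auto
      moreover have "\<tau> / 2 * 1 \<le> \<tau> / 2 * real d" using \<tau> d_pos by (intro mult_left_mono) auto
      ultimately show "z \<in> cball x (\<tau> * real d)"
        using dist_triangle[of x z y] z by (simp add: field_simps)
    qed
    have "fl * \<omega> * (\<tau> / 2) ^ d \<le> prob (cball y (\<tau> / 2))" using \<tau> sub1 by (intro prob_cball_ge) auto
    also have "\<dots> \<le> prob (cball x (\<tau> * real d))" using sub2 by (intro prob_mono) auto
    finally show ?thesis .
  qed
  define R where "R = ball_radius v x"
  \<comment> \<open>Ratio 1 and the smallness of \<open>v\<close> give this rough bound, which in
    turn permits the ratio \<open>R / real d\<close> below.\<close>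
  have "R \<le> real d"
  proof (rule ccontr)
    assume "\<not> R \<le> real d"
    then have "prob (cball x (1 * real d)) \<le> prob (cball x R)" by (intro prob_mono) auto
    with main[of 1] small prob_ball_radius[of x] show False by (simp add: R_def)
  qed
  then have "fl * \<omega> * (R / real d / 2) ^ d \<le> prob (cball x (R / real d * real d))"
    using ball_radius_nonneg[of x] d_pos by (intro main) (auto simp: R_def)
  then have "fl * \<omega> * (R / real d / 2) ^ d \<le> v" using prob_ball_radius[of x] d_pos by (simp add: R_def)
  then have "root d (fl * \<omega> * (R / real d / 2) ^ d) \<le> root d v" using d_pos by simp
  then have "root d (fl * \<omega>) * (R / real d / 2) \<le> root d v"
    using ball_radius_nonneg[of x] d_pos by (simp add: real_root_mult real_root_power_cancel R_def)
  then show ?thesis using fl omega_pos d_pos by (simp add: field_simps R_def)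
qed

end

section \<open>Boundary layer and unions of two balls\<close>

lemma inner_cube:
  assumes "x \<in> cbox ((2 * s) *\<^sub>R One) ((1 - 2 * s) *\<^sub>R (One::'a))"
  shows "cball x (2 * s) \<subseteq> cbox 0 One"
proof
  fix z assume z: "z \<in> cball x (2 * s)"
  have "0 \<le> z \<bullet> b \<and> z \<bullet> b \<le> 1" if b: "b \<in> Basis" for b
  proof -
    have "\<bar>(z - x) \<bullet> b\<bar> \<le> 2 * s"
      using Basis_le_norm[OF b, of "z - x"] z by (simp add: dist_norm norm_minus_commute)
    then have "x \<bullet> b - 2 * s \<le> z \<bullet> b" "z \<bullet> b \<le> x \<bullet> b + 2 * s"
      by (auto simp: inner_diff_left abs_le_iff)
    moreover have "2 * s \<le> x \<bullet> b" "x \<bullet> b \<le> 1 - 2 * s" using assms b by (auto simp: mem_box)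
    ultimately show ?thesis by linarith
  qed
  then show "z \<in> cbox 0 One" by (simp add: mem_box)
qed

text \<open>The margin \<open>2 * s\<close> leaves room for the ball of a neighbour at distance at
  most \<open>s\<close> with radius at most \<open>s / 2\<close>. Bernoulli's inequality makes the
  volume of the layer at most linear in \<open>s\<close>.\<close>

lemma prob_boundary_layer:
  assumes "0 \<le> s" "s \<le> 1 / 4"
  shows "prob (cbox 0 One - cbox ((2 * s) *\<^sub>R One) ((1 - 2 * s) *\<^sub>R (One::'a))) \<le> fu * (4 * s * real d)"
proof -
  let ?A = "cbox ((2 * s) *\<^sub>R One) ((1 - 2 * s) *\<^sub>R (One::'a))" and ?Q = "cbox 0 (One::'a)"
  have sub: "?A \<subseteq> ?Q"
  proof
    fix z assume z: "z \<in> ?A"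
    have "0 \<le> z \<bullet> b \<and> z \<bullet> b \<le> 1" if "b \<in> Basis" for b
    proof -
      have "2 * s \<le> z \<bullet> b" "z \<bullet> b \<le> 1 - 2 * s" using z that by (auto simp: mem_box)
      then show ?thesis using assms by linarith
    qed
    then show "z \<in> ?Q" by (simp add: mem_box)
  qed
  have Q: "measure lborel ?Q = 1" by (subst measure_lborel_cbox_eq) (auto simp: inner_diff_left)
  have A: "measure lborel ?A = (1 - 4 * s) ^ d"
    using assms by (subst measure_lborel_cbox_eq) (auto simp: inner_diff_left d_eq)
  have "prob (?Q - ?A) \<le> fu * measure lborel (?Q - ?A)"
  proof (rule upper)
    show "emeasure lborel (?Q - ?A) < \<infinity>"
      using emeasure_mono[of "?Q - ?A" ?Q lborel] emeasure_lborel_cbox_finite[of 0 "One::'a"]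
      by (auto intro: le_less_trans)
  qed auto
  also have "measure lborel (?Q - ?A) = measure lborel ?Q - measure lborel ?A"
    using sub emeasure_lborel_cbox_finite[of 0 "One::'a"]
      emeasure_lborel_cbox_finite[of "(2 * s) *\<^sub>R (One::'a)" "(1 - 2 * s) *\<^sub>R One"]
    by (intro measure_Diff) (auto simp: top.not_eq_extremum)
  also have "\<dots> = 1 - (1 - 4 * s) ^ d" unfolding A Q ..
  also have "1 - (1 - 4 * s) ^ d \<le> 4 * s * real d"
    using Bernoulli_inequality[of "- 4 * s" d] assms by (simp add: mult.commute)
  finally show ?thesis using fu by simp
qed

text \<open>Of two balls of equal mass, the one of larger radius contains, at its far end, a small ball missing
  the other; as both have mass \<open>v\<close>, it does not matter which of the two that is.\<close>

lemma prob_union_balls: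
  assumes inside: "cball x (2 * s) \<subseteq> cbox 0 One"
    and rad: "\<rho> \<le> rx" "\<rho> \<le> ry" "2 * rx \<le> s" "2 * ry \<le> s" "0 < \<rho>"
    and mass: "prob (cball x rx) = v" "prob (cball y ry) = v"
    and dist: "\<rho> < dist x y" "dist x y \<le> s"
  shows "v + fl * \<omega> * (\<rho> / 4) ^ d \<le> prob (cball x rx \<union> cball y ry)"
proof -
  have far: "\<exists>z. cball z (\<rho> / 4) \<subseteq> cball b rb - cball a ra"
    if "\<rho> \<le> rb" "ra \<le> rb" "\<rho> < dist a b" for a b :: 'a and ra rb
  proof -
    define D where "D = dist a b"
    have D: "D > \<rho>" "D > 0" using that rad(5) by (auto simp: D_def)
    \<comment> \<open>\<open>z\<close> lies on the ray from \<open>a\<close> through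
      \<open>b\<close>, beyond \<open>b\<close>. Its distance to \<open>a\<close> exceeds
      \<open>rb\<close> by more than three quarters of \<open>\<rho>\<close>, so a ball of radius
      \<open>\<rho> / 4\<close> about it still misses \<open>cball a ra\<close>.\<close>
    define z where "z = b + ((rb - \<rho> / 4) / D) *\<^sub>R (b - a)"
    have "norm (b - a) = D" by (simp add: D_def dist_norm norm_minus_commute)
    have zb: "dist z b = rb - \<rho> / 4"
      using \<open>norm (b - a) = D\<close> D rad(5) that by (simp add: z_def dist_norm)
    have "z - a = (1 + (rb - \<rho> / 4) / D) *\<^sub>R (b - a)" by (simp add: z_def algebra_simps)
    then have "dist z a = (1 + (rb - \<rho> / 4) / D) * D"
      using \<open>norm (b - a) = D\<close> D rad(5) that by (simp add: dist_norm)
    also have "\<dots> = D + (rb - \<rho> / 4)" using D by (simp add: distrib_right)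
    finally have za: "dist z a = D + rb - \<rho> / 4" by simp
    have "w \<in> cball b rb - cball a ra" if w: "w \<in> cball z (\<rho> / 4)" for w
    proof -
      have "dist b w \<le> rb" using dist_triangle[of b w z] w zb by (simp add: dist_commute)
      moreover have "ra < dist a w"
        using dist_triangle[of a z w] w za D that(1) \<open>ra \<le> rb\<close> rad(5) by (simp add: dist_commute)
      ultimately show ?thesis by simp
    qed
    then show ?thesis by blast
  qed
  have inQ: "cball x rx \<union> cball y ry \<subseteq> cbox 0 One"
  proof -
    have "cball x rx \<subseteq> cball x (2 * s)" using rad by auto
    moreover have "cball y ry \<subseteq> cball x (2 * s)"
    proof
      fix w assume "w \<in> cball y ry"
      then show "w \<in> cball x (2 * s)" using dist_triangle[of x w y] dist(2) rad by simp
    qed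
    ultimately show ?thesis using inside by blast
  qed
  have add: "v + fl * \<omega> * (\<rho> / 4) ^ d \<le> prob (A \<union> B)"
    if "cball z (\<rho> / 4) \<subseteq> B - A" "prob A = v" "A \<in> sets borel" "B \<in> sets borel" "A \<union> B \<subseteq> cbox 0 One" for A B z
  proof -
    have "fl * \<omega> * (\<rho> / 4) ^ d \<le> prob (cball z (\<rho> / 4))" using that rad by (intro prob_cball_ge) auto
    moreover have "prob A + prob (cball z (\<rho> / 4)) = prob (A \<union> cball z (\<rho> / 4))"
      using that by (intro finite_measure_Union[symmetric]) (auto simp: sets_mu)
    moreover have "\<dots> \<le> prob (A \<union> B)" using that by (intro prob_mono) auto
    ultimately show ?thesis using that(2) by linarith
  qed
  show ?thesis
  proof (cases "rx \<le> ry")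
    case True
    from far[OF rad(2) this dist(1)] obtain z where "cball z (\<rho> / 4) \<subseteq> cball y ry - cball x rx" ..
    from add[OF this mass(1) _ _ inQ] show ?thesis by simp
  next
    case False
    then have "ry \<le> rx" by simp
    moreover have "\<rho> < dist y x" using dist(1) by (simp add: dist_commute)
    ultimately obtain z where "cball z (\<rho> / 4) \<subseteq> cball x rx - cball y ry"
      using far[OF rad(1), of ry y x] by (elim meta_impE exE) assumption+
    from add[OF this mass(2)] inQ show ?thesis by (simp add: Un_commute)
  qed
qed

end

section \<open>Expected separated counts and near pairs at a fixed sample size\<close>

context knn_scale
begin

abbreviation "V \<equiv> sparse_points Q r k n"

lemma V_subset: "V x \<subseteq> {1..n}"
  by (auto simp: sparse_points_def)

lemma measurable_card_V: "(\<lambda>x. card (V x)) \<in> measurable (sample {1..n}) (count_space UNIV)"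
proof -
  have "(\<lambda>x. card {i \<in> {1..n}. i \<in> V x}) \<in> measurable (sample {1..n}) (count_space UNIV)"
    by (intro measurable_card_pred pred_sparse_point) auto
  moreover have "{i \<in> {1..n}. i \<in> V x} = V x" for x using V_subset[of x] by blast
  ultimately show ?thesis by (simp only:)
qed

definition sparse_family :: "nat set \<Rightarrow> (nat \<Rightarrow> 'a) set" where
  "sparse_family S = {x \<in> space (sample {1..n}). S \<subseteq> V x \<and> separated s S x}"

lemma separated_count_eq_sum:
  assumes "x \<in> space (sample {1..n})"
  shows "real (separated_count s (V x) m x)
    = (\<Sum>S | S \<subseteq> {1..n} \<and> card S = m. indicator (sparse_family S) x)"
proof -
  have "{S. S \<subseteq> V x \<and> card S = m \<and> separated s S x}
      = {S \<in> {S. S \<subseteq> {1..n} \<and> card S = m}. x \<in> sparse_family S}"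
    using V_subset[of x] assms by (auto simp: sparse_family_def)
  then have "real (separated_count s (V x) m x)
      = real (card {S \<in> {S. S \<subseteq> {1..n} \<and> card S = m}. x \<in> sparse_family S})"
    by (simp only: separated_count_def)
  also have "\<dots> = (\<Sum>S | S \<subseteq> {1..n} \<and> card S = m. indicator (sparse_family S) x)"
    by (simp add: indicator_def of_bool_def sum.If_cases Int_def)
  finally show ?thesis .
qed

text \<open>Linearity of expectation over the \<open>m\<close>-sets of indices, which all obey the
  same bounds. Upper and lower bound differ by the factor \<open>1 - real m ^ 2 * p\<close>, which
  tends to one when \<open>p\<close> tends to zero.\<close>

lemma expectation_separated_count:
  assumes "real m * v \<le> 1"
  shows "(\<lambda>x. separated_count s (V x) m x) \<in> measurable (sample {1..n}) (count_space UNIV)"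
    and "(\<integral>x. real (separated_count s (V x) m x) \<partial>sample {1..n})
      \<le> real (n choose m) * sparse_prob k v m (n - m) 0"
    and "real (n choose m) * sparse_prob k v m (n - m) 0 * (1 - real m ^ 2 * p)
      \<le> (\<integral>x. real (separated_count s (V x) m x) \<partial>sample {1..n})"
proof -
  interpret P: prob_space "sample {1..n}" by (rule prob_space_sample)
  let ?F = "{S. S \<subseteq> {1..n} \<and> card S = m}"
  have fam: "sparse_family S \<in> sets (sample {1..n})"
      "measure (sample {1..n}) (sparse_family S) \<le> sparse_prob k v m (n - m) 0"
      "sparse_prob k v m (n - m) 0 * (1 - real m ^ 2 * p) \<le> measure (sample {1..n}) (sparse_family S)"
    if "S \<in> ?F" for S
    using prob_sparse_separated[of S m] that assms unfolding sparse_family_def by auto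
  have "(\<lambda>x. \<Sum>S\<in>?F. indicator (sparse_family S) x :: real) \<in> borel_measurable (sample {1..n})"
    using fam(1) by (intro borel_measurable_sum borel_measurable_indicator)
  then have "(\<lambda>x. real (separated_count s (V x) m x)) \<in> borel_measurable (sample {1..n})"
    by (subst measurable_cong[OF separated_count_eq_sum])
  then have "(\<lambda>x. nat \<lfloor>real (separated_count s (V x) m x)\<rfloor>) \<in> measurable (sample {1..n}) (count_space UNIV)"
    by measurable
  then show "(\<lambda>x. separated_count s (V x) m x) \<in> measurable (sample {1..n}) (count_space UNIV)" by simp
  have fin: "emeasure (sample {1..n}) A < \<infinity>" for A
    using P.emeasure_finite[of A] by (simp add: less_top)
  have "(\<integral>x. real (separated_count s (V x) m x) \<partial>sample {1..n})
      = (\<integral>x. (\<Sum>S\<in>?F. indicator (sparse_family S) x) \<partial>sample {1..n})"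
    by (intro Bochner_Integration.integral_cong refl separated_count_eq_sum)
  also have "\<dots> = (\<Sum>S\<in>?F. \<integral>x. indicator (sparse_family S) x \<partial>sample {1..n})"
    by (intro Bochner_Integration.integral_sum integrable_real_indicator fam(1) fin)
  also have "\<dots> = (\<Sum>S\<in>?F. measure (sample {1..n}) (sparse_family S))"
    using fam(1) by (intro sum.cong refl) (simp add: sets.Int_space_eq2)
  finally have eq: "(\<integral>x. real (separated_count s (V x) m x) \<partial>sample {1..n})
      = (\<Sum>S\<in>?F. measure (sample {1..n}) (sparse_family S))" .
  have card_F: "card ?F = n choose m" using n_subsets[of "{1..n}" m] by simp
  show "(\<integral>x. real (separated_count s (V x) m x) \<partial>sample {1..n})
      \<le> real (n choose m) * sparse_prob k v m (n - m) 0"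
    unfolding eq using sum_bounded_above[OF fam(2), of ?F "\<lambda>S. S"] card_F by simp
  show "real (n choose m) * sparse_prob k v m (n - m) 0 * (1 - real m ^ 2 * p)
      \<le> (\<integral>x. real (separated_count s (V x) m x) \<partial>sample {1..n})"
    unfolding eq using sum_bounded_below[OF fam(3), of ?F "\<lambda>S. S"] card_F by (simp add: mult.assoc)
qed

definition near_pairs :: "(nat \<Rightarrow> 'a) set" where
  "near_pairs = {x \<in> space (sample {1..n}). \<exists>i\<in>V x. \<exists>j\<in>V x. i \<noteq> j \<and> dist (x i) (x j) \<le> s}"

lemma prob_near_pairs:
  assumes A: "A \<in> sets borel" "A \<subseteq> Q"
    and small: "\<And>x. x \<in> Q \<Longrightarrow> \<rho> \<le> r x" "\<And>x. x \<in> Q \<Longrightarrow> prob (cball x \<rho>) \<le> q" "0 \<le> q"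
    and union: "\<And>x y. x \<in> A \<Longrightarrow> y \<in> Q \<Longrightarrow> \<rho> < dist x y \<Longrightarrow> dist x y \<le> s
        \<Longrightarrow> u \<le> prob (cball x (r x) \<union> cball y (r y))"
    and Z: "\<And>w. u \<le> w \<Longrightarrow> w \<le> 2 * v \<Longrightarrow> sparse_prob (2 * k) w 1 (n - 2) 0 \<le> Z" "0 \<le> Z"
    and "v \<le> 1"
  shows "near_pairs \<in> sets (sample {1..n})"
    and "measure (sample {1..n}) near_pairs \<le> real n ^ 2 * (sparse_prob k v 1 (n - 2) 0 * (p * prob (Q - A))
      + sparse_prob (k - 1) v 1 (n - 2) 0 * q + Z * p)"
proof -
  interpret P: prob_space "sample {1..n}" by (rule prob_space_sample)
  define E where "E = (\<lambda>(i, j). {x \<in> space (sample {1..n}). i \<in> V x \<and> j \<in> V x \<and> dist (x i) (x j) \<le> s})"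
  define O' where "O' = {z \<in> {1..n} \<times> {1..n}. fst z \<noteq> snd z}"
  define b where "b = sparse_prob k v 1 (n - 2) 0 * (p * prob (Q - A))
      + sparse_prob (k - 1) v 1 (n - 2) 0 * q + Z * p"
  have E: "E z \<in> sets (sample {1..n})" "measure (sample {1..n}) (E z) \<le> b" if "z \<in> O'" for z
  proof -
    obtain i j where z: "z = (i, j)" by (cases z)
    have "i \<in> {1..n}" "j \<in> {1..n}" "i \<noteq> j" using that by (auto simp: O'_def z)
    from prob_near_pair[OF this assms]
    show "E z \<in> sets (sample {1..n})" "measure (sample {1..n}) (E z) \<le> b"
      by (simp_all add: E_def z b_def)
  qed
  have finO: "finite O'" by (simp add: O'_def)
  have eq: "near_pairs = (\<Union>z\<in>O'. E z)"
    unfolding near_pairs_def E_def O'_def using V_subset by fastforce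
  show "near_pairs \<in> sets (sample {1..n})" unfolding eq using finO E(1) by (intro sets.finite_UN) auto
  have nonneg: "0 \<le> b"
    unfolding b_def using v_nonneg \<open>v \<le> 1\<close> small(3) Z(2) p_nonneg
    by (intro add_nonneg_nonneg mult_nonneg_nonneg sparse_prob_nonneg) auto
  have "card O' \<le> card ({1..n} \<times> {1..n})" by (intro card_mono) (auto simp: O'_def)
  then have "card O' \<le> n ^ 2" by (simp add: power2_eq_square)
  then have card_O: "real (card O') \<le> real n ^ 2" by (metis of_nat_le_iff of_nat_power)
  have "measure (sample {1..n}) near_pairs \<le> (\<Sum>z\<in>O'. measure (sample {1..n}) (E z))"
    unfolding eq using finO E(1) by (intro P.finite_measure_subadditive_finite) auto
  also have "\<dots> \<le> (\<Sum>z\<in>O'. b)" using E(2) by (intro sum_mono)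
  also have "\<dots> = real (card O') * b" by simp
  also have "\<dots> \<le> real n ^ 2 * b" using card_O nonneg by (rule mult_right_mono)
  finally show "measure (sample {1..n}) near_pairs \<le> real n ^ 2 * (sparse_prob k v 1 (n - 2) 0 * (p * prob (Q - A))
      + sparse_prob (k - 1) v 1 (n - 2) 0 * q + Z * p)" by (simp add: b_def)
qed

end

section \<open>The limit for the unit cube\<close>

locale cube_knn = cube_measure \<mu> fl fu \<omega> d + critical_mass y k \<eta>
  for \<mu> :: "'a::euclidean_space measure" and fl fu \<omega> :: real and d :: nat
    and y :: "nat \<Rightarrow> real" and k :: nat and \<eta> :: real
begin

abbreviation "Q \<equiv> cbox 0 (One :: 'a)"

definition v :: "nat \<Rightarrow> real" where "v n = y n / real n"
definition a :: "nat \<Rightarrow> real" where "a n = root d (v n)"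
text \<open>The radii of balls of mass \<open>v n\<close> centred in the cube lie between
  \<open>c1 * a n\<close> and \<open>c2 * a n\<close> for large \<open>n\<close>; both constants
  come from comparing mass with volume.\<close>

definition c1 :: real where "c1 = inverse (root d (fu * \<omega>))"
definition c2 :: real where "c2 = 2 * real d * inverse (root d (fl * \<omega>))"
definition s :: "nat \<Rightarrow> real" where "s n = 2 * c2 * a n"

text \<open>Pairs of points at distance less than \<open>\<rho> n\<close> are rare even at the scale of the radii, while
  pairs further apart have balls whose union has mass at least \<open>u n\<close>.\<close>

definition \<rho> :: "nat \<Rightarrow> real" where "\<rho> n = root d (inverse (sqrt (y n))) * (c1 * a n)"
definition p :: "nat \<Rightarrow> real" where "p n = fu * \<omega> * s n ^ d"
definition q :: "nat \<Rightarrow> real" where "q n = fu * \<omega> * \<rho> n ^ d"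
text \<open>The constant for which \<open>real n * u n\<close> equals
  \<open>y n + c * sqrt (y n)\<close>: the surplus mass of a union, rescaled by the sample
  size.\<close>

definition c :: real where "c = fl * \<omega> * (c1 / 4) ^ d"
definition u :: "nat \<Rightarrow> real" where "u n = v n + fl * \<omega> * (\<rho> n / 4) ^ d"
text \<open>This is the bound of \<open>sparse_prob_single_le\<close> for threshold
  \<open>2 * k\<close> and expected count at most \<open>2 * y n\<close>; \<open>exp 2\<close> pays
  for passing from \<open>n - 2\<close> to \<open>n\<close> points.\<close>

definition Z :: "nat \<Rightarrow> real" where
  "Z n = real (2 * k) * (1 + 2 * y n) ^ (2 * k) * exp (real (2 * k)) * (exp 2 * exp (- (y n + c * sqrt (y n))))"

lemma constants_pos: "0 < c1" "0 < c2" "0 < c"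
  using fl fu omega_pos d_pos by (simp_all add: c1_def c2_def c_def)

lemma v_tendsto: "v \<longlonglongrightarrow> 0"
  unfolding v_def[abs_def] by (rule v_lim)

lemma a_tendsto: "a \<longlonglongrightarrow> 0"
  unfolding a_def[abs_def] using tendsto_real_root[OF v_tendsto, of d] by simp

lemma s_tendsto: "s \<longlonglongrightarrow> 0"
  unfolding s_def[abs_def] using tendsto_mult_right_zero[OF a_tendsto, of "2 * c2"] by simp

text \<open>The demands on a large sample: \<open>2 * v n < 1\<close> keeps the mass of two balls
  below one, the other bound on \<open>v n\<close> is that of \<open>ball_radius_upper\<close>, and
  \<open>s n \<le> 1 / 4\<close> keeps the inner cube nonempty.\<close>

definition good :: "nat \<Rightarrow> bool" where
  "good n \<longleftrightarrow> 2 \<le> n \<and> 1 \<le> y n \<and> 0 < v n \<and> 2 * v n < 1 \<and> v n < fl * \<omega> * (1 / 2) ^ d \<and> s n \<le> 1 / 4"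

lemma eventually_good: "eventually good sequentially"
proof -
  have "0 < fl * \<omega> * (1 / 2) ^ d" using fl omega_pos by simp
  then have "\<forall>\<^sub>F n in sequentially. v n < fl * \<omega> * (1 / 2) ^ d"
    using order_tendstoD(2)[OF v_tendsto] by blast
  moreover have "\<forall>\<^sub>F n in sequentially. v n < 1 / 2" using order_tendstoD(2)[OF v_tendsto, of "1 / 2"] by simp
  moreover have "\<forall>\<^sub>F n in sequentially. s n < 1 / 4" using order_tendstoD(2)[OF s_tendsto, of "1 / 4"] by simp
  ultimately show ?thesis
    using eventually_ge_at_top[of 2] eventually_y_ge[of 1]
    by eventually_elim (auto simp: good_def v_def)
qed

lemma goodD:
  assumes "good n"
  shows "2 \<le> n" "1 \<le> y n" "0 < v n" "v n < 1" "2 * v n \<le> 1" "v n < fl * \<omega> * (1 / 2) ^ d" "s n \<le> 1 / 4"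
    "0 < a n" "0 < s n" "0 < \<rho> n" "real n * v n = y n" "a n ^ d = v n"
  using assms constants_pos d_pos by (auto simp: good_def a_def s_def \<rho>_def v_def)

lemma \<rho>_power: "good n \<Longrightarrow> \<rho> n ^ d = inverse (sqrt (y n)) * (c1 ^ d * v n)"
  using goodD[of n] d_pos by (simp add: \<rho>_def power_mult_distrib)

lemma \<rho>_le: "good n \<Longrightarrow> \<rho> n \<le> c1 * a n"
  using goodD[of n] constants_pos d_pos
  by (auto simp: \<rho>_def inverse_le_1_iff intro!: mult_left_le_one_le)

lemma knn_scale_good:
  assumes "good n"
  shows "knn_scale \<mu> Q (ball_radius (v n)) (v n) (s n) (p n)"
proof -
  note g = goodD[OF assms]
  show ?thesis
  proof (unfold_locales, goal_cases)
    case 4 show ?case using measurable_ball_radius g by simp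
  next
    case (5 x) then show ?case using prob_ball_radius g by simp
  next
    case (6 x) then show ?case using ball_radius_upper[OF g(3,4) _ g(6), of x]
      by (simp add: s_def a_def c2_def mult_ac)
  next
    case (7 x) then show ?case using prob_cball_le[of "s n" x] g by (simp add: p_def)
  qed (auto simp: sets_mu prob_cube)
qed

lemma union_mass:
  assumes "good n" and x: "x \<in> cbox ((2 * s n) *\<^sub>R One) ((1 - 2 * s n) *\<^sub>R One)" "y' \<in> Q"
    and dist: "\<rho> n < dist x y'" "dist x y' \<le> s n"
  shows "u n \<le> prob (cball x (ball_radius (v n) x) \<union> cball y' (ball_radius (v n) y'))"
proof -
  interpret K: knn_scale \<mu> Q "ball_radius (v n)" "v n" "s n" "p n" k n
    by (rule knn_scale_good[OF assms(1)])
  note g = goodD[OF assms(1)]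
  have sub: "cball x (2 * s n) \<subseteq> Q" by (rule inner_cube[OF x(1)])
  then have xQ: "x \<in> Q" using g by auto
  have low: "\<rho> n \<le> ball_radius (v n) z" for z
    using ball_radius_lower[OF g(3,4), of z] \<rho>_le[OF assms(1)] by (simp add: c1_def a_def)
  show ?thesis unfolding u_def
    by (rule prob_union_balls[OF sub low low K.radius[OF xQ] K.radius[OF x(2)] g(10)
          prob_ball_radius[OF g(3,4)] prob_ball_radius[OF g(3,4)] dist])
qed

lemma u_eq: "good n \<Longrightarrow> real n * u n = y n + c * sqrt (y n)"
proof -
  assume g: "good n"
  note gd = goodD[OF g]
  have "real n * u n = real n * v n + c * (inverse (sqrt (y n)) * (real n * v n))"
    using \<rho>_power[OF g] by (simp add: u_def c_def power_divide algebra_simps)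
  also have "inverse (sqrt (y n)) * (real n * v n) = sqrt (y n)"
    using gd by (simp add: field_simps)
  finally show ?thesis using gd by simp
qed

lemma sparse_prob_le_Z:
  assumes "good n" "u n \<le> w" "w \<le> 2 * v n"
  shows "sparse_prob (2 * k) w 1 (n - 2) 0 \<le> Z n"
proof -
  note g = goodD[OF assms(1)]
  have u0: "0 \<le> u n" using g fl omega_pos by (simp add: u_def)
  have u1: "u n \<le> 1" using assms g by linarith
  have "real (n - 2) * w \<le> real n * (2 * v n)" using assms u0 by (intro mult_mono) auto
  then have "sparse_prob (2 * k) w 1 (n - 2) 0
    \<le> real (2 * k) * (1 + 2 * y n) ^ (2 * k) * exp (real (2 * k)) * exp (- u n * real (n - 2))"
    using assms g u0 by (intro sparse_prob_single_le) auto
  also have "exp (- u n * real (n - 2)) \<le> exp 2 * exp (- (y n + c * sqrt (y n)))"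
  proof -
    have "u n * real (n - 2) = real n * u n - 2 * u n" using g by (simp add: algebra_simps of_nat_diff)
    then have "- u n * real (n - 2) \<le> 2 + - (y n + c * sqrt (y n))"
      using u1 u_eq[OF assms(1)] by simp
    then show ?thesis by (simp flip: exp_add)
  qed
  finally show ?thesis using g unfolding Z_def by (simp add: mult_left_mono)
qed

text \<open>The three summands account for pairs near the boundary, for pairs at distance at most \<open>\<rho> n\<close>,
  and for pairs whose balls have a union of mass at least \<open>u n\<close>.\<close>

definition pair_bound :: "nat \<Rightarrow> real" where
  "pair_bound n = real n ^ 2 * (sparse_prob k (v n) 1 (n - 2) 0 * (p n * (fu * (4 * s n * real d)))
    + sparse_prob (k - 1) (v n) 1 (n - 2) 0 * q n + Z n * p n)"

text \<open>The product is the d-th root of y^(d+1) / n, so \<open>y_pow\<close> applies. It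
  disposes of the boundary: a layer of thickness of order \<open>a n\<close> meets an expected
  number of order \<open>y n\<close> of points near a given one.\<close>

lemma y_a_tendsto: "(\<lambda>n. y n * a n) \<longlonglongrightarrow> 0"
proof -
  have "(\<lambda>n. root d (y n ^ Suc d / real n)) \<longlonglongrightarrow> 0"
    using tendsto_real_root[OF y_pow[of "Suc d"], of d] by simp
  moreover have "\<forall>\<^sub>F n in sequentially. root d (y n ^ Suc d / real n) = y n * a n"
    using eventually_good
  proof eventually_elim
    case (elim n)
    have "y n ^ Suc d / real n = y n ^ d * v n" by (simp add: v_def)
    then show ?case using goodD(2)[OF elim] d_pos by (simp add: a_def real_root_mult real_root_power_cancel)
  qed
  ultimately show ?thesis by (rule Lim_transform_eventually)
qed

text \<open>Both \<open>p n\<close> and \<open>q n\<close> contain the factor \<open>v n\<close>,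
  and one factor \<open>n\<close> turns it into \<open>y n\<close>. Up to bounded factors the
  summands are then \<open>y n * a n\<close>, \<open>inverse (sqrt (y n))\<close>, and a power of
  \<open>y n\<close> times \<open>exp (- c * sqrt (y n))\<close>.\<close>

lemma pair_bound_tendsto: "pair_bound \<longlonglongrightarrow> 0"
proof -
  define Cp where "Cp = fu * \<omega> * (2 * c2) ^ d"
  define b where "b = Cp * (real (2 * k) * exp (real (2 * k)) * exp 2)"
  have 1: "(\<lambda>n. (real n ^ 1 * sparse_prob k (y n / real n) 1 (n - 2) 0)
      * (Cp * fu * 4 * 2 * c2 * real d * (y n * a n))) \<longlonglongrightarrow> \<eta> ^ 1 * (Cp * fu * 4 * 2 * c2 * real d * 0)"
    by (intro tendsto_intros power_sparse_prob_lim y_a_tendsto)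
  have sq: "(\<lambda>n. inverse (sqrt (y n))) \<longlonglongrightarrow> 0"
    by (intro tendsto_inverse_0_at_top filterlim_compose[OF sqrt_at_top y_top])
  have 2: "(\<lambda>n. (real n * y n * sparse_prob (k - 1) (y n / real n) 1 (n - 2) 0)
      * (fu * \<omega> * c1 ^ d * inverse (sqrt (y n)))) \<longlonglongrightarrow> \<eta> * real (k - 1) * (fu * \<omega> * c1 ^ d * 0)"
    by (intro tendsto_intros sparse_prob_pred_lim sq)
  have 3: "(\<lambda>n. real n * y n * (b * (1 + 2 * y n) ^ (2 * k) * exp (- (y n + c * sqrt (y n))))) \<longlonglongrightarrow> 0"
    by (rule doubled_mass_lim[OF constants_pos(3)])
  have "(\<lambda>n. (real n ^ 1 * sparse_prob k (y n / real n) 1 (n - 2) 0)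
        * (Cp * fu * 4 * 2 * c2 * real d * (y n * a n))
      + (real n * y n * sparse_prob (k - 1) (y n / real n) 1 (n - 2) 0)
        * (fu * \<omega> * c1 ^ d * inverse (sqrt (y n)))
      + real n * y n * (b * (1 + 2 * y n) ^ (2 * k) * exp (- (y n + c * sqrt (y n))))) \<longlonglongrightarrow> 0"
    using tendsto_add[OF tendsto_add[OF 1 2] 3] by simp
  moreover have "\<forall>\<^sub>F n in sequentially. (real n ^ 1 * sparse_prob k (y n / real n) 1 (n - 2) 0)
        * (Cp * fu * 4 * 2 * c2 * real d * (y n * a n))
      + (real n * y n * sparse_prob (k - 1) (y n / real n) 1 (n - 2) 0)
        * (fu * \<omega> * c1 ^ d * inverse (sqrt (y n)))
      + real n * y n * (b * (1 + 2 * y n) ^ (2 * k) * exp (- (y n + c * sqrt (y n)))) = pair_bound n"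
    using eventually_good
  proof eventually_elim
    case (elim n)
    note g = goodD[OF elim]
    have p: "p n = Cp * v n" using g by (simp add: p_def s_def Cp_def power_mult_distrib)
    have q: "q n = fu * \<omega> * c1 ^ d * inverse (sqrt (y n)) * v n" by (simp add: q_def \<rho>_power[OF elim])
    have Z: "Z n * Cp = b * (1 + 2 * y n) ^ (2 * k) * exp (- (y n + c * sqrt (y n)))"
      by (simp add: Z_def b_def)
    have "pair_bound n = real n * sparse_prob k (v n) 1 (n - 2) 0 * (Cp * (real n * v n) * (fu * (4 * s n * real d)))
      + real n * (real n * v n) * sparse_prob (k - 1) (v n) 1 (n - 2) 0 * (fu * \<omega> * c1 ^ d * inverse (sqrt (y n)))
      + real n * (real n * v n) * (Z n * Cp)"
      unfolding pair_bound_def p q by (simp add: power2_eq_square algebra_simps)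
    also have "\<dots> = real n * sparse_prob k (v n) 1 (n - 2) 0 * (Cp * y n * (fu * (4 * s n * real d)))
      + real n * y n * sparse_prob (k - 1) (v n) 1 (n - 2) 0 * (fu * \<omega> * c1 ^ d * inverse (sqrt (y n)))
      + real n * y n * (b * (1 + 2 * y n) ^ (2 * k) * exp (- (y n + c * sqrt (y n))))"
      unfolding g(11) Z ..
    finally show ?case by (simp add: s_def v_def mult_ac)
  qed
  ultimately show ?thesis by (rule Lim_transform_eventually)
qed

abbreviation "sample n \<equiv> PiM {1..n} (\<lambda>_. \<mu>)"
abbreviation "V n \<equiv> sparse_points Q (ball_radius (v n)) k n"

lemma near_pairs_bound:
  assumes "good n"
  defines "W \<equiv> {x \<in> space (sample n). \<exists>i\<in>V n x. \<exists>j\<in>V n x. i \<noteq> j \<and> dist (x i) (x j) \<le> s n}"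
  shows "W \<in> sets (sample n)" "measure (sample n) W \<le> pair_bound n"
proof -
  interpret K: knn_scale \<mu> Q "ball_radius (v n)" "v n" "s n" "p n" k n
    by (rule knn_scale_good[OF assms(1)])
  note g = goodD[OF assms(1)]
  define A where "A = cbox ((2 * s n) *\<^sub>R One) ((1 - 2 * s n) *\<^sub>R (One :: 'a))"
  have A: "A \<in> sets borel" "A \<subseteq> Q"
  proof -
    show "A \<subseteq> Q"
    proof
      fix x assume "x \<in> A"
      then have "cball x (2 * s n) \<subseteq> Q" unfolding A_def by (rule inner_cube)
      then show "x \<in> Q" using g by auto
    qed
  qed (simp add: A_def)
  have low: "\<rho> n \<le> ball_radius (v n) z" for z
    using ball_radius_lower[OF g(3,4), of z] \<rho>_le[OF assms(1)] by (simp add: c1_def a_def)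
  have qb: "prob (cball x (\<rho> n)) \<le> q n" for x using prob_cball_le[of "\<rho> n" x] g by (simp add: q_def)
  have q0: "0 \<le> q n" using measure_nonneg qb by (rule order_trans)
  have un: "u n \<le> prob (cball x (ball_radius (v n) x) \<union> cball y' (ball_radius (v n) y'))"
    if "x \<in> A" "y' \<in> Q" "\<rho> n < dist x y'" "dist x y' \<le> s n" for x y'
    using union_mass[OF assms(1) _ that(2-4)] that(1) by (simp add: A_def)
  have Z0: "0 \<le> Z n" using g by (simp add: Z_def)
  have W_eq: "W = K.near_pairs" by (simp add: W_def K.near_pairs_def)
  note near = K.prob_near_pairs[OF A low qb q0 un sparse_prob_le_Z[OF assms(1)] Z0 less_imp_le[OF g(4)]]
  show "W \<in> sets (sample n)" unfolding W_eq by (rule near(1))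
  have "prob (Q - A) \<le> fu * (4 * s n * real d)"
    unfolding A_def using g by (intro prob_boundary_layer) auto
  then have "sparse_prob k (v n) 1 (n - 2) 0 * (p n * prob (Q - A))
    \<le> sparse_prob k (v n) 1 (n - 2) 0 * (p n * (fu * (4 * s n * real d)))"
    using g K.p_nonneg by (intro mult_left_mono sparse_prob_nonneg) auto
  then have "real n ^ 2 * (sparse_prob k (v n) 1 (n - 2) 0 * (p n * prob (Q - A))
      + sparse_prob (k - 1) (v n) 1 (n - 2) 0 * q n + Z n * p n) \<le> pair_bound n"
    unfolding pair_bound_def by (intro mult_left_mono) (linarith, simp)
  then show "measure (sample n) W \<le> pair_bound n" unfolding W_eq using near(2) by linarith
qed

theorem void_limit:
  "(\<lambda>n. measure (sample n) {x \<in> space (sample n). card (V n x) = 0}) \<longlonglongrightarrow> exp (- \<eta>)"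
proof -
  define W where "W n = {x \<in> space (sample n). \<exists>i\<in>V n x. \<exists>j\<in>V n x. i \<noteq> j \<and> dist (x i) (x j) \<le> s n}" for n
  \<comment> \<open>\<open>s n\<close> is this ratio times the lower radius bound
    \<open>c1 * a n\<close>. With \<open>h = c1 * a n\<close> the cells have diameter at most every
    radius, and their number does not depend on \<open>n\<close>.\<close>
  obtain K :: "'a set" where K: "finite K"
    "\<And>x h. 0 < h \<Longrightarrow> cball x (2 * c2 / c1 * h) \<subseteq> (\<Union>b\<in>K. cball (x + h *\<^sub>R b) (h / 2))"
    using cball_cover_small[of "2 * c2 / c1"] by blast
  define D where "D = k * card K"
  have V_sub: "V n x \<subseteq> {1..n}" for n x unfolding sparse_points_def by blast
  have finV: "finite (V n x)" for n x by (simp add: sparse_points_def)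
  show ?thesis
  proof (rule void_probability_limit[where W = W
        and T = "\<lambda>n m x. separated_count (s n) (V n x) m x" and C = "\<lambda>m. real ((D * m) ^ m)"])
    fix n m :: nat and x
    show "prob_space (sample n)" by (intro prob_space_PiM prob_space_axioms)
    show "card (V n x) \<le> n" using card_mono[OF finite_atLeastAtMost V_sub[of n x]] by simp
    show "separated_count (s n) (V n x) m x \<le> card (V n x) choose m"
      by (rule separated_count_le[OF finV])
    assume "x \<in> space (sample n)" "x \<notin> W n"
    then have "separated (s n) (V n x) x" unfolding W_def separated_def by (simp add: not_le) blast
    then show "separated_count (s n) (V n x) m x = card (V n x) choose m"
      by (rule separated_count_eq[OF finV])
  next
    show "\<forall>\<^sub>F n in sequentially. (\<lambda>x. card (V n x)) \<in> measurable (sample n) (count_space UNIV)"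
      using eventually_good
    proof eventually_elim
      case (elim n)
      interpret K: knn_scale \<mu> Q "ball_radius (v n)" "v n" "s n" "p n" k n
        by (rule knn_scale_good[OF elim])
      show ?case by (rule K.measurable_card_V)
    qed
    show "\<forall>\<^sub>F n in sequentially. W n \<in> sets (sample n)"
      using eventually_good unfolding W_def by eventually_elim (rule near_pairs_bound(1))
    have "\<forall>\<^sub>F n in sequentially. norm (measure (sample n) (W n)) \<le> pair_bound n"
      using eventually_good
    proof eventually_elim
      case (elim n)
      show ?case unfolding W_def real_norm_def abs_of_nonneg[OF measure_nonneg]
        by (rule near_pairs_bound(2)[OF elim])
    qed
    then show "(\<lambda>n. measure (sample n) (W n)) \<longlonglongrightarrow> 0"
      by (rule Lim_null_comparison[OF _ pair_bound_tendsto])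
  next
    fix m
    have "(\<lambda>n. real m * v n) \<longlonglongrightarrow> 0" using tendsto_mult_right_zero[OF v_tendsto] .
    then have "\<forall>\<^sub>F n in sequentially. real m * v n < 1" by (rule order_tendstoD) simp
    then have ev: "\<forall>\<^sub>F n in sequentially. good n \<and> real m * v n \<le> 1"
      using eventually_good by eventually_elim auto
    show "\<forall>\<^sub>F n in sequentially. (\<lambda>x. separated_count (s n) (V n x) m x) \<in> measurable (sample n) (count_space UNIV)"
      using ev
    proof eventually_elim
      case (elim n)
      interpret K: knn_scale \<mu> Q "ball_radius (v n)" "v n" "s n" "p n" k n
        using elim by (intro knn_scale_good) auto
      show ?case using elim by (intro K.expectation_separated_count) auto
    qed
    show "\<forall>\<^sub>F n in sequentially. AE x in sample n. real (card (V n x)) ^ m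
        \<le> real ((D * m) ^ m) * (1 + real (separated_count (s n) (V n x) m x))"
      using eventually_good
    proof eventually_elim
      case (elim n)
      note g = goodD[OF elim]
      have "card (V n x) ^ m \<le> (D * m) ^ m * (1 + separated_count (s n) (V n x) m x)" for x
      proof (rule power_card_le_separated_count[OF finV])
        fix i
        show "card {j \<in> V n x. dist (x i) (x j) \<le> s n} \<le> D" unfolding D_def
        proof (rule card_sparse_points_near[OF K(1) _ _ _ refl])
          show "0 < c1 * a n" using g constants_pos by simp
          then show "cball z (s n) \<subseteq> (\<Union>b\<in>K. cball (z + (c1 * a n) *\<^sub>R b) (c1 * a n / 2))" for z
            using K(2)[of "c1 * a n" z] constants_pos by (simp add: s_def mult.assoc)
          show "c1 * a n \<le> ball_radius (v n) z" for z
            using ball_radius_lower[OF g(3,4), of z] by (simp add: c1_def a_def)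
        qed
      qed (use g in auto)
      then have "real (card (V n x) ^ m) \<le> real ((D * m) ^ m * (1 + separated_count (s n) (V n x) m x))" for x
        by (simp only: of_nat_le_iff)
      then show ?case by (intro AE_I2) (simp only: of_nat_mult of_nat_add of_nat_power of_nat_1)
    qed
    show "(\<lambda>n. \<integral>x. real (separated_count (s n) (V n x) m x) \<partial>sample n) \<longlonglongrightarrow> \<eta> ^ m / fact m"
    proof -
      have up: "(\<lambda>n. real (n choose m) * sparse_prob k (v n) m (n - m) 0) \<longlonglongrightarrow> \<eta> ^ m / fact m"
        unfolding v_def by (rule choose_sparse_prob_lim)
      have "(\<lambda>n. fu * \<omega> * s n ^ d) \<longlonglongrightarrow> fu * \<omega> * 0 ^ d" by (intro tendsto_intros s_tendsto)
      then have "p \<longlonglongrightarrow> 0" using d_pos by (simp add: p_def[abs_def] zero_power)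
      then have "(\<lambda>n. real (n choose m) * sparse_prob k (v n) m (n - m) 0 * (1 - real m ^ 2 * p n))
          \<longlonglongrightarrow> \<eta> ^ m / fact m * (1 - real m ^ 2 * 0)"
        by (intro tendsto_intros up)
      then have low: "(\<lambda>n. real (n choose m) * sparse_prob k (v n) m (n - m) 0 * (1 - real m ^ 2 * p n))
          \<longlonglongrightarrow> \<eta> ^ m / fact m" by simp
      have both: "\<forall>\<^sub>F n in sequentially.
          real (n choose m) * sparse_prob k (v n) m (n - m) 0 * (1 - real m ^ 2 * p n)
            \<le> (\<integral>x. real (separated_count (s n) (V n x) m x) \<partial>sample n)
        \<and> (\<integral>x. real (separated_count (s n) (V n x) m x) \<partial>sample n)
            \<le> real (n choose m) * sparse_prob k (v n) m (n - m) 0"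
        using ev
      proof eventually_elim
        case (elim n)
        interpret K: knn_scale \<mu> Q "ball_radius (v n)" "v n" "s n" "p n" k n
          using elim by (intro knn_scale_good) auto
        show ?case using K.expectation_separated_count(2,3)[of m] elim by simp
      qed
      show ?thesis
        by (rule tendsto_sandwich[OF _ _ low up]; use both in \<open>auto elim: eventually_mono\<close>)
    qed
  qed
qed

end

section \<open>Nearest-neighbour distances\<close>

text \<open>In a sorted list the entries at most \<open>c\<close> form an initial segment.\<close>

lemma sorted_nth_le_iff:
  fixes ys :: "real list"
  assumes "sorted ys" "l < length ys"
  shows "ys ! l \<le> c \<longleftrightarrow> l < length (filter (\<lambda>z. z \<le> c) ys)"
  using assms
proof (induction ys arbitrary: l)
  case (Cons b ys)
  show ?case
  proof (cases "b \<le> c")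
    case True
    then show ?thesis using Cons by (cases l) auto
  next
    case False
    then have "filter (\<lambda>z. z \<le> c) ys = []" using Cons.prems(1) by (auto simp: filter_empty_conv)
    moreover have "b \<le> (b # ys) ! l" using Cons.prems by (cases l) auto
    ultimately show ?thesis using False by auto
  qed
qed simp

text \<open>Duality of order statistics and counts. The \<open>k\<close>-th smallest distance has
  list index \<open>k - 1\<close>, and \<open>k < n\<close> makes this a valid index among the
  \<open>n - 1\<close> distances.\<close>

lemma knn_dist_le_iff:
  assumes "i \<in> {1..n}" "1 \<le> k" "k < n"
  shows "knn_dist x i n k \<le> c \<longleftrightarrow> k \<le> card {j \<in> {1..n} - {i}. x j \<in> cball (x i) c}"
proof -
  define js where "js = filter (\<lambda>j. j \<noteq> i) [1..<Suc n]"
  define ds where "ds = map (\<lambda>j. dist (x i) (x j)) js"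
  have js: "distinct js" "set js = {1..n} - {i}" by (auto simp: js_def)
  have "length js = n - 1" using distinct_card[OF js(1)] js(2) assms(1) by simp
  then have len: "k - 1 < length (sort ds)" using assms by (simp add: ds_def)
  have "length (filter (\<lambda>z. z \<le> c) (sort ds)) = length (filter (\<lambda>z. z \<le> c) ds)"
    by (metis mset_filter mset_sort size_mset)
  also have "\<dots> = length (filter (\<lambda>j. dist (x i) (x j) \<le> c) js)" by (simp add: ds_def filter_map o_def)
  also have "\<dots> = card (set (filter (\<lambda>j. dist (x i) (x j) \<le> c) js))"
    using js(1) by (intro distinct_card[symmetric] distinct_filter)
  also have "set (filter (\<lambda>j. dist (x i) (x j) \<le> c) js) = {j \<in> {1..n} - {i}. x j \<in> cball (x i) c}"
    by (auto simp: js(2))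
  finally have count: "length (filter (\<lambda>z. z \<le> c) (sort ds)) = card {j \<in> {1..n} - {i}. x j \<in> cball (x i) c}" .
  have "knn_dist x i n k = sort ds ! (k - 1)" by (simp add: knn_dist_def ds_def js_def)
  then have "knn_dist x i n k \<le> c \<longleftrightarrow> k - 1 < card {j \<in> {1..n} - {i}. x j \<in> cball (x i) c}"
    using sorted_nth_le_iff[OF sorted_sort len, of c] by (simp only: count)
  then show ?thesis using assms(2) by linarith
qed

text \<open>Only coordinates in \<open>{1..n}\<close> are read, so the infinite sample may be
  replaced by its restriction, a point of the product space.\<close>

lemma max_knn_ball_measure_cong:
  assumes "\<And>i. i \<in> {1..n} \<Longrightarrow> x i = x' i"
  shows "max_knn_ball_measure \<mu> x n k = max_knn_ball_measure \<mu> x' n k"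
proof -
  have "knn_dist x i n k = knn_dist x' i n k" if "i \<in> {1..n}" for i
  proof -
    have "map (\<lambda>j. dist (x i) (x j)) (filter (\<lambda>j. j \<noteq> i) [1..<Suc n])
        = map (\<lambda>j. dist (x' i) (x' j)) (filter (\<lambda>j. j \<noteq> i) [1..<Suc n])"
    proof (rule map_cong[OF refl])
      fix j assume "j \<in> set (filter (\<lambda>j. j \<noteq> i) [1..<Suc n])"
      then have "j \<in> {1..n}" unfolding set_filter set_upt by auto
      then show "dist (x i) (x j) = dist (x' i) (x' j)" using assms[OF that] assms[of j] by simp
    qed
    then show ?thesis by (simp only: knn_dist_def)
  qed
  then have "(\<lambda>i. measure \<mu> (cball (x i) (knn_dist x i n k))) ` {1..n}
      = (\<lambda>i. measure \<mu> (cball (x' i) (knn_dist x' i n k))) ` {1..n}"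
    using assms by (intro image_cong refl) simp
  then show ?thesis by (simp only: max_knn_ball_measure_def)
qed

section \<open>From nearest-neighbour balls to sparse points\<close>

context cube_knn
begin

text \<open>\<open>le_ball_radius_iff\<close> turns the comparison of masses into one of radii, and
  \<open>knn_dist_le_iff\<close> turns that into one of counts. This holds for every configuration,
  inside the cube or not.\<close>

lemma max_knn_le_iff:
  assumes "good n" "k < n"
  shows "max_knn_ball_measure \<mu> x n k \<le> v n
    \<longleftrightarrow> (\<forall>i\<in>{1..n}. \<not> card {j \<in> {1..n} - {i}. x j \<in> cball (x i) (ball_radius (v n) (x i))} < k)"
proof -
  note g = goodD[OF assms(1)]
  have "max_knn_ball_measure \<mu> x n k \<le> v n
      \<longleftrightarrow> (\<forall>i\<in>{1..n}. prob (cball (x i) (knn_dist x i n k)) \<le> v n)"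
    unfolding max_knn_ball_measure_def using g(1) by (subst Max_le_iff) auto
  also have "\<dots> \<longleftrightarrow> (\<forall>i\<in>{1..n}. knn_dist x i n k \<le> ball_radius (v n) (x i))"
    by (simp only: le_ball_radius_iff[OF g(3,4)])
  also have "\<dots> \<longleftrightarrow> (\<forall>i\<in>{1..n}. \<not> card {j \<in> {1..n} - {i}. x j \<in> cball (x i) (ball_radius (v n) (x i))} < k)"
    using k assms(2) by (intro ball_cong refl) (simp only: knn_dist_le_iff not_less)
  finally show ?thesis .
qed

text \<open>Measurability is read off the counting form of the event. The two events can differ only
  when some centre lies outside the cube, since \<open>sparse_points\<close> ignores such centres;
  this has probability zero.\<close>

lemma max_knn_event:
  assumes "good n" "k < n"
  shows "{x \<in> space (sample n). max_knn_ball_measure \<mu> x n k \<le> v n} \<in> sets (sample n)"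
    and "measure (sample n) {x \<in> space (sample n). max_knn_ball_measure \<mu> x n k \<le> v n}
      = measure (sample n) {x \<in> space (sample n). card (V n x) = 0}"
proof -
  interpret K: knn_scale \<mu> Q "ball_radius (v n)" "v n" "s n" "p n" k n
    by (rule knn_scale_good[OF assms(1)])
  interpret P: prob_space "sample n" by (rule K.prob_space_sample)
  show m: "{x \<in> space (sample n). max_knn_ball_measure \<mu> x n k \<le> v n} \<in> sets (sample n)"
    unfolding max_knn_le_iff[OF assms]
    by (intro predE pred_intros_finite(3) pred_intros_logic(2) K.pred_card_ball) auto
  have V0: "card (V n x) = 0 \<longleftrightarrow> V n x = {}" for x by (simp add: sparse_points_def)
  have m0: "{x \<in> space (sample n). card (V n x) = 0} \<in> sets (sample n)"
  proof -
    have eq: "{x \<in> space (sample n). card (V n x) = 0} = (\<lambda>x. card (V n x)) -` {0} \<inter> space (sample n)" by auto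
    show ?thesis unfolding eq using K.measurable_card_V by (rule measurable_sets) simp
  qed
  have "AE x in \<mu>. x \<in> Q" using AE_prob_1[of Q] prob_cube by simp
  then have "AE x in sample n. x i \<in> Q" if "i \<in> {1..n}" for i
    using that by (intro AE_PiM_component prob_space_axioms)
  then have "AE x in sample n. \<forall>i\<in>{1..n}. x i \<in> Q" by (intro AE_finite_allI) auto
  then have "AE x in sample n. x \<in> {x \<in> space (sample n). max_knn_ball_measure \<mu> x n k \<le> v n}
      \<longleftrightarrow> x \<in> {x \<in> space (sample n). card (V n x) = 0}"
  proof (rule AE_mp, intro AE_I2 impI)
    fix x assume "x \<in> space (sample n)" "\<forall>i\<in>{1..n}. x i \<in> Q"
    then show "x \<in> {x \<in> space (sample n). max_knn_ball_measure \<mu> x n k \<le> v n}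
      \<longleftrightarrow> x \<in> {x \<in> space (sample n). card (V n x) = 0}"
      unfolding mem_Collect_eq max_knn_le_iff[OF assms] V0 unfolding sparse_points_def by blast
  qed
  then show "measure (sample n) {x \<in> space (sample n). max_knn_ball_measure \<mu> x n k \<le> v n}
      = measure (sample n) {x \<in> space (sample n). card (V n x) = 0}"
    using m m0 by (rule P.finite_measure_eq_AE)
qed

text \<open>Independence and equality of laws give the restricted sample the product law on
  \<open>{1..n}\<close>, so the event can be measured there.\<close>

lemma max_knn_limit:
  fixes M :: "'w measure" and X :: "nat \<Rightarrow> 'w \<Rightarrow> 'a"
  assumes "prob_space M" and indep: "prob_space.indep_vars M (\<lambda>_. borel) X {1..}"
    and dist: "\<And>i. 1 \<le> i \<Longrightarrow> distr M borel (X i) = \<mu>"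
  shows "(\<lambda>n. measure M {\<omega> \<in> space M. max_knn_ball_measure \<mu> (\<lambda>i. X i \<omega>) n k \<le> y n / real n})
    \<longlonglongrightarrow> exp (- \<eta>)"
proof -
  interpret M: prob_space M by fact
  have "\<forall>\<^sub>F n in sequentially. measure (sample n) {x \<in> space (sample n). card (V n x) = 0}
      = measure M {\<omega> \<in> space M. max_knn_ball_measure \<mu> (\<lambda>i. X i \<omega>) n k \<le> y n / real n}"
    using eventually_good eventually_gt_at_top[of k]
  proof eventually_elim
    case (elim n)
    let ?Y = "\<lambda>\<omega>. \<lambda>i\<in>{1..n}. X i \<omega>"
    let ?E = "{x \<in> space (sample n). max_knn_ball_measure \<mu> x n k \<le> v n}"
    have ind: "M.indep_vars (\<lambda>_. borel) X {1..n}" by (rule M.indep_vars_subset[OF indep]) auto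
    then have rv: "X i \<in> borel_measurable M" if "i \<in> {1..n}" for i
      using that by (auto simp: M.indep_vars_def)
    have "{1..n} \<noteq> {}" using goodD(1)[OF elim(1)] by auto
    from M.indep_vars_iff_distr_eq_PiM'[OF this, of X "\<lambda>_. borel", OF rv] ind
    have "distr M (PiM {1..n} (\<lambda>_. borel)) ?Y = PiM {1..n} (\<lambda>i. distr M borel (X i))" by simp
    also have "\<dots> = sample n" using dist by (intro PiM_cong refl) auto
    finally have distr_eq: "distr M (PiM {1..n} (\<lambda>_. borel)) ?Y = sample n" .
    have Ym: "?Y \<in> measurable M (PiM {1..n} (\<lambda>_. borel))" using rv by (intro measurable_restrict)
    have sets_eq: "sets (sample n) = sets (PiM {1..n} (\<lambda>_. borel))"
      by (intro sets_PiM_cong refl sets_mu)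
    have "measure (sample n) {x \<in> space (sample n). card (V n x) = 0} = measure (sample n) ?E"
      using max_knn_event(2)[OF elim] by simp
    also have "\<dots> = measure (distr M (PiM {1..n} (\<lambda>_. borel)) ?Y) ?E" by (simp only: distr_eq)
    also have "\<dots> = measure M (?Y -` ?E \<inter> space M)"
      using max_knn_event(1)[OF elim] by (intro measure_distr Ym) (simp only: sets_eq)
    also have "?Y -` ?E \<inter> space M = {\<omega> \<in> space M. max_knn_ball_measure \<mu> (\<lambda>i. X i \<omega>) n k \<le> y n / real n}"
    proof -
      have "max_knn_ball_measure \<mu> (?Y \<omega>) n k = max_knn_ball_measure \<mu> (\<lambda>i. X i \<omega>) n k" for \<omega>
        by (rule max_knn_ball_measure_cong) simp
      moreover have "?Y \<omega> \<in> space (sample n)" if "\<omega> \<in> space M" for \<omega>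
        using measurable_space[OF Ym that] sets_eq_imp_space_eq[OF sets_eq] by simp
      ultimately show ?thesis by (auto simp: v_def)
    qed
    finally show ?case .
  qed
  from Lim_transform_eventually[OF void_limit this] show ?thesis .
qed

end

section \<open>Mass comparisons from the density\<close>

lemma emeasure_compl_measure_support:
  fixes \<mu> :: "'a::second_countable_topology measure"
  assumes "sets \<mu> = sets borel"
  shows "emeasure \<mu> (- measure_support \<mu>) = 0"
proof -
  \<comment> \<open>The complement of the support is a union of null open sets; a countable basis
    makes the union countable, hence null.\<close>
  obtain B :: "'a set set" where B: "countable B" "topological_basis B"
    using ex_countable_basis by auto
  define N where "N = {U \<in> B. emeasure \<mu> U = 0}"
  have open_N: "open U" if "U \<in> N" for U using that B(2) by (auto simp: N_def topological_basis_open)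
  have "- measure_support \<mu> \<subseteq> \<Union>N"
  proof
    fix x assume "x \<in> - measure_support \<mu>"
    then obtain U where U: "open U" "x \<in> U" "emeasure \<mu> U = 0" by (auto simp: measure_support_def)
    obtain U' where U': "U' \<in> B" "x \<in> U'" "U' \<subseteq> U" using topological_basisE[OF B(2) U(1,2)] .
    have "emeasure \<mu> U' \<le> emeasure \<mu> U" using U'(3) U(1) assms by (intro emeasure_mono) auto
    then show "x \<in> \<Union>N" using U U' by (auto simp: N_def)
  qed
  moreover have "emeasure \<mu> (\<Union>N) = 0"
  proof -
    have "N \<subseteq> B" by (auto simp: N_def)
    then have cN: "countable N" using B(1) countable_subset by blast
    have "(\<Union>U\<in>N. U) \<in> null_sets \<mu>"
      using cN open_N assms by (intro null_sets_UN') (auto simp: null_sets_def N_def)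
    then show ?thesis by (simp add: null_sets_def)
  qed
  moreover have "\<Union>N \<in> sets \<mu>" using open_N assms by (simp add: open_Union)
  ultimately show ?thesis by (metis emeasure_mono le_zero_eq)
qed

text \<open>The pointwise bounds on \<open>f\<close> speak only of the cube, but the complement of
  the support is null. This extends the upper bound on the cube to a comparison for all sets of
  finite volume.\<close>

lemma cube_measure_density:
  fixes \<mu> :: "'a::euclidean_space measure" and f :: "'a \<Rightarrow> real"
  assumes "prob_space \<mu>" and f: "f \<in> borel_measurable borel" and \<mu>: "\<mu> = density lborel (\<lambda>x. ennreal (f x))"
    and supp: "measure_support \<mu> = cbox 0 One" and fl: "0 < fl" and fu: "0 < fu"
    and bounds: "\<And>x. x \<in> cbox 0 One \<Longrightarrow> fl \<le> f x \<and> f x \<le> fu"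
  shows "cube_measure \<mu> fl fu (unit_ball_vol (real DIM('a))) DIM('a)"
proof -
  interpret prob_space \<mu> by fact
  let ?Q = "cbox 0 One :: 'a set"
  have sets_mu: "sets \<mu> = sets borel" by (simp add: \<mu>)
  have space_mu: "space \<mu> = UNIV" by (simp add: \<mu>)
  have null: "prob (- ?Q) = 0"
    using emeasure_compl_measure_support[OF sets_mu] by (simp add: supp measure_def)
  have Q1: "prob ?Q = 1" using prob_compl[of ?Q] null by (simp add: space_mu sets_mu Compl_eq_Diff_UNIV)
  have em: "emeasure \<mu> A = (\<integral>\<^sup>+x. ennreal (f x) * indicator A x \<partial>lborel)" if "A \<in> sets borel" for A
    unfolding \<mu> using f that by (intro emeasure_density) auto
  show ?thesis
  proof (unfold_locales, goal_cases)
    case (6 A)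
    have "ennreal (fl * measure lborel A) = ennreal fl * emeasure lborel A"
    proof -
      have "emeasure lborel A \<le> emeasure lborel ?Q" using 6 by (intro emeasure_mono) auto
      then have "emeasure lborel A < \<infinity>" using emeasure_lborel_cbox_finite[of 0 "One::'a"] by (rule le_less_trans)
      then show ?thesis using fl by (simp add: emeasure_eq_ennreal_measure ennreal_mult)
    qed
    also have "\<dots> = (\<integral>\<^sup>+x. ennreal fl * indicator A x \<partial>lborel)"
      using 6 by (simp add: nn_integral_cmult_indicator)
    also have "\<dots> \<le> (\<integral>\<^sup>+x. ennreal (f x) * indicator A x \<partial>lborel)"
      using 6 bounds by (intro nn_integral_mono) (auto simp: indicator_def intro!: ennreal_leI)
    also have "\<dots> = ennreal (prob A)" using em[OF 6(1)] by (simp add: emeasure_eq_measure)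
    finally show ?case by (simp add: ennreal_le_iff)
  next
    case (7 A)
    have "prob A \<le> prob (A \<inter> ?Q) + prob (- ?Q)"
    proof -
      have "prob A \<le> prob ((A \<inter> ?Q) \<union> - ?Q)" using 7 by (intro finite_measure_mono) (auto simp: sets_mu)
      also have "\<dots> \<le> prob (A \<inter> ?Q) + prob (- ?Q)" using 7 by (intro measure_Un_le) (auto simp: sets_mu)
      finally show ?thesis .
    qed
    then have AQ: "prob A \<le> prob (A \<inter> ?Q)" using null by simp
    have "ennreal (prob (A \<inter> ?Q)) = (\<integral>\<^sup>+x. ennreal (f x) * indicator (A \<inter> ?Q) x \<partial>lborel)"
      using em[of "A \<inter> ?Q"] 7 by (simp add: emeasure_eq_measure)
    also have "\<dots> \<le> (\<integral>\<^sup>+x. ennreal fu * indicator A x \<partial>lborel)"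
      using bounds by (intro nn_integral_mono) (auto simp: indicator_def intro!: ennreal_leI)
    also have "\<dots> = ennreal fu * emeasure lborel A"
      using 7 by (simp add: nn_integral_cmult_indicator)
    also have "\<dots> = ennreal (fu * measure lborel A)"
      using 7 fu by (simp add: emeasure_eq_ennreal_measure ennreal_mult)
    finally have "prob (A \<inter> ?Q) \<le> fu * measure lborel A" using fu by (simp add: ennreal_le_iff)
    then show ?case using AQ by linarith
  qed (use fl fu Q1 sets_mu in auto)
qed

theorem corollary1p4:
  fixes M :: "'w measure"
    and X :: "nat \<Rightarrow> 'w \<Rightarrow> real ^ 'd"
    and \<mu> :: "(real ^ 'd) measure"
    and f :: "real ^ 'd \<Rightarrow> real"
    and f_minus f_plus t :: real
    and k :: nat
  assumes "prob_space M"
    and "prob_space.indep_vars M (\<lambda>_. borel) X {1..}"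
    and "\<And>i. 1 \<le> i \<Longrightarrow> distr M borel (X i) = \<mu>"
    and "f \<in> borel_measurable borel"
    and "\<And>x. 0 \<le> f x"
    and "\<mu> = density lborel (\<lambda>x. ennreal (f x))"
    and "measure_support \<mu> = {x. \<forall>j. 0 \<le> x $ j \<and> x $ j \<le> 1}"
    and "0 < f_minus" and "0 < f_plus"
    and "\<And>x. (\<forall>j. 0 \<le> x $ j \<and> x $ j \<le> 1) \<Longrightarrow> f_minus \<le> f x \<and> f x \<le> f_plus"
    and "1 \<le> k"
  shows "(\<lambda>n. measure M {\<omega> \<in> space M.
            real n * max_knn_ball_measure \<mu> (\<lambda>i. X i \<omega>) n k
              - ln (real n) - (real k - 1) * ln (ln (real n)) + ln (fact (k - 1)) \<le> t})
          \<longlonglongrightarrow> exp (- exp (- t))"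
proof -
  interpret M: prob_space M by fact
  \<comment> \<open>The statement describes the cube by coordinates, whereas \<open>One\<close> is
    the sum of the basis vectors; its coordinates must first be seen to be 1.\<close>
  have cube: "{x :: real ^ 'd. \<forall>j. 0 \<le> x $ j \<and> x $ j \<le> 1} = cbox 0 One"
  proof -
    have "One $ j = (1::real)" for j :: 'd
    proof -
      have "(axis j 1 :: real ^ 'd) \<in> Basis" by (simp add: axis_in_Basis_iff)
      then have "(One :: real ^ 'd) \<bullet> axis j 1 = 1" by simp
      then show ?thesis by (simp add: inner_axis)
    qed
    then show ?thesis by (auto simp: mem_box_cart)
  qed
  have "X 1 \<in> borel_measurable M" using assms(2) by (auto simp: M.indep_vars_def)
  then have "prob_space \<mu>" using M.prob_space_distr[of "X 1" borel] assms(3)[of 1] by simp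
  moreover have "f_minus \<le> f x \<and> f x \<le> f_plus" if "x \<in> cbox 0 One" for x
    using assms(10)[of x] that unfolding cube[symmetric] by simp
  ultimately interpret C: cube_measure \<mu> f_minus f_plus "unit_ball_vol (real DIM(real ^ 'd))" "DIM(real ^ 'd)"
    using assms(4,6,8,9) assms(7)[unfolded cube] by (intro cube_measure_density[of \<mu> f])
  define y where "y n = t + ln (real n) + (real k - 1) * ln (ln (real n)) - ln (fact (k - 1))" for n
  interpret Y: critical_mass y k "exp (- t)"
    unfolding y_def by (rule critical_mass_gumbel[OF assms(11)])
  interpret K: cube_knn \<mu> f_minus f_plus "unit_ball_vol (real DIM(real ^ 'd))" "DIM(real ^ 'd)" y k "exp (- t)" ..
  \<comment> \<open>For positive \<open>n\<close>, centring the rescaled maximum by the logarithmic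
    terms amounts to comparing the maximum with \<open>y n / real n\<close>.\<close>
  have "\<forall>\<^sub>F n in sequentially.
      measure M {\<omega> \<in> space M. max_knn_ball_measure \<mu> (\<lambda>i. X i \<omega>) n k \<le> y n / real n}
      = measure M {\<omega> \<in> space M. real n * max_knn_ball_measure \<mu> (\<lambda>i. X i \<omega>) n k
          - ln (real n) - (real k - 1) * ln (ln (real n)) + ln (fact (k - 1)) \<le> t}"
    using eventually_gt_at_top[of 0]
  proof eventually_elim
    case (elim n)
    have "z \<le> y n / real n \<longleftrightarrow> real n * z - ln (real n) - (real k - 1) * ln (ln (real n)) + ln (fact (k - 1)) \<le> t" for z
    proof -
      have "z \<le> y n / real n \<longleftrightarrow> real n * z \<le> y n" using elim by (simp add: pos_le_divide_eq mult.commute)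
      then show ?thesis unfolding y_def by linarith
    qed
    then show ?case by (simp only:)
  qed
  from Lim_transform_eventually[OF K.max_knn_limit[OF assms(1-3)] this] show ?thesis .
qed

end
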